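(* Let $\mu$ be a stochastic measure on $\mathcal{B}([0,2\pi])$. Assume that there exists a real-valued finite measure $\mathsf{m}$ on $([0,2\pi],\mathcal{B}([0,2\pi]))$ with the following property: if a measurable function $g:[0,2\pi]\to\mathbb{R}$ is such that $\int_{[0,2\pi]}2^{\lambda|g|}\,d\mathsf{m}<+\infty$ for all real $\lambda>0$, then $g$ is integrable with respect to $\mu$ on $[0,2\pi]$. Define random variables $$\xi_0=2\mu((0,2\pi])-\frac1\pi\int_{(0,2\pi]}s\,d\mu(s),\qquad \xi_k=-\frac{1}{k\pi}\int_{(0,2\pi]}\sin ks\,d\mu(s),\qquad \eta_k=\frac{1}{k\pi}\int_{(0,2\pi]}(\cos ks-1)\,d\mu(s),\quad k\ge1,$$ and $$S_n(t)=\frac{\xi_0}{2}+\sum_{k=1}^n(\xi_k\cos kt+\eta_k\sin kt),\qquad t\in[0,2\pi],\ n\ge 1.$$ Then $$\mathsf{P}\bigl[S_n(t)\text{ converges as } n\to\infty \text{ for Lebesgue-almost every } t\in[0,2\pi]\bigr]=1.$$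
   Context: Let $(\Omega,\mathcal{F},\mathsf{P})$ be a complete probability space and $\mathsf{L}_0=\mathsf{L}_0(\Omega,\mathcal{F},\mathsf{P})$ the set of all real-valued random variables on it, with convergence in probability. For a measurable space $(\mathsf{X},\mathcal{B})$, a stochastic measure (SM) is a $\sigma$-additive mapping $\mu:\mathcal{B}\to\mathsf{L}_0$ (i.e. for pairwise disjoint $A_n\in\mathcal{B}$, $\mu(\bigcup_n A_n)=\sum_n\mu(A_n)$ with the series converging in probability). No moment existence or martingale property is assumed. $\mathcal{B}([0,2\pi])$ denotes the Borel $\sigma$-algebra. Integral of deterministic functions: for a simple measurable function $f=\sum_i c_i\mathbf{1}_{A_i}$ and $A\in\mathcal{B}$ set $\int_A f\,d\mu=\sum_i c_i\,\mu(A\cap A_i)$. A measurable $g:\mathsf{X}\to\mathbb{R}$ is integrable with respect to $\mu$ on $\mathsf{X}$ if there are simple functions $g_n\to g$ pointwise such that for every $A\in\mathcal{B}$ the sequence $\int_A g_n\,d\mu$ converges in probability; the limit is denoted $\int_A g\,d\mu$ (it does not depend on the choice of the sequence). Every bounded measurable function is integrable with respect to any SM. *)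

theory Defs
  imports "HOL-Probability.Probability"
begin

text \<open>Random variables are represented by measurable functions; equality and limits in
  $L_0$ are therefore meant up to almost sure equality.\<close>

definition conv_in_prob :: "'a measure \<Rightarrow> (nat \<Rightarrow> 'a \<Rightarrow> real) \<Rightarrow> ('a \<Rightarrow> real) \<Rightarrow> bool" where
  "conv_in_prob M \<xi> \<zeta> \<longleftrightarrow>
     (\<forall>\<epsilon>>0. (\<lambda>n. measure M {\<omega> \<in> space M. \<bar>\<xi> n \<omega> - \<zeta> \<omega>\<bar> > \<epsilon>}) \<longlonglongrightarrow> 0)"

text \<open>Only the underlying \<open>\<sigma>\<close>-algebra of \<open>X\<close> is relevant in the following definitions,
  not the measure it carries.\<close>

definition stochastic_measure :: "'a measure \<Rightarrow> 'x measure \<Rightarrow> ('x set \<Rightarrow> 'a \<Rightarrow> real) \<Rightarrow> bool" where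
  "stochastic_measure M X \<mu> \<longleftrightarrow>
     (\<forall>A\<in>sets X. \<mu> A \<in> borel_measurable M) \<and>
     (\<forall>A :: nat \<Rightarrow> 'x set. range A \<subseteq> sets X \<longrightarrow> disjoint_family A \<longrightarrow>
        conv_in_prob M (\<lambda>n \<omega>. \<Sum>i<n. \<mu> (A i) \<omega>) (\<mu> (\<Union>i. A i)))"

text \<open>The canonical representation \<open>f = (\<Sum>y\<in>f ` space X. y * indicator (f -` {y} \<inter> space X))\<close>
  is used, as in \<^const>\<open>simple_integral\<close>; any other representation as a linear combination
  of indicators gives the same random variable almost surely.\<close>

definition sm_simple_integral ::
    "'x measure \<Rightarrow> ('x set \<Rightarrow> 'a \<Rightarrow> real) \<Rightarrow> 'x set \<Rightarrow> ('x \<Rightarrow> real) \<Rightarrow> 'a \<Rightarrow> real" where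
  "sm_simple_integral X \<mu> A f \<omega> =
     (\<Sum>y\<in>f ` space X. y * \<mu> (A \<inter> (f -` {y} \<inter> space X)) \<omega>)"

definition sm_approximation ::
    "'a measure \<Rightarrow> 'x measure \<Rightarrow> ('x set \<Rightarrow> 'a \<Rightarrow> real) \<Rightarrow> ('x \<Rightarrow> real) \<Rightarrow> (nat \<Rightarrow> 'x \<Rightarrow> real) \<Rightarrow> bool" where
  "sm_approximation M X \<mu> g gs \<longleftrightarrow>
     (\<forall>n. simple_function X (gs n)) \<and>
     (\<forall>x\<in>space X. (\<lambda>n. gs n x) \<longlonglongrightarrow> g x) \<and>
     (\<forall>A\<in>sets X. \<exists>\<zeta>\<in>borel_measurable M.
        conv_in_prob M (\<lambda>n. sm_simple_integral X \<mu> A (gs n)) \<zeta>)"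

definition sm_integrable ::
    "'a measure \<Rightarrow> 'x measure \<Rightarrow> ('x set \<Rightarrow> 'a \<Rightarrow> real) \<Rightarrow> ('x \<Rightarrow> real) \<Rightarrow> bool" where
  "sm_integrable M X \<mu> g \<longleftrightarrow>
     g \<in> borel_measurable X \<and> (\<exists>gs. sm_approximation M X \<mu> g gs)"

text \<open>The value is independent of the approximating sequence up to almost sure equality, so the
  choice below only fixes a version; it is meaningful only for integrable \<open>g\<close> and \<open>A \<in> sets X\<close>.\<close>

definition sm_integral ::
    "'a measure \<Rightarrow> 'x measure \<Rightarrow> ('x set \<Rightarrow> 'a \<Rightarrow> real) \<Rightarrow> 'x set \<Rightarrow> ('x \<Rightarrow> real) \<Rightarrow> 'a \<Rightarrow> real" where
  "sm_integral M X \<mu> A g =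
     (SOME \<zeta>. \<zeta> \<in> borel_measurable M \<and>
        (\<exists>gs. sm_approximation M X \<mu> g gs \<and>
              conv_in_prob M (\<lambda>n. sm_simple_integral X \<mu> A (gs n)) \<zeta>))"

end

theory Submission
  imports Defs
begin

text \<open>
  Up to the factor \<open>1 / (k * pi)\<close> the coefficients of the series are the random variables
  \<open>x k\<close> obtained by integrating \<open>sin (k * s)\<close> or \<open>cos (k * s) - 1\<close> over \<open>(0, 2 * pi]\<close>. A
  trigonometric series with coefficients \<open>c k\<close> converges almost everywhere as soon as
  \<open>k powr (3/4) * (c k)\<^sup>2\<close> is summable: orthogonality controls the partial sums along the
  squares, and between two consecutive squares the Cauchy-Schwarz inequality suffices
  (\<open>orthogonal_series_converges_AE\<close>). So the theorem follows once
  \<open>(k powr (-5/8) * x k)\<^sup>2\<close> is shown to be summable almost surely.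

  This is a statement about random signs. By the argument of Salem and Zygmund the signed sums
  of the functions \<open>k powr (-5/8) * sin (k * s)\<close> are bounded, uniformly in \<open>s\<close> and in the number
  of terms, with probability close to 1 in the choice of the signs (\<open>salem_zygmund\<close>). The
  integral of a function with values in \<open>[-C, C]\<close> is bounded in probability by a multiple of
  \<open>C\<close>, where the multiple depends only on the stochastic measure and on the probability allowed for
  exceptions (\<open>sint_bounded_in_prob\<close>,
  \<open>integral_limit_bounded\<close>). Hence the signed sums of the \<open>k powr (-5/8) * x k\<close> are bounded in
  probability, jointly in the signs and in \<open>\<omega>\<close>, and the Paley-Zygmund inequality turns this
  into a bound for the sum of their squares (\<open>square_summable_coefficients\<close>). The exponential
  class of the theorem contains the bounded functions, which makes the integrals of
  \<open>sin (k * s)\<close> and \<open>cos (k * s) - 1\<close> meaningful.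

  The main work is the theorem of Talagrand and of Kalton, Peck and Roberts that the range of a
  stochastic measure is bounded in probability (\<open>range_bounded_in_prob\<close>). No norm is available
  here, and the usual argument, which splits off from an unbounded set a part of large measure
  and keeps an unbounded remainder, loses a fixed proportion of the probability at every step.
  The remedy is to split off a random set that contains each point with small probability only:
  then the remainder stays unbounded on nearly the same event, while the measure of the part
  split off is still at least 1 with a probability bounded below. Such a set is found in a fine
  partition whose cells are selected independently. Either the squares of the measures of the
  cells, cut off at 1, have a large sum, and then a sparse random selection of the cells already
  has large measure by the Paley-Zygmund inequality; or some set of large measure is made up of
  cells with a small sum of squares, and then Chebyshev's inequality shows that a sparse
  selection inherits a multiple of its measure (\<open>weighted_thinning_large\<close>). Repeating the step
  gives disjoint sets whose measures do not tend to 0 in probability, which contradicts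
  \<open>\<sigma>\<close>-additivity.

  Since the approximating sequence in the definition of the integral is arbitrary, bounds for
  simple functions pass to the integral only where the sequence is bounded. The exceptional sets
  decrease to the empty set, and the Nikodym convergence theorem (\<open>nikodym_convergence\<close>) shows
  that their contribution disappears.
\<close>

section \<open>Random subsets of a finite index set\<close>

text \<open>The average of \<open>F\<close> over the random subset of \<open>I\<close> that contains each \<open>i\<close> independently with
  probability \<open>q i\<close>. A weighted sum over the power set keeps independence elementary: averages
  split along disjoint index sets, and interchanging them with integrals over \<open>\<Omega>\<close> is linearity.\<close>

definition subset_avg :: "'i set \<Rightarrow> ('i \<Rightarrow> real) \<Rightarrow> ('i set \<Rightarrow> real) \<Rightarrow> real" where
  "subset_avg I q F = (\<Sum>S\<in>Pow I. (\<Prod>i\<in>S. q i) * (\<Prod>i\<in>I - S. 1 - q i) * F S)"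

lemma subset_avg_empty [simp]: "subset_avg {} q F = F {}"
  by (simp add: subset_avg_def)

lemma subset_avg_insert:
  assumes "finite I" "x \<notin> I"
  shows "subset_avg (insert x I) q F = q x * subset_avg I q (\<lambda>S. F (insert x S)) + (1 - q x) * subset_avg I q F"
proof -
  let ?w = "\<lambda>J S. (\<Prod>i\<in>S. q i) * (\<Prod>i\<in>J - S. 1 - q i) * F S"
  have inj: "inj_on (insert x) (Pow I)"
    using assms(2) by (auto simp: inj_on_def)
  have "subset_avg (insert x I) q F
      = (\<Sum>S\<in>Pow I. ?w (insert x I) S) + (\<Sum>S\<in>insert x ` Pow I. ?w (insert x I) S)"
    unfolding subset_avg_def Pow_insert
    by (rule sum.union_disjoint) (use assms in auto)
  also have "(\<Sum>S\<in>insert x ` Pow I. ?w (insert x I) S) = (\<Sum>S\<in>Pow I. ?w (insert x I) (insert x S))"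
    by (simp add: sum.reindex[OF inj])
  also have "\<dots> = (\<Sum>S\<in>Pow I. q x * ((\<Prod>i\<in>S. q i) * (\<Prod>i\<in>I - S. 1 - q i) * F (insert x S)))"
  proof (rule sum.cong)
    fix S assume "S \<in> Pow I"
    then have "finite S" "x \<notin> S" "insert x I - insert x S = I - S"
      using assms finite_subset by auto
    then show "?w (insert x I) (insert x S)
        = q x * ((\<Prod>i\<in>S. q i) * (\<Prod>i\<in>I - S. 1 - q i) * F (insert x S))" by simp
  qed simp
  also have "(\<Sum>S\<in>Pow I. ?w (insert x I) S) = (\<Sum>S\<in>Pow I. (1 - q x) * ?w I S)"
  proof (rule sum.cong)
    fix S assume "S \<in> Pow I"
    then have "insert x I - S = insert x (I - S)" "x \<notin> I - S" "finite (I - S)"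
      using assms by auto
    then show "?w (insert x I) S = (1 - q x) * ?w I S" by simp
  qed simp
  finally show ?thesis
    by (simp add: subset_avg_def sum_distrib_left)
qed

lemma subset_avg_add: "subset_avg I q (\<lambda>S. F S + G S) = subset_avg I q F + subset_avg I q G"
  by (simp add: subset_avg_def algebra_simps sum.distrib)

lemma subset_avg_cmult: "subset_avg I q (\<lambda>S. c * F S) = c * subset_avg I q F"
  by (simp add: subset_avg_def algebra_simps sum_distrib_left)

lemma subset_avg_diff: "subset_avg I q (\<lambda>S. F S - G S) = subset_avg I q F - subset_avg I q G"
  by (simp add: subset_avg_def algebra_simps sum_subtractf)

lemma subset_avg_sum: "subset_avg I q (\<lambda>S. \<Sum>k\<in>K. F k S) = (\<Sum>k\<in>K. subset_avg I q (F k))"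
  unfolding subset_avg_def sum_distrib_left by (rule sum.swap)

lemma subset_avg_cong:
  assumes "\<And>S. S \<subseteq> I \<Longrightarrow> F S = G S" "\<And>i. i \<in> I \<Longrightarrow> q i = r i"
  shows "subset_avg I q F = subset_avg I r G"
  unfolding subset_avg_def
proof (rule sum.cong)
  fix S assume "S \<in> Pow I"
  then have "(\<Prod>i\<in>S. q i) = (\<Prod>i\<in>S. r i)" "(\<Prod>i\<in>I - S. 1 - q i) = (\<Prod>i\<in>I - S. 1 - r i)"
    using assms(2) by (auto intro!: prod.cong)
  then show "(\<Prod>i\<in>S. q i) * (\<Prod>i\<in>I - S. 1 - q i) * F S = (\<Prod>i\<in>S. r i) * (\<Prod>i\<in>I - S. 1 - r i) * G S"
    using assms(1) \<open>S \<in> Pow I\<close> by auto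
qed simp

lemma subset_avg_mono:
  assumes "\<And>i. i \<in> I \<Longrightarrow> 0 \<le> q i \<and> q i \<le> 1" "\<And>S. S \<subseteq> I \<Longrightarrow> F S \<le> G S"
  shows "subset_avg I q F \<le> subset_avg I q G"
  unfolding subset_avg_def
proof (rule sum_mono)
  fix S assume "S \<in> Pow I"
  then have "0 \<le> (\<Prod>i\<in>S. q i) * (\<Prod>i\<in>I - S. 1 - q i)"
    using assms(1) by (intro mult_nonneg_nonneg prod_nonneg) auto
  then show "(\<Prod>i\<in>S. q i) * (\<Prod>i\<in>I - S. 1 - q i) * F S
      \<le> (\<Prod>i\<in>S. q i) * (\<Prod>i\<in>I - S. 1 - q i) * G S"
    using assms(2) \<open>S \<in> Pow I\<close> by (auto intro: mult_left_mono)
qed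

lemma subset_avg_const [simp]:
  assumes "finite I" shows "subset_avg I q (\<lambda>_. c) = c"
  using assms by (induction I) (simp_all add: subset_avg_insert algebra_simps)

lemma subset_avg_union:
  assumes "finite I" "finite J" "I \<inter> J = {}"
  shows "subset_avg (I \<union> J) q F = subset_avg I q (\<lambda>S. subset_avg J q (\<lambda>T. F (S \<union> T)))"
  using assms(1,3)
proof (induction I arbitrary: F)
  case (insert x I)
  then have "x \<notin> I \<union> J" "finite (I \<union> J)" using assms by auto
  then show ?case using insert
    by (simp add: subset_avg_insert)
qed simp

text \<open>Thinning twice multiplies the selection probabilities.\<close>

lemma subset_avg_compose:
  assumes "finite I"
  shows "subset_avg I (\<lambda>i. r i * s i) F = subset_avg I r (\<lambda>S. subset_avg S s F)"
  using assms
proof (induction I arbitrary: F)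
  case (insert x I)
  have "subset_avg I r (\<lambda>S. subset_avg (insert x S) s F)
      = subset_avg I r (\<lambda>S. s x * subset_avg S s (\<lambda>S. F (insert x S)) + (1 - s x) * subset_avg S s F)"
  proof (rule subset_avg_cong)
    fix S assume "S \<subseteq> I"
    then show "subset_avg (insert x S) s F = s x * subset_avg S s (\<lambda>S. F (insert x S)) + (1 - s x) * subset_avg S s F"
      using insert(1,2) finite_subset by (intro subset_avg_insert) auto
  qed simp
  then have *: "subset_avg I r (\<lambda>S. subset_avg (insert x S) s F)
      = s x * subset_avg I r (\<lambda>S. subset_avg S s (\<lambda>S. F (insert x S))) + (1 - s x) * subset_avg I r (\<lambda>S. subset_avg S s F)"
    by (simp only: subset_avg_add subset_avg_cmult)
  have "subset_avg (insert x I) (\<lambda>i. r i * s i) F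
      = r x * s x * subset_avg I r (\<lambda>S. subset_avg S s (\<lambda>S. F (insert x S)))
        + (1 - r x * s x) * subset_avg I r (\<lambda>S. subset_avg S s F)"
    by (simp only: subset_avg_insert[OF insert(1,2)] insert.IH)
  also have "\<dots> = r x * subset_avg I r (\<lambda>S. subset_avg (insert x S) s F) + (1 - r x) * subset_avg I r (\<lambda>S. subset_avg S s F)"
    unfolding * by (simp add: algebra_simps)
  also have "\<dots> = subset_avg (insert x I) r (\<lambda>S. subset_avg S s F)"
    by (simp only: subset_avg_insert[OF insert(1,2)])
  finally show ?case .
qed simp

lemma subset_avg_member:
  assumes "finite I" "i \<in> I"
  shows "subset_avg I q (\<lambda>S. of_bool (i \<in> S)) = q i"
proof -
  have "I = insert i (I - {i})" using assms by auto
  then have "subset_avg I q (\<lambda>S. of_bool (i \<in> S))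
     = q i * subset_avg (I - {i}) q (\<lambda>S. 1) + (1 - q i) * subset_avg (I - {i}) q (\<lambda>S. of_bool (i \<in> S))"
    using assms subset_avg_insert[of "I - {i}" i q "\<lambda>S. of_bool (i \<in> S)"] by simp
  also have "subset_avg (I - {i}) q (\<lambda>S. of_bool (i \<in> S)) = subset_avg (I - {i}) q (\<lambda>S. 0)"
    by (rule subset_avg_cong) auto
  finally show ?thesis using assms by simp
qed

lemma subset_avg_ex:
  assumes "finite I" "\<And>i. i \<in> I \<Longrightarrow> 0 \<le> q i \<and> q i \<le> 1"
  shows "\<exists>S\<subseteq>I. subset_avg I q F \<le> F S"
proof (rule ccontr)
  assume "\<not> ?thesis"
  then have less: "\<And>S. S \<subseteq> I \<Longrightarrow> F S < subset_avg I q F" by (auto simp: not_le)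
  define c where "c = Max (F ` Pow I)"
  have "c < subset_avg I q F" unfolding c_def using assms less by (subst Max_less_iff) auto
  moreover have "subset_avg I q F \<le> subset_avg I q (\<lambda>_. c)"
    by (rule subset_avg_mono) (use assms in \<open>auto simp: c_def\<close>)
  ultimately show False using assms by simp
qed

definition centred_sum :: "'i set \<Rightarrow> ('i \<Rightarrow> real) \<Rightarrow> ('i \<Rightarrow> real) \<Rightarrow> 'i set \<Rightarrow> real" where
  "centred_sum I q y S = (\<Sum>i\<in>S. y i) - (\<Sum>i\<in>I. q i * y i)"

lemma centred_sum_insert:
  assumes "finite I" "x \<notin> I" "S \<subseteq> I"
  shows "centred_sum (insert x I) q y (insert x S) = centred_sum I q y S + (1 - q x) * y x"
    and "centred_sum (insert x I) q y S = centred_sum I q y S - q x * y x"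
proof -
  have "finite S" "x \<notin> S" using assms finite_subset by auto
  then show "centred_sum (insert x I) q y (insert x S) = centred_sum I q y S + (1 - q x) * y x"
    "centred_sum (insert x I) q y S = centred_sum I q y S - q x * y x"
    using assms by (simp_all add: centred_sum_def algebra_simps)
qed

lemma subset_avg_centred_sum_insert:
  assumes "finite I" "x \<notin> I"
  shows "subset_avg (insert x I) q (\<lambda>S. f (centred_sum (insert x I) q y S))
    = q x * subset_avg I q (\<lambda>S. f (centred_sum I q y S + (1 - q x) * y x))
      + (1 - q x) * subset_avg I q (\<lambda>S. f (centred_sum I q y S - q x * y x))"
proof -
  have "subset_avg I q (\<lambda>S. f (centred_sum (insert x I) q y (insert x S)))
      = subset_avg I q (\<lambda>S. f (centred_sum I q y S + (1 - q x) * y x))"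
    by (rule subset_avg_cong) (auto simp: centred_sum_insert(1)[OF assms])
  moreover have "subset_avg I q (\<lambda>S. f (centred_sum (insert x I) q y S))
      = subset_avg I q (\<lambda>S. f (centred_sum I q y S - q x * y x))"
    by (rule subset_avg_cong) (auto simp: centred_sum_insert(2)[OF assms])
  ultimately show ?thesis by (simp add: subset_avg_insert[OF assms])
qed

lemma subset_avg_centred_sum_1:
  assumes "finite I"
  shows "subset_avg I q (centred_sum I q y) = 0"
  using assms
proof (induction I)
  case empty then show ?case by (simp add: centred_sum_def)
next
  case (insert x I)
  have "subset_avg (insert x I) q (centred_sum (insert x I) q y)
    = q x * subset_avg I q (\<lambda>S. centred_sum I q y S + (1 - q x) * y x)
      + (1 - q x) * subset_avg I q (\<lambda>S. centred_sum I q y S - q x * y x)"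
    using subset_avg_centred_sum_insert[OF insert(1,2), of q "\<lambda>z. z" y] by simp
  then show ?case using insert by (simp add: subset_avg_add subset_avg_diff algebra_simps)
qed

lemma subset_avg_centred_sum_2:
  assumes "finite I"
  shows "subset_avg I q (\<lambda>S. (centred_sum I q y S)\<^sup>2) = (\<Sum>i\<in>I. q i * (1 - q i) * (y i)\<^sup>2)"
  using assms
proof (induction I)
  case empty then show ?case by (simp add: centred_sum_def)
next
  case (insert x I)
  let ?W = "centred_sum I q y" let ?a = "(1 - q x) * y x" let ?b = "- (q x * y x)"
  have sq: "subset_avg I q (\<lambda>S. (?W S + a)\<^sup>2) = subset_avg I q (\<lambda>S. (?W S)\<^sup>2) + a\<^sup>2" for a
  proof -
    have "subset_avg I q (\<lambda>S. (?W S + a)\<^sup>2) = subset_avg I q (\<lambda>S. (?W S)\<^sup>2 + ((2 * a) * ?W S + a\<^sup>2))"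
      by (rule subset_avg_cong) (simp_all add: power2_sum)
    then show ?thesis using insert subset_avg_centred_sum_1[of I q y] by (simp add: subset_avg_add subset_avg_cmult)
  qed
  define V where "V = (\<Sum>i\<in>I. q i * (1 - q i) * (y i)\<^sup>2)"
  have "subset_avg (insert x I) q (\<lambda>S. (centred_sum (insert x I) q y S)\<^sup>2)
      = q x * (V + ?a\<^sup>2) + (1 - q x) * (V + ?b\<^sup>2)"
    unfolding subset_avg_centred_sum_insert[OF insert(1,2), of q "\<lambda>z. z\<^sup>2" y]
    using sq[of ?a] sq[of ?b] insert.IH by (simp add: V_def)
  also have "\<dots> = V + q x * (1 - q x) * (y x)\<^sup>2"
    by (simp add: algebra_simps power2_eq_square)
  finally show ?case using insert(1,2) by (simp add: V_def)
qed

text \<open>The constant 3 is the one of a Gaussian variable. It survives adding an independent summand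
  because, for \<open>q\<close> in \<open>[1/4, 3/4]\<close>, the variance \<open>v\<close> is at least 1/6, which is what
  \<open>v * (1 - 3 * v) \<le> 3 * v\<^sup>2\<close> requires of the fourth moment of the summand.\<close>

lemma subset_avg_centred_sum_4:
  assumes "finite I" "\<And>i. i \<in> I \<Longrightarrow> 1/4 \<le> q i \<and> q i \<le> 3/4"
  shows "subset_avg I q (\<lambda>S. (centred_sum I q y S)^4) \<le> 3 * (\<Sum>i\<in>I. q i * (1 - q i) * (y i)\<^sup>2)\<^sup>2"
  using assms
proof (induction I)
  case empty then show ?case by (simp add: centred_sum_def)
next
  case (insert x I)
  let ?W = "centred_sum I q y" let ?a = "(1 - q x) * y x" let ?b = "- (q x * y x)"
  define V where "V = (\<Sum>i\<in>I. q i * (1 - q i) * (y i)\<^sup>2)"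
  define v where "v = q x * (1 - q x)"
  define W3 where "W3 = subset_avg I q (\<lambda>S. (?W S)^3)"
  define W4 where "W4 = subset_avg I q (\<lambda>S. (?W S)^4)"
  have quart: "subset_avg I q (\<lambda>S. (?W S + a)^4) = W4 + 4 * a * W3 + 6 * a\<^sup>2 * V + a^4" for a
  proof -
    have "subset_avg I q (\<lambda>S. (?W S + a)^4)
        = subset_avg I q (\<lambda>S. (?W S)^4 + ((4 * a) * (?W S)^3 + ((6 * a\<^sup>2) * (?W S)\<^sup>2 + ((4 * a^3) * ?W S + a^4))))"
      by (rule subset_avg_cong) (simp_all add: algebra_simps power4_eq_xxxx power3_eq_cube power2_eq_square)
    then show ?thesis using insert subset_avg_centred_sum_1[of I q y] subset_avg_centred_sum_2[of I q y]
      by (simp add: subset_avg_add subset_avg_cmult W3_def W4_def V_def)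
  qed
  have v: "3/16 \<le> v"
  proof -
    have "0 \<le> (q x - 1/4) * (3/4 - q x)" using insert.prems by (intro mult_nonneg_nonneg) auto
    then show ?thesis by (simp add: v_def algebra_simps)
  qed
  have "subset_avg (insert x I) q (\<lambda>S. (centred_sum (insert x I) q y S)^4)
      = q x * (W4 + 4 * ?a * W3 + 6 * ?a\<^sup>2 * V + ?a^4) + (1 - q x) * (W4 + 4 * ?b * W3 + 6 * ?b\<^sup>2 * V + ?b^4)"
    unfolding subset_avg_centred_sum_insert[OF insert(1,2), of q "\<lambda>z. z^4" y]
    using quart[of ?a] quart[of ?b] by simp
  also have "\<dots> = W4 + 6 * v * (y x)\<^sup>2 * V + v * (1 - 3 * v) * (y x)^4"
    by (simp add: v_def power4_eq_xxxx power2_eq_square algebra_simps)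
  also have "\<dots> \<le> 3 * V\<^sup>2 + 6 * v * (y x)\<^sup>2 * V + v * (3 * v) * (y x)^4"
  proof -
    have "W4 \<le> 3 * V\<^sup>2" using insert by (simp add: W4_def V_def)
    moreover have "v * (1 - 3 * v) * (y x)^4 \<le> v * (3 * v) * (y x)^4"
      using v by (intro mult_right_mono mult_left_mono) auto
    ultimately show ?thesis by linarith
  qed
  also have "\<dots> = 3 * (V + v * (y x)\<^sup>2)\<^sup>2"
    by (simp add: power4_eq_xxxx power2_eq_square algebra_simps)
  also have "V + v * (y x)\<^sup>2 = (\<Sum>i\<in>insert x I. q i * (1 - q i) * (y i)\<^sup>2)"
    using insert by (simp add: V_def v_def)
  finally show ?case .
qed

definition signed_sum :: "'i set \<Rightarrow> ('i \<Rightarrow> real) \<Rightarrow> 'i set \<Rightarrow> real" where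
  "signed_sum I b S = (\<Sum>i\<in>I. (2 * of_bool (i \<in> S) - 1) * b i)"

lemma signed_sum_eq_centred_sum:
  assumes "finite I" "S \<subseteq> I"
  shows "signed_sum I b S = 2 * centred_sum I (\<lambda>_. 1/2) b S"
proof -
  have "(\<Sum>i\<in>I. of_bool (i \<in> S) * b i) = (\<Sum>i\<in>S. b i)"
    by (rule sum.mono_neutral_cong_right) (use assms in auto)
  moreover have "signed_sum I b S = 2 * (\<Sum>i\<in>I. of_bool (i \<in> S) * b i) - (\<Sum>i\<in>I. b i)"
    by (simp add: signed_sum_def algebra_simps sum_subtractf sum_distrib_left)
  moreover have "(\<Sum>i\<in>I. 1/2 * b i) = 1/2 * (\<Sum>i\<in>I. b i)" by (rule sum_distrib_left[symmetric])
  ultimately show ?thesis unfolding centred_sum_def by simp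
qed

text \<open>The fourth moment of \<open>m + W\<close>, where \<open>W\<close> is the centred sum, is at most seven times the square
  of its second moment \<open>m\<^sup>2 + V\<close>, so \<open>m + W\<close> cannot be much smaller than its root mean square
  with probability close to 1. Allowing a shift \<open>m\<close> covers random signs as well as unsigned
  random subsets.\<close>

lemma subset_avg_paley_zygmund:
  fixes q y :: "'i \<Rightarrow> real"
  assumes fin: "finite I" and q: "\<And>i. i \<in> I \<Longrightarrow> 1/4 \<le> q i \<and> q i \<le> 3/4"
    and V: "V = (\<Sum>i\<in>I. q i * (1 - q i) * (y i)\<^sup>2)"
  shows "subset_avg I q (\<lambda>S. of_bool ((m + centred_sum I q y S)\<^sup>2 \<ge> (m\<^sup>2 + V) / 4)) \<ge> 1/20"
proof -
  let ?W = "centred_sum I q y" 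
  let ?F = "\<lambda>S. (m + ?W S)\<^sup>2"
  let ?G = "\<lambda>S. of_bool (?F S \<ge> (m\<^sup>2 + V) / 4) :: real"
  have q01: "0 \<le> q i \<and> q i \<le> 1" if "i \<in> I" for i using q[OF that] by auto
  have V0: "0 \<le> V" unfolding V using q01 by (auto intro!: sum_nonneg mult_nonneg_nonneg)
  define A where "A = m\<^sup>2 + V"
  have A0: "A \<ge> 0" using V0 by (simp add: A_def)
  show ?thesis
  proof (cases "A = 0")
    case True
    then have "subset_avg I q ?G = subset_avg I q (\<lambda>_. 1)"
      by (intro subset_avg_cong) (auto simp: A_def)
    then show ?thesis using fin by simp
  next
    case False
    then have Apos: "A > 0" using A0 by simp
    have EF: "subset_avg I q ?F = A"
    proof -
      have "subset_avg I q ?F = subset_avg I q (\<lambda>S. m\<^sup>2 + ((2 * m) * ?W S + (?W S)\<^sup>2))"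
        by (rule subset_avg_cong) (simp_all add: power2_sum)
      then show ?thesis using fin
        by (simp add: subset_avg_add subset_avg_cmult subset_avg_centred_sum_1 subset_avg_centred_sum_2 V A_def)
    qed
    have EF2: "subset_avg I q (\<lambda>S. (?F S)\<^sup>2) \<le> 7 * A\<^sup>2"
    proof -
      have "subset_avg I q (\<lambda>S. (?F S)\<^sup>2)
          \<le> subset_avg I q (\<lambda>S. m^4 + ((4 * m^3) * ?W S + ((10 * m\<^sup>2) * (?W S)\<^sup>2 + 2 * (?W S)^4)))"
      proof (rule subset_avg_mono)
        fix S
        have "0 \<le> (2 * m * ?W S - (?W S)\<^sup>2)\<^sup>2" by simp
        then show "(?F S)\<^sup>2 \<le> m^4 + ((4 * m^3) * ?W S + ((10 * m\<^sup>2) * (?W S)\<^sup>2 + 2 * (?W S)^4))"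
          by (simp add: algebra_simps power4_eq_xxxx power3_eq_cube power2_eq_square)
      qed (use q01 in auto)
      also have "\<dots> \<le> m^4 + (10 * m\<^sup>2 * V + 2 * (3 * V\<^sup>2))"
        using fin subset_avg_centred_sum_4[OF fin q, where y = y]
        by (simp add: subset_avg_add subset_avg_cmult subset_avg_centred_sum_1 subset_avg_centred_sum_2 V)
      also have "\<dots> \<le> 7 * A\<^sup>2"
      proof -
        have "7 * A\<^sup>2 - (m^4 + (10 * m\<^sup>2 * V + 2 * (3 * V\<^sup>2))) = 6 * m^4 + 4 * m\<^sup>2 * V + V\<^sup>2"
          by (simp add: A_def power4_eq_xxxx power2_eq_square algebra_simps)
        also have "\<dots> \<ge> 0" using V0 by simp
        finally show ?thesis by linarith
      qed
      finally show ?thesis .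
    qed
    \<comment> \<open>where \<open>?F\<close> is at least \<open>A / 4\<close>, it is bounded by the arithmetic-geometric mean inequality with the balance \<open>10 * A\<close>\<close>
    have "A = subset_avg I q ?F" using EF by simp
    also have "\<dots> \<le> subset_avg I q (\<lambda>S. A / 4 + ((1 / (20 * A)) * (?F S)\<^sup>2 + (5 * A) * ?G S))"
    proof (rule subset_avg_mono)
      fix S
      show "?F S \<le> A / 4 + ((1 / (20 * A)) * (?F S)\<^sup>2 + (5 * A) * ?G S)"
      proof (cases "?F S \<ge> A / 4")
        case True
        have "0 \<le> (?F S - 10 * A)\<^sup>2 / (20 * A)" using Apos by simp
        also have "\<dots> = (1 / (20 * A)) * (?F S)\<^sup>2 + 5 * A - ?F S"
          using Apos by (simp add: power2_diff field_simps power2_eq_square)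
        finally have le: "?F S \<le> (1 / (20 * A)) * (?F S)\<^sup>2 + 5 * A" by simp
        have G: "?G S = 1" using True by (simp add: A_def)
        show ?thesis unfolding G using le Apos by linarith
      next
        case False
        then have G: "?G S = 0" and "?F S \<le> A / 4" by (simp_all add: A_def)
        moreover have "0 \<le> (1 / (20 * A)) * (?F S)\<^sup>2" using Apos by simp
        ultimately show ?thesis unfolding G by linarith
      qed
    qed (use q01 in auto)
    also have "\<dots> = A / 4 + ((1 / (20 * A)) * subset_avg I q (\<lambda>S. (?F S)\<^sup>2) + 5 * A * subset_avg I q ?G)"
      by (simp only: subset_avg_add subset_avg_cmult subset_avg_const[OF fin])
    also have "\<dots> \<le> A / 4 + ((1 / (20 * A)) * (7 * A\<^sup>2) + 5 * A * subset_avg I q ?G)"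
      using EF2 Apos by (intro add_mono mult_left_mono) auto
    also have "\<dots> = A * (3/5 + 5 * subset_avg I q ?G)"
      using Apos by (simp add: field_simps power2_eq_square)
    finally have "1 \<le> 3/5 + 5 * subset_avg I q ?G" using Apos by simp
    then show ?thesis by simp
  qed
qed


text \<open>Chebyshev's inequality.\<close>

lemma subset_avg_away_from_zero:
  fixes q y :: "'i \<Rightarrow> real"
  assumes fin: "finite I" and q: "\<And>i. i \<in> I \<Longrightarrow> 0 \<le> q i \<and> q i \<le> 1"
    and y: "(\<Sum>i\<in>I. (y i)\<^sup>2) \<le> 1" and a: "\<bar>a\<bar> \<ge> 3"
  shows "subset_avg I q (\<lambda>S. of_bool (1 \<le> \<bar>a + centred_sum I q y S\<bar>)) \<ge> 3/4"
proof -
  have "(\<Sum>i\<in>I. q i * (1 - q i) * (y i)\<^sup>2) \<le> (\<Sum>i\<in>I. 1 * (y i)\<^sup>2)"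
    using q by (intro sum_mono mult_right_mono mult_le_one) auto
  then have V: "subset_avg I q (\<lambda>S. (centred_sum I q y S)\<^sup>2) \<le> 1"
    using y subset_avg_centred_sum_2[OF fin, of q y] by simp
  have "3/4 \<le> 1 - 1/4 * subset_avg I q (\<lambda>S. (centred_sum I q y S)\<^sup>2)" using V by simp
  also have "\<dots> = subset_avg I q (\<lambda>S. 1 - 1/4 * (centred_sum I q y S)\<^sup>2)"
    using fin by (simp only: subset_avg_diff subset_avg_cmult subset_avg_const)
  also have "\<dots> \<le> subset_avg I q (\<lambda>S. of_bool (1 \<le> \<bar>a + centred_sum I q y S\<bar>))"
  proof (rule subset_avg_mono)
    fix S
    show "1 - 1/4 * (centred_sum I q y S)\<^sup>2 \<le> of_bool (1 \<le> \<bar>a + centred_sum I q y S\<bar>)"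
    proof (cases "1 \<le> \<bar>a + centred_sum I q y S\<bar>")
      case False
      then have "2 \<le> \<bar>centred_sum I q y S\<bar>" using a by linarith
      then have "2\<^sup>2 \<le> \<bar>centred_sum I q y S\<bar>\<^sup>2" by (intro power_mono) auto
      then show ?thesis using False by simp
    qed simp
  qed (use q in auto)
  finally show ?thesis .
qed

text \<open>A selection with probabilities of order \<open>p\<close> is a selection with probabilities \<open>2 * q\<close>
  followed by fair coin tosses. After the first step the truncated squares still add up to a
  large number by Chebyshev's inequality, and the coin tosses then produce a large sum by the
  Paley-Zygmund inequality. The truncation at 1 is what makes the variance in the first step
  comparable with the mean.\<close>

lemma thinning_large:
  fixes y :: "'i \<Rightarrow> real"
  assumes fin: "finite I" and q: "\<And>i. i \<in> I \<Longrightarrow> p / 4 \<le> q i \<and> q i \<le> 1/2" and p: "0 < p"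
    and y: "(\<Sum>i\<in>I. min 1 ((y i)\<^sup>2)) \<ge> 64 / p"
  shows "subset_avg I q (\<lambda>S. of_bool (1 \<le> \<bar>\<Sum>i\<in>S. y i\<bar>)) \<ge> 1/40"
proof -
  define z where "z i = min 1 ((y i)\<^sup>2)" for i
  let ?r = "\<lambda>i. 2 * q i"
  have r01: "0 \<le> ?r i \<and> ?r i \<le> 1" if "i \<in> I" for i using q[OF that] p by auto
  define A where "A = (\<Sum>i\<in>I. ?r i * z i)"
  \<comment> \<open>the mean of the truncated squares selected in the first step is \<open>A\<close>\<close>
  have "32 = (p / 2) * (64 / p)" using p by simp
  also have "\<dots> \<le> (p / 2) * (\<Sum>i\<in>I. z i)" using y p by (intro mult_left_mono) (auto simp: z_def)
  also have "\<dots> = (\<Sum>i\<in>I. p / 2 * z i)" by (simp add: sum_distrib_left)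
  also have "\<dots> \<le> A" unfolding A_def
  proof (intro sum_mono mult_right_mono)
    fix i assume "i \<in> I" then show "p / 2 \<le> 2 * q i" using q[of i] by auto
  qed (auto simp: z_def)
  finally have A: "32 \<le> A" .
  have V: "subset_avg I ?r (\<lambda>S. (centred_sum I ?r z S)\<^sup>2) \<le> A"
    unfolding subset_avg_centred_sum_2[OF fin] A_def
  proof (rule sum_mono)
    fix i assume i: "i \<in> I"
    have "z i * z i \<le> z i * 1" by (intro mult_left_mono) (auto simp: z_def)
    moreover have "(1 - ?r i) * (z i)\<^sup>2 \<le> 1 * (z i)\<^sup>2"
      using r01[OF i] by (intro mult_right_mono) auto
    ultimately have "(1 - ?r i) * (z i)\<^sup>2 \<le> z i" by (simp add: power2_eq_square)
    then have "?r i * ((1 - ?r i) * (z i)\<^sup>2) \<le> ?r i * z i" using r01[OF i] by (intro mult_left_mono) auto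
    then show "?r i * (1 - ?r i) * (z i)\<^sup>2 \<le> ?r i * z i" by (simp only: mult.assoc)
  qed
  have "1/40 \<le> (1/20) * (1 - (4 / A\<^sup>2) * A)" using A by (simp add: field_simps power2_eq_square)
  also have "\<dots> \<le> (1/20) * (1 - (4 / A\<^sup>2) * subset_avg I ?r (\<lambda>S. (centred_sum I ?r z S)\<^sup>2))"
    using V A by (intro mult_left_mono diff_left_mono) auto
  also have "\<dots> = subset_avg I ?r (\<lambda>S. (1/20) * (1 - (4 / A\<^sup>2) * (centred_sum I ?r z S)\<^sup>2))"
    using fin by (simp only: subset_avg_diff subset_avg_cmult subset_avg_const)
  also have "\<dots> \<le> subset_avg I ?r (\<lambda>S. subset_avg S (\<lambda>_. 1/2) (\<lambda>T. of_bool (1 \<le> \<bar>\<Sum>i\<in>T. y i\<bar>)))"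
  proof (rule subset_avg_mono)
    fix S assume S: "S \<subseteq> I"
    have finS: "finite S" using S fin finite_subset by auto
    let ?R = "subset_avg S (\<lambda>_. 1/2) (\<lambda>T. of_bool (1 \<le> \<bar>\<Sum>i\<in>T. y i\<bar>))"
    have R0: "0 \<le> ?R" using subset_avg_mono[of S "\<lambda>_. 1/2" "\<lambda>_. 0" "\<lambda>T. of_bool (1 \<le> \<bar>\<Sum>i\<in>T. y i\<bar>)"] finS by simp
    show "(1/20) * (1 - (4 / A\<^sup>2) * (centred_sum I ?r z S)\<^sup>2) \<le> ?R"
    proof (cases "\<bar>centred_sum I ?r z S\<bar> \<ge> A / 2")
      case True
      then have "(A/2)\<^sup>2 \<le> \<bar>centred_sum I ?r z S\<bar>\<^sup>2" using A by (intro power_mono) auto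
      then have "1 \<le> (4 / A\<^sup>2) * (centred_sum I ?r z S)\<^sup>2" using A by (simp add: field_simps power2_eq_square)
      then show ?thesis using R0 by simp
    next
      case False
      moreover have "centred_sum I ?r z S = (\<Sum>i\<in>S. z i) - A" by (simp only: centred_sum_def A_def)
      ultimately have "A / 2 \<le> (\<Sum>i\<in>S. z i)" using A by linarith
      then have z16: "16 \<le> (\<Sum>i\<in>S. z i)" using A by simp
      define V where "V = (\<Sum>i\<in>S. 1/2 * (1 - 1/2) * (y i)\<^sup>2)"
      define m where "m = (\<Sum>i\<in>S. 1/2 * y i)"
      have "(\<Sum>i\<in>S. z i) \<le> (\<Sum>i\<in>S. (y i)\<^sup>2)" by (intro sum_mono) (auto simp: z_def)
      also have "\<dots> = 4 * V" by (simp add: V_def sum_distrib_left)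
      finally have V4: "4 \<le> V" using z16 by simp
      have "1/20 \<le> subset_avg S (\<lambda>_. 1/2) (\<lambda>T. of_bool ((m + centred_sum S (\<lambda>_. 1/2) y T)\<^sup>2 \<ge> (m\<^sup>2 + V) / 4))"
        by (rule subset_avg_paley_zygmund) (use finS in \<open>auto simp: V_def\<close>)
      also have "\<dots> \<le> ?R"
      proof (rule subset_avg_mono)
        fix T
        have *: "m + centred_sum S (\<lambda>_. 1/2) y T = (\<Sum>i\<in>T. y i)" by (simp add: m_def centred_sum_def)
        have "(m\<^sup>2 + V) / 4 \<ge> 1" using V4 by (auto intro: add_increasing)
        then show "of_bool ((m + centred_sum S (\<lambda>_. 1/2) y T)\<^sup>2 \<ge> (m\<^sup>2 + V) / 4) \<le> (of_bool (1 \<le> \<bar>\<Sum>i\<in>T. y i\<bar>) :: real)"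
          unfolding * using abs_le_square_iff[of 1 "\<Sum>i\<in>T. y i"] by (auto simp: of_bool_def)
      qed auto
      finally have R: "1/20 \<le> ?R" .
      have "0 \<le> (4 / A\<^sup>2) * (centred_sum I ?r z S)\<^sup>2" by simp
      then have "(1/20) * (1 - (4 / A\<^sup>2) * (centred_sum I ?r z S)\<^sup>2) \<le> (1/20) * 1"
        by (intro mult_left_mono) auto
      also have "\<dots> \<le> ?R" using R by simp
      finally show ?thesis .
    qed
  qed (use r01 in auto)
  also have "\<dots> = subset_avg I (\<lambda>i. ?r i * (1/2)) (\<lambda>T. of_bool (1 \<le> \<bar>\<Sum>i\<in>T. y i\<bar>))"
    by (rule subset_avg_compose[OF fin, symmetric])
  finally show ?thesis by simp
qed

text \<open>The random subset \<open>c\<close> of \<open>C\<close> modulates the density of the thinning by the functions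
  \<open>\<psi> j\<close>. In the second alternative the sum over the support of \<open>\<psi> j\<close> is close to its mean,
  because the squares there have a small sum; including \<open>j\<close> in \<open>c\<close> or leaving it out changes
  that mean a lot, hence the total is away from 0 for one of the two choices, whatever the sum
  over the remaining indices is.\<close>

lemma weighted_thinning_large:
  fixes y :: "'i \<Rightarrow> real" and \<psi> :: "'j \<Rightarrow> 'i \<Rightarrow> real"
  assumes fin: "finite I" "finite C" and p: "0 < p" "p \<le> 1/2"
    and \<psi>: "\<And>i j. i \<in> I \<Longrightarrow> j \<in> C \<Longrightarrow> 0 \<le> \<psi> j i" "\<And>i. i \<in> I \<Longrightarrow> (\<Sum>j\<in>C. \<psi> j i) \<le> 1"
    and large: "(\<Sum>i\<in>I. min 1 ((y i)\<^sup>2)) \<ge> 64 / p \<or>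
      (\<exists>j\<in>C. \<bar>\<Sum>i\<in>I. \<psi> j i * y i\<bar> \<ge> 12 / p \<and> (\<Sum>i | i \<in> I \<and> \<psi> j i \<noteq> 0. (y i)\<^sup>2) \<le> 1)"
  defines "q \<equiv> \<lambda>c i. p * (1/4 + (\<Sum>j\<in>c. \<psi> j i) / 2)"
  shows "subset_avg C (\<lambda>_. 1/2) (\<lambda>c. subset_avg I (q c) (\<lambda>S. of_bool (1 \<le> \<bar>\<Sum>i\<in>S. y i\<bar>))) \<ge> 1/40"
proof -
  let ?F = "\<lambda>S. of_bool (1 \<le> \<bar>\<Sum>i\<in>S. y i\<bar>) :: real"
  let ?H = "\<lambda>c. subset_avg I (q c) ?F"
  have q: "p / 4 \<le> q c i \<and> q c i \<le> 1/2" if "c \<subseteq> C" "i \<in> I" for c i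
  proof -
    have "0 \<le> (\<Sum>j\<in>c. \<psi> j i)" using that \<psi> by (intro sum_nonneg) auto
    moreover have "(\<Sum>j\<in>c. \<psi> j i) \<le> (\<Sum>j\<in>C. \<psi> j i)" using that \<psi> fin by (intro sum_mono2) auto
    ultimately have s: "0 \<le> (\<Sum>j\<in>c. \<psi> j i)" "(\<Sum>j\<in>c. \<psi> j i) \<le> 1" using \<psi>(2)[OF that(2)] by auto
    have "p * (1/4) \<le> q c i" unfolding q_def using s p by (intro mult_left_mono) auto
    moreover have "q c i \<le> (1/2) * 1" unfolding q_def using s p by (intro mult_mono) auto
    ultimately show ?thesis by simp
  qed
  from large show ?thesis
  proof
    assume y: "(\<Sum>i\<in>I. min 1 ((y i)\<^sup>2)) \<ge> 64 / p"
    have "1/40 = subset_avg C (\<lambda>_. 1/2) (\<lambda>_. 1/40)" using fin by simp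
    also have "\<dots> \<le> subset_avg C (\<lambda>_. 1/2) ?H"
      using q p fin y by (intro subset_avg_mono thinning_large[of I p]) auto
    finally show ?thesis .
  next
    assume "\<exists>j\<in>C. \<bar>\<Sum>i\<in>I. \<psi> j i * y i\<bar> \<ge> 12 / p \<and> (\<Sum>i | i \<in> I \<and> \<psi> j i \<noteq> 0. (y i)\<^sup>2) \<le> 1"
    then obtain j where j: "j \<in> C" "\<bar>\<Sum>i\<in>I. \<psi> j i * y i\<bar> \<ge> 12 / p"
      "(\<Sum>i | i \<in> I \<and> \<psi> j i \<noteq> 0. (y i)\<^sup>2) \<le> 1" by auto
    define C' where "C' = C - {j}"
    have C': "C = insert j C'" "j \<notin> C'" "finite C'" using j fin by (auto simp: C'_def)
    define D where "D = {i \<in> I. \<psi> j i \<noteq> 0}"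
    have D: "finite D" "D \<subseteq> I" "finite (I - D)" "I = (I - D) \<union> D" "(I - D) \<inter> D = {}"
      using fin by (auto simp: D_def)
    \<comment> \<open>both choices for \<open>j\<close> together succeed with total probability at least 3/4\<close>
    have HH: "3/4 \<le> ?H (insert j c) + ?H c" if c: "c \<subseteq> C'" for c
    proof -
      have finc: "finite c" "j \<notin> c" using c C' finite_subset by auto
      define r where "r = q c"
      define r' where "r' = q (insert j c)"
      have r': "r' i = r i + p / 2 * \<psi> j i" for i
        using finc by (simp add: r_def r'_def q_def algebra_simps)
      have r01: "0 \<le> r i \<and> r i \<le> 1" "0 \<le> r' i \<and> r' i \<le> 1" if "i \<in> I" for i
      proof -
        have "c \<subseteq> C" "insert j c \<subseteq> C" using c C' by auto
        then show "0 \<le> r i \<and> r i \<le> 1" "0 \<le> r' i \<and> r' i \<le> 1"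
          using q[of c i] q[of "insert j c" i] that p unfolding r_def r'_def by linarith+
      qed
      define m where "m = (\<Sum>i\<in>D. r i * y i)"
      define m' where "m' = (\<Sum>i\<in>D. r' i * y i)"
      have "m' - m = (\<Sum>i\<in>D. (p / 2) * (\<psi> j i * y i))"
        unfolding m_def m'_def r' sum_subtractf[symmetric] by (simp add: algebra_simps)
      also have "\<dots> = (p / 2) * (\<Sum>i\<in>I. \<psi> j i * y i)"
        unfolding sum_distrib_left[symmetric]
        by (subst sum.mono_neutral_left[of I D]) (use fin in \<open>auto simp: D_def\<close>)
      finally have "\<bar>m' - m\<bar> = \<bar>(p / 2) * (\<Sum>i\<in>I. \<psi> j i * y i)\<bar>" by (rule arg_cong)
      also have "\<dots> = (p / 2) * \<bar>\<Sum>i\<in>I. \<psi> j i * y i\<bar>" using p by (simp only: abs_mult)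
      also have "\<dots> \<ge> (p / 2) * (12 / p)" using j p by (intro mult_left_mono) auto
      finally have m: "\<bar>m' - m\<bar> \<ge> 6" using p by simp
      \<comment> \<open>conditioning on the selection off the support \<open>D\<close> of \<open>\<psi> j\<close>, on which both densities agree\<close>
      have split: "subset_avg I s ?F = subset_avg (I - D) s (\<lambda>S. subset_avg D s (\<lambda>T. of_bool (1 \<le> \<bar>(\<Sum>i\<in>S. y i) + (\<Sum>i\<in>D. s i * y i) + centred_sum D s y T\<bar>)))"
        for s
      proof -
        have "subset_avg I s ?F = subset_avg (I - D) s (\<lambda>S. subset_avg D s (\<lambda>T. ?F (S \<union> T)))"
          by (subst D(4)) (rule subset_avg_union[OF D(3,1,5)])
        also have "\<dots> = subset_avg (I - D) s (\<lambda>S. subset_avg D s (\<lambda>T. of_bool (1 \<le> \<bar>(\<Sum>i\<in>S. y i) + (\<Sum>i\<in>D. s i * y i) + centred_sum D s y T\<bar>)))"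
        proof (intro subset_avg_cong refl)
          fix S T assume ST: "S \<subseteq> I - D" "T \<subseteq> D"
          then have "(\<Sum>i\<in>S \<union> T. y i) = (\<Sum>i\<in>S. y i) + (\<Sum>i\<in>T. y i)"
            using D by (intro sum.union_disjoint) (auto intro: finite_subset)
          then show "?F (S \<union> T) = of_bool (1 \<le> \<bar>(\<Sum>i\<in>S. y i) + (\<Sum>i\<in>D. s i * y i) + centred_sum D s y T\<bar>)"
            by (simp add: centred_sum_def)
        qed
        finally show ?thesis .
      qed
      let ?G = "\<lambda>s S. subset_avg D s (\<lambda>T. of_bool (1 \<le> \<bar>(\<Sum>i\<in>S. y i) + (\<Sum>i\<in>D. s i * y i) + centred_sum D s y T\<bar>)) :: real"
      have H': "?H (insert j c) = subset_avg (I - D) r (?G r')"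
        unfolding r'_def[symmetric] split[of r'] by (rule subset_avg_cong) (auto simp: r' D_def)
      have H: "?H c = subset_avg (I - D) r (?G r)"
        unfolding r_def[symmetric] by (rule split)
      have "3/4 = subset_avg (I - D) r (\<lambda>_. 3/4)" using D by simp
      also have "\<dots> \<le> subset_avg (I - D) r (\<lambda>S. ?G r' S + ?G r S)"
      proof (rule subset_avg_mono)
        fix S
        have pos: "0 \<le> ?G s S" if "\<And>i. i \<in> D \<Longrightarrow> 0 \<le> s i \<and> s i \<le> 1" for s
          using subset_avg_mono[of D s "\<lambda>_. 0" "\<lambda>T. of_bool (1 \<le> \<bar>(\<Sum>i\<in>S. y i) + (\<Sum>i\<in>D. s i * y i) + centred_sum D s y T\<bar>)"] that D
          by simp
        have big: "3/4 \<le> ?G s S" if "\<And>i. i \<in> D \<Longrightarrow> 0 \<le> s i \<and> s i \<le> 1"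
          "\<bar>(\<Sum>i\<in>S. y i) + (\<Sum>i\<in>D. s i * y i)\<bar> \<ge> 3" for s
          by (rule subset_avg_away_from_zero) (use that D j in \<open>auto simp: D_def\<close>)
        have "\<bar>(\<Sum>i\<in>S. y i) + m\<bar> \<ge> 3 \<or> \<bar>(\<Sum>i\<in>S. y i) + m'\<bar> \<ge> 3" using m by linarith
        then have "3/4 \<le> ?G r S \<or> 3/4 \<le> ?G r' S"
          using big[of r] big[of r'] r01 D unfolding m_def m'_def by blast
        moreover have "0 \<le> ?G r S" "0 \<le> ?G r' S" using pos[of r] pos[of r'] r01 D by blast+
        ultimately show "3/4 \<le> ?G r' S + ?G r S" by linarith
      qed (use r01 in auto)
      also have "\<dots> = ?H (insert j c) + ?H c" unfolding H H' by (rule subset_avg_add)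
      finally show ?thesis .
    qed
    have "3/8 = (1/2) * subset_avg C' (\<lambda>_. 1/2) (\<lambda>_. 3/4)" using C' by simp
    also have "\<dots> \<le> (1/2) * subset_avg C' (\<lambda>_. 1/2) (\<lambda>c. ?H (insert j c) + ?H c)"
      using HH by (intro mult_left_mono subset_avg_mono) auto
    also have "\<dots> = subset_avg C (\<lambda>_. 1/2) ?H"
      unfolding C'(1) using C' by (simp add: subset_avg_insert subset_avg_add)
    finally show ?thesis by simp
  qed
qed

section \<open>Convergence in probability and elementary properties of stochastic measures\<close>

text \<open>The functional that metrises convergence in probability. It replaces limits in probability by
  limits of numbers that obey the triangle inequality.\<close>

definition L0_norm :: "'a measure \<Rightarrow> ('a \<Rightarrow> real) \<Rightarrow> real" where
  "L0_norm M X = (\<integral>\<omega>. min 1 \<bar>X \<omega>\<bar> \<partial>M)"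

abbreviation tail_prob :: "'a measure \<Rightarrow> ('a \<Rightarrow> real) \<Rightarrow> real \<Rightarrow> real" where
  "tail_prob M X t \<equiv> measure M {\<omega> \<in> space M. t < \<bar>X \<omega>\<bar>}"

text \<open>The limit is written as \<open>0 + 0\<close> because the majorants are sums of two null sequences.\<close>

lemma tendsto_0_squeeze:
  fixes f g :: "nat \<Rightarrow> real"
  assumes "g \<longlonglongrightarrow> 0 + 0" "\<And>n. f n \<le> g n" "\<And>n. 0 \<le> f n"
  shows "f \<longlonglongrightarrow> 0"
  by (rule tendsto_sandwich[of "\<lambda>_. 0" _ _ g]) (use assms in auto)

context prob_space
begin

lemma L0_integrable [simp]:
  fixes X :: "'a \<Rightarrow> real"
  assumes "X \<in> borel_measurable M"
  shows "integrable M (\<lambda>\<omega>. min 1 \<bar>X \<omega>\<bar>)"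
  by (rule integrable_const_bound[where B = 1]) (use assms in auto)

lemma L0_norm_nonneg: "0 \<le> L0_norm M X"
  unfolding L0_norm_def by (intro integral_nonneg_AE) auto

lemma L0_norm_triangle:
  assumes [measurable]: "X \<in> borel_measurable M" "Y \<in> borel_measurable M"
  shows "L0_norm M (\<lambda>\<omega>. X \<omega> + Y \<omega>) \<le> L0_norm M X + L0_norm M Y"
proof -
  have "(\<integral>\<omega>. min 1 \<bar>X \<omega> + Y \<omega>\<bar> \<partial>M) \<le> (\<integral>\<omega>. min 1 \<bar>X \<omega>\<bar> + min 1 \<bar>Y \<omega>\<bar> \<partial>M)"
    by (rule integral_mono) (auto intro!: Bochner_Integration.integrable_add)
  also have "\<dots> = (\<integral>\<omega>. min 1 \<bar>X \<omega>\<bar> \<partial>M) + (\<integral>\<omega>. min 1 \<bar>Y \<omega>\<bar> \<partial>M)"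
    by (rule Bochner_Integration.integral_add) auto
  finally show ?thesis by (simp only: L0_norm_def)
qed

lemma L0_norm_minus [simp]: "L0_norm M (\<lambda>\<omega>. - X \<omega>) = L0_norm M X"
  by (simp add: L0_norm_def)

lemma L0_norm_diff:
  assumes [measurable]: "X \<in> borel_measurable M" "Y \<in> borel_measurable M"
  shows "L0_norm M (\<lambda>\<omega>. X \<omega> - Y \<omega>) \<le> L0_norm M X + L0_norm M Y"
  using L0_norm_triangle[of X "\<lambda>\<omega>. - Y \<omega>"] by simp

lemma L0_norm_cong_AE:
  assumes [measurable]: "X \<in> borel_measurable M" "Y \<in> borel_measurable M" and "AE \<omega> in M. X \<omega> = Y \<omega>"
  shows "L0_norm M X = L0_norm M Y"
  unfolding L0_norm_def by (rule integral_cong_AE) (use assms(3) in auto)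

lemma L0_norm_le_tail:
  assumes [measurable]: "X \<in> borel_measurable M" and "0 \<le> t"
  shows "L0_norm M X \<le> t + tail_prob M X t"
proof -
  let ?A = "{\<omega> \<in> space M. t < \<bar>X \<omega>\<bar>}"
  have "L0_norm M X \<le> (\<integral>\<omega>. t + indicator ?A \<omega> \<partial>M)"
    unfolding L0_norm_def
  proof (rule integral_mono)
    show "integrable M (\<lambda>\<omega>. t + indicator ?A \<omega>)" by (intro Bochner_Integration.integrable_add integrable_real_indicator) (auto simp: emeasure_eq_measure)
    show "min 1 \<bar>X \<omega>\<bar> \<le> t + indicator ?A \<omega>" if "\<omega> \<in> space M" for \<omega>
      using that \<open>0 \<le> t\<close> by (auto simp: indicator_def)
  qed auto
  also have "\<dots> = (\<integral>\<omega>. t \<partial>M) + (\<integral>\<omega>. indicator ?A \<omega> \<partial>M)"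
    by (rule Bochner_Integration.integral_add) (auto simp: emeasure_eq_measure intro!: integrable_real_indicator)
  also have "\<dots> = t + tail_prob M X t" by (simp add: prob_space)
  finally show ?thesis .
qed

lemma tail_le_L0_norm:
  assumes [measurable]: "X \<in> borel_measurable M" and t: "0 < t" "t \<le> 1"
  shows "t * tail_prob M X t \<le> L0_norm M X"
proof -
  let ?A = "{\<omega> \<in> space M. t < \<bar>X \<omega>\<bar>}"
  have "t * tail_prob M X t = (\<integral>\<omega>. t * indicator ?A \<omega> \<partial>M)" by simp
  also have "\<dots> \<le> L0_norm M X" unfolding L0_norm_def
  proof (rule integral_mono)
    show "t * indicator ?A \<omega> \<le> min 1 \<bar>X \<omega>\<bar>" for \<omega>
      using t by (auto simp: indicator_def)
    show "integrable M (\<lambda>\<omega>. t * indicator ?A \<omega>)"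
      by (intro integrable_mult_right integrable_real_indicator) (auto simp: emeasure_eq_measure)
  qed auto
  finally show ?thesis .
qed

lemma tail_cong_AE:
  assumes [measurable]: "X \<in> borel_measurable M" "Y \<in> borel_measurable M" and "AE \<omega> in M. X \<omega> = Y \<omega>"
  shows "tail_prob M X t = tail_prob M Y t"
  by (rule finite_measure_eq_AE) (use assms(3) in auto)

lemma tail_antimono:
  assumes [measurable]: "X \<in> borel_measurable M" and "s \<le> t"
  shows "tail_prob M X t \<le> tail_prob M X s"
  by (rule finite_measure_mono) (use assms(2) in auto)

lemma tail_add:
  assumes [measurable]: "X \<in> borel_measurable M" "Y \<in> borel_measurable M"
  shows "tail_prob M (\<lambda>\<omega>. X \<omega> + Y \<omega>) (s + t) \<le> tail_prob M X s + tail_prob M Y t"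
proof -
  have "tail_prob M (\<lambda>\<omega>. X \<omega> + Y \<omega>) (s + t) \<le> prob ({\<omega> \<in> space M. s < \<bar>X \<omega>\<bar>} \<union> {\<omega> \<in> space M. t < \<bar>Y \<omega>\<bar>})"
    by (rule finite_measure_mono) auto
  also have "\<dots> \<le> tail_prob M X s + tail_prob M Y t" by (rule measure_Un_le) auto
  finally show ?thesis .
qed

lemma tail_small:
  assumes [measurable]: "X \<in> borel_measurable M" and "0 < \<eta>"
  shows "\<exists>t\<ge>0. tail_prob M X t \<le> \<eta>"
proof -
  define A where "A n = {\<omega> \<in> space M. real n < \<bar>X \<omega>\<bar>}" for n
  have "(\<lambda>n. prob (A n)) \<longlonglongrightarrow> prob (\<Inter>n. A n)"
    by (rule finite_Lim_measure_decseq) (auto simp: A_def decseq_def)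
  also have "(\<Inter>n. A n) = {}"
  proof -
    have "\<omega> \<notin> (\<Inter>n. A n)" for \<omega>
    proof -
      obtain n where "\<bar>X \<omega>\<bar> < real n" using reals_Archimedean2 by blast
      then have "\<omega> \<notin> A n" by (simp add: A_def)
      then show ?thesis by blast
    qed
    then show ?thesis by blast
  qed
  finally have "\<forall>\<^sub>F n in sequentially. prob (A n) < \<eta>"
    using assms(2) by (intro order_tendstoD) auto
  then obtain n where "prob (A n) < \<eta>" by (auto simp: eventually_sequentially)
  then show ?thesis by (intro exI[of _ "real n"]) (auto simp: A_def)
qed

lemma conv_in_prob_iff:
  assumes [measurable]: "\<And>n. X n \<in> borel_measurable M" "Y \<in> borel_measurable M"
  shows "conv_in_prob M X Y \<longleftrightarrow> (\<lambda>n. L0_norm M (\<lambda>\<omega>. X n \<omega> - Y \<omega>)) \<longlonglongrightarrow> 0"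
proof
  assume conv: "conv_in_prob M X Y"
  show "(\<lambda>n. L0_norm M (\<lambda>\<omega>. X n \<omega> - Y \<omega>)) \<longlonglongrightarrow> 0"
  proof (rule LIMSEQ_I)
    fix r :: real assume r: "0 < r"
    have "(\<lambda>n. tail_prob M (\<lambda>\<omega>. X n \<omega> - Y \<omega>) (r/3)) \<longlonglongrightarrow> 0"
      by (rule conv[unfolded conv_in_prob_def, rule_format]) (use r in simp)
    then have "\<forall>\<^sub>F n in sequentially. tail_prob M (\<lambda>\<omega>. X n \<omega> - Y \<omega>) (r/3) < r/3"
      using r by (intro order_tendstoD) auto
    then obtain N where N: "tail_prob M (\<lambda>\<omega>. X n \<omega> - Y \<omega>) (r/3) < r/3" if "n \<ge> N" for n
      by (auto simp: eventually_sequentially)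
    have "norm (L0_norm M (\<lambda>\<omega>. X n \<omega> - Y \<omega>) - 0) < r" if "n \<ge> N" for n
      using L0_norm_le_tail[of "\<lambda>\<omega>. X n \<omega> - Y \<omega>" "r/3"] N[OF that] r
        L0_norm_nonneg[of "\<lambda>\<omega>. X n \<omega> - Y \<omega>"] by simp
    then show "\<exists>N. \<forall>n\<ge>N. norm (L0_norm M (\<lambda>\<omega>. X n \<omega> - Y \<omega>) - 0) < r" by blast
  qed
next
  assume lim: "(\<lambda>n. L0_norm M (\<lambda>\<omega>. X n \<omega> - Y \<omega>)) \<longlonglongrightarrow> 0"
  show "conv_in_prob M X Y"
    unfolding conv_in_prob_def
  proof (intro allI impI)
    fix \<epsilon> :: real assume e: "0 < \<epsilon>"
    define d where "d = min 1 \<epsilon>"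
    have d: "0 < d" "d \<le> 1" "d \<le> \<epsilon>" using e by (auto simp: d_def)
    show "(\<lambda>n. tail_prob M (\<lambda>\<omega>. X n \<omega> - Y \<omega>) \<epsilon>) \<longlonglongrightarrow> 0"
    proof (rule tendsto_sandwich[of "\<lambda>_. 0" _ _ "\<lambda>n. L0_norm M (\<lambda>\<omega>. X n \<omega> - Y \<omega>) / d"])
      show "\<forall>\<^sub>F n in sequentially. tail_prob M (\<lambda>\<omega>. X n \<omega> - Y \<omega>) \<epsilon> \<le> L0_norm M (\<lambda>\<omega>. X n \<omega> - Y \<omega>) / d"
      proof (rule always_eventually, rule allI)
        fix n
        have "tail_prob M (\<lambda>\<omega>. X n \<omega> - Y \<omega>) \<epsilon> \<le> tail_prob M (\<lambda>\<omega>. X n \<omega> - Y \<omega>) d"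
          using d by (intro tail_antimono) auto
        also have "\<dots> \<le> L0_norm M (\<lambda>\<omega>. X n \<omega> - Y \<omega>) / d"
          using tail_le_L0_norm[of "\<lambda>\<omega>. X n \<omega> - Y \<omega>" d] d by (simp add: field_simps)
        finally show "tail_prob M (\<lambda>\<omega>. X n \<omega> - Y \<omega>) \<epsilon> \<le> L0_norm M (\<lambda>\<omega>. X n \<omega> - Y \<omega>) / d" .
      qed
      show "(\<lambda>n. L0_norm M (\<lambda>\<omega>. X n \<omega> - Y \<omega>) / d) \<longlonglongrightarrow> 0"
        using tendsto_divide[OF lim tendsto_const[of d]] d by simp
    qed auto
  qed
qed

lemma L0_norm_eq_0:
  assumes [measurable]: "X \<in> borel_measurable M" and "L0_norm M X = 0"
  shows "AE \<omega> in M. X \<omega> = 0"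
proof -
  have "AE \<omega> in M. min 1 \<bar>X \<omega>\<bar> = 0"
    using assms(2) unfolding L0_norm_def
    by (subst (asm) integral_nonneg_eq_0_iff_AE) auto
  then show ?thesis by (auto simp: min_def split: if_splits)
qed

lemma conv_in_prob_unique:
  assumes [measurable]: "\<And>n. X n \<in> borel_measurable M" "Y \<in> borel_measurable M" "Z \<in> borel_measurable M"
    and "conv_in_prob M X Y" "conv_in_prob M X Z"
  shows "AE \<omega> in M. Y \<omega> = Z \<omega>"
proof -
  have "(\<lambda>n. L0_norm M (\<lambda>\<omega>. X n \<omega> - Z \<omega>) + L0_norm M (\<lambda>\<omega>. X n \<omega> - Y \<omega>)) \<longlonglongrightarrow> 0 + 0"
    using assms by (intro tendsto_add) (auto simp: conv_in_prob_iff)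
  moreover have "L0_norm M (\<lambda>\<omega>. Y \<omega> - Z \<omega>) \<le> L0_norm M (\<lambda>\<omega>. X n \<omega> - Z \<omega>) + L0_norm M (\<lambda>\<omega>. X n \<omega> - Y \<omega>)" for n
    using L0_norm_diff[of "\<lambda>\<omega>. X n \<omega> - Z \<omega>" "\<lambda>\<omega>. X n \<omega> - Y \<omega>"] by simp
  ultimately have "L0_norm M (\<lambda>\<omega>. Y \<omega> - Z \<omega>) \<le> 0"
    by (intro LIMSEQ_le_const) auto
  then have "L0_norm M (\<lambda>\<omega>. Y \<omega> - Z \<omega>) = 0" using L0_norm_nonneg[of "\<lambda>\<omega>. Y \<omega> - Z \<omega>"] by simp
  then have "AE \<omega> in M. Y \<omega> - Z \<omega> = 0" by (intro L0_norm_eq_0) auto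
  then show ?thesis by simp
qed

lemma conv_in_prob_cong_AE:
  assumes [measurable]: "\<And>n. X n \<in> borel_measurable M" "\<And>n. Y n \<in> borel_measurable M" "Z \<in> borel_measurable M"
    and "conv_in_prob M X Z" "\<And>n. AE \<omega> in M. X n \<omega> = Y n \<omega>"
  shows "conv_in_prob M Y Z"
proof -
  have "L0_norm M (\<lambda>\<omega>. Y n \<omega> - Z \<omega>) = L0_norm M (\<lambda>\<omega>. X n \<omega> - Z \<omega>)" for n
    by (rule L0_norm_cong_AE) (use assms(5)[of n] in auto)
  then show ?thesis using assms(4) by (simp add: conv_in_prob_iff)
qed

lemma conv_in_prob_add:
  assumes [measurable]: "\<And>n. X n \<in> borel_measurable M" "\<And>n. Y n \<in> borel_measurable M"
      "Z \<in> borel_measurable M" "W \<in> borel_measurable M"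
    and "conv_in_prob M X Z" "conv_in_prob M Y W"
  shows "conv_in_prob M (\<lambda>n \<omega>. X n \<omega> + Y n \<omega>) (\<lambda>\<omega>. Z \<omega> + W \<omega>)"
proof -
  have "(\<lambda>n. L0_norm M (\<lambda>\<omega>. X n \<omega> - Z \<omega>) + L0_norm M (\<lambda>\<omega>. Y n \<omega> - W \<omega>)) \<longlonglongrightarrow> 0 + 0"
    using assms by (intro tendsto_add) (auto simp: conv_in_prob_iff)
  moreover have "L0_norm M (\<lambda>\<omega>. X n \<omega> + Y n \<omega> - (Z \<omega> + W \<omega>))
      \<le> L0_norm M (\<lambda>\<omega>. X n \<omega> - Z \<omega>) + L0_norm M (\<lambda>\<omega>. Y n \<omega> - W \<omega>)" for n
    using L0_norm_triangle[of "\<lambda>\<omega>. X n \<omega> - Z \<omega>" "\<lambda>\<omega>. Y n \<omega> - W \<omega>"] by (simp add: algebra_simps)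
  ultimately have "(\<lambda>n. L0_norm M (\<lambda>\<omega>. X n \<omega> + Y n \<omega> - (Z \<omega> + W \<omega>))) \<longlonglongrightarrow> 0"
    by (rule tendsto_0_squeeze) (rule L0_norm_nonneg)
  then show ?thesis by (simp add: conv_in_prob_iff)
qed

lemma conv_in_prob_cmult:
  assumes "conv_in_prob M X Z"
  shows "conv_in_prob M (\<lambda>n \<omega>. c * X n \<omega>) (\<lambda>\<omega>. c * Z \<omega>)"
proof (cases "c = 0")
  case True
  then show ?thesis by (simp add: conv_in_prob_def)
next
  case False
  have "\<epsilon> < \<bar>c * X n \<omega> - c * Z \<omega>\<bar> \<longleftrightarrow> \<epsilon> / \<bar>c\<bar> < \<bar>X n \<omega> - Z \<omega>\<bar>" for \<epsilon> n \<omega>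
  proof -
    have "\<bar>c * X n \<omega> - c * Z \<omega>\<bar> = \<bar>X n \<omega> - Z \<omega>\<bar> * \<bar>c\<bar>"
      unfolding abs_mult[symmetric] by (simp add: algebra_simps)
    then show ?thesis using False by (simp add: pos_divide_less_eq)
  qed
  then show ?thesis using assms False by (simp add: conv_in_prob_def)
qed

lemma conv_in_prob_sum:
  assumes "finite K" and "\<And>k n. k \<in> K \<Longrightarrow> X k n \<in> borel_measurable M" "\<And>k. k \<in> K \<Longrightarrow> Z k \<in> borel_measurable M"
    and "\<And>k. k \<in> K \<Longrightarrow> conv_in_prob M (X k) (Z k)"
  shows "conv_in_prob M (\<lambda>n \<omega>. \<Sum>k\<in>K. X k n \<omega>) (\<lambda>\<omega>. \<Sum>k\<in>K. Z k \<omega>)"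
  using assms
proof (induction K)
  case empty
  then show ?case by (simp add: conv_in_prob_def)
next
  case (insert k K)
  then have "conv_in_prob M (\<lambda>n \<omega>. X k n \<omega> + (\<Sum>k\<in>K. X k n \<omega>)) (\<lambda>\<omega>. Z k \<omega> + (\<Sum>k\<in>K. Z k \<omega>))"
    by (intro conv_in_prob_add borel_measurable_sum) auto
  then show ?case using insert by simp
qed

end

locale stochastic_meas = prob_space M for M :: "'a measure" +
  fixes X :: "'x measure" and \<mu> :: "'x set \<Rightarrow> 'a \<Rightarrow> real"
  assumes sm: "stochastic_measure M X \<mu>"
begin

lemma measurable_mu: "A \<in> sets X \<Longrightarrow> \<mu> A \<in> borel_measurable M"
  using sm by (auto simp: stochastic_measure_def)

lemma sigma_additive:
  assumes "\<And>i::nat. A i \<in> sets X" "disjoint_family A"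
  shows "conv_in_prob M (\<lambda>n \<omega>. \<Sum>i<n. \<mu> (A i) \<omega>) (\<mu> (\<Union>i. A i))"
proof -
  have "range A \<subseteq> sets X" using assms(1) by auto
  then show ?thesis using sm assms(2) by (simp add: stochastic_measure_def)
qed

text \<open>The partial sums of the series for a constantly empty sequence are multiples of \<open>\<mu> {}\<close>; they
  converge only if \<open>\<mu> {}\<close> vanishes.\<close>

lemma mu_empty: "AE \<omega> in M. \<mu> {} \<omega> = 0"
proof -
  have [measurable]: "\<mu> {} \<in> borel_measurable M" by (intro measurable_mu) auto
  have "conv_in_prob M (\<lambda>n \<omega>. \<Sum>i<n. \<mu> {} \<omega>) (\<mu> (\<Union>i::nat. {}))"
    using sigma_additive[of "\<lambda>_. {}"] by (simp add: disjoint_family_on_def)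
  then have "(\<lambda>n. L0_norm M (\<lambda>\<omega>. (\<Sum>i<n. \<mu> {} \<omega>) - \<mu> {} \<omega>)) \<longlonglongrightarrow> 0"
    by (subst (asm) conv_in_prob_iff) auto
  then have "(\<lambda>n. L0_norm M (\<lambda>\<omega>. (\<Sum>i<Suc (Suc n). \<mu> {} \<omega>) - \<mu> {} \<omega>)) \<longlonglongrightarrow> 0"
    by (intro LIMSEQ_Suc)
  moreover have "L0_norm M (\<mu> {}) \<le> L0_norm M (\<lambda>\<omega>. (\<Sum>i<Suc (Suc n). \<mu> {} \<omega>) - \<mu> {} \<omega>)" for n
    unfolding L0_norm_def
  proof (rule integral_mono)
    fix \<omega>
    have "\<bar>(\<Sum>i<Suc (Suc n). \<mu> {} \<omega>) - \<mu> {} \<omega>\<bar> = real (Suc n) * \<bar>\<mu> {} \<omega>\<bar>"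
      by (subst abs_of_nat[symmetric], subst abs_mult[symmetric]) (simp add: algebra_simps)
    also have "\<dots> \<ge> 1 * \<bar>\<mu> {} \<omega>\<bar>" by (intro mult_right_mono) auto
    finally show "min 1 \<bar>\<mu> {} \<omega>\<bar> \<le> min 1 \<bar>(\<Sum>i<Suc (Suc n). \<mu> {} \<omega>) - \<mu> {} \<omega>\<bar>" by simp
  qed auto
  ultimately have "L0_norm M (\<mu> {}) \<le> 0" by (intro LIMSEQ_le_const) auto
  then show ?thesis using L0_norm_nonneg[of "\<mu> {}"] by (intro L0_norm_eq_0) auto
qed

lemma mu_union:
  assumes AB: "A \<in> sets X" "B \<in> sets X" and disj: "A \<inter> B = {}"
  shows "AE \<omega> in M. \<mu> (A \<union> B) \<omega> = \<mu> A \<omega> + \<mu> B \<omega>"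
proof -
  have [measurable]: "\<mu> A \<in> borel_measurable M" "\<mu> B \<in> borel_measurable M" "\<mu> (A \<union> B) \<in> borel_measurable M"
    using AB by (auto intro!: measurable_mu)
  define C where "C i = (if i = 0 then A else if i = Suc 0 then B else {})" for i
  have C: "(\<Union>i. C i) = A \<union> B" "disjoint_family C" "C i \<in> sets X" for i
    using AB disj by (auto simp: C_def disjoint_family_on_def split: if_splits)
  have conv: "conv_in_prob M (\<lambda>n \<omega>. \<Sum>i<n. \<mu> (C i) \<omega>) (\<mu> (A \<union> B))"
    using sigma_additive[of C] C by simp
  have ae: "AE \<omega> in M. (\<Sum>i<Suc (Suc n). \<mu> (C i) \<omega>) = \<mu> A \<omega> + \<mu> B \<omega>" for n
    using mu_empty
  proof eventually_elim
    case (elim \<omega>)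
    have "(\<Sum>i<Suc (Suc n). \<mu> (C i) \<omega>) = \<mu> (C 0) \<omega> + (\<mu> (C (Suc 0)) \<omega> + (\<Sum>i<n. \<mu> (C (Suc (Suc i))) \<omega>))"
      by (simp only: sum.lessThan_Suc_shift)
    then show ?case using elim by (simp add: C_def)
  qed
  have [measurable]: "\<mu> (C i) \<in> borel_measurable M" for i by (intro measurable_mu C)
  have "(\<lambda>n. L0_norm M (\<lambda>\<omega>. (\<Sum>i<n. \<mu> (C i) \<omega>) - \<mu> (A \<union> B) \<omega>)) \<longlonglongrightarrow> 0"
    using conv by (subst (asm) conv_in_prob_iff) auto
  then have "(\<lambda>n. L0_norm M (\<lambda>\<omega>. (\<Sum>i<Suc (Suc n). \<mu> (C i) \<omega>) - \<mu> (A \<union> B) \<omega>)) \<longlonglongrightarrow> 0"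
    by (intro LIMSEQ_Suc)
  moreover have "L0_norm M (\<lambda>\<omega>. (\<Sum>i<Suc (Suc n). \<mu> (C i) \<omega>) - \<mu> (A \<union> B) \<omega>)
      = L0_norm M (\<lambda>\<omega>. \<mu> A \<omega> + \<mu> B \<omega> - \<mu> (A \<union> B) \<omega>)" for n
    by (rule L0_norm_cong_AE) (use ae[of n] in auto)
  ultimately have "L0_norm M (\<lambda>\<omega>. \<mu> A \<omega> + \<mu> B \<omega> - \<mu> (A \<union> B) \<omega>) = 0"
    by (simp add: LIMSEQ_const_iff)
  then have "AE \<omega> in M. \<mu> A \<omega> + \<mu> B \<omega> - \<mu> (A \<union> B) \<omega> = 0"
    by (intro L0_norm_eq_0) auto
  then show ?thesis by eventually_elim simp
qed

lemma mu_diff: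
  assumes "A \<in> sets X" "B \<in> sets X" and "B \<subseteq> A"
  shows "AE \<omega> in M. \<mu> (A - B) \<omega> = \<mu> A \<omega> - \<mu> B \<omega>"
proof -
  have "AE \<omega> in M. \<mu> ((A - B) \<union> B) \<omega> = \<mu> (A - B) \<omega> + \<mu> B \<omega>"
    by (rule mu_union) (use assms in auto)
  moreover have "(A - B) \<union> B = A" using assms by auto
  ultimately show ?thesis by auto
qed

lemma mu_UNION:
  assumes "finite I" "\<And>i. i \<in> I \<Longrightarrow> A i \<in> sets X" "disjoint_family_on A I"
  shows "AE \<omega> in M. \<mu> (\<Union>i\<in>I. A i) \<omega> = (\<Sum>i\<in>I. \<mu> (A i) \<omega>)"
  using assms
proof (induction I)
  case empty then show ?case using mu_empty by simp
next
  case (insert j I)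
  have "A j \<inter> (\<Union>i\<in>I. A i) = {}" using insert by (auto simp: disjoint_family_on_def)
  moreover have "(\<Union>i\<in>I. A i) \<in> sets X" using insert by auto
  ultimately have "AE \<omega> in M. \<mu> (A j \<union> (\<Union>i\<in>I. A i)) \<omega> = \<mu> (A j) \<omega> + \<mu> (\<Union>i\<in>I. A i) \<omega>"
    using insert by (intro mu_union) auto
  moreover have "AE \<omega> in M. \<mu> (\<Union>i\<in>I. A i) \<omega> = (\<Sum>i\<in>I. \<mu> (A i) \<omega>)"
    using insert by (auto simp: disjoint_family_on_def)
  ultimately show ?case by eventually_elim (use insert in simp)
qed

lemma mu_Union:
  assumes "finite \<I>" "\<I> \<subseteq> sets X" "disjoint \<I>"
  shows "AE \<omega> in M. \<mu> (\<Union>\<I>) \<omega> = (\<Sum>A\<in>\<I>. \<mu> A \<omega>)"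
  using mu_UNION[of \<I> "\<lambda>A. A"] assms by (auto simp: disjoint_def disjoint_family_on_def)

lemma mu_disjoint_tendsto_0:
  assumes A: "\<And>i::nat. A i \<in> sets X" "disjoint_family A"
  shows "(\<lambda>n. L0_norm M (\<mu> (A n))) \<longlonglongrightarrow> 0"
proof -
  have [measurable]: "\<mu> (A i) \<in> borel_measurable M" for i by (intro measurable_mu A(1))
  have [measurable]: "\<mu> (\<Union>i. A i) \<in> borel_measurable M" using A(1) by (intro measurable_mu) auto
  have lim: "(\<lambda>n. L0_norm M (\<lambda>\<omega>. (\<Sum>i<n. \<mu> (A i) \<omega>) - \<mu> (\<Union>i. A i) \<omega>)) \<longlonglongrightarrow> 0"
    using sigma_additive[OF A] by (subst (asm) conv_in_prob_iff) auto
  have "(\<lambda>n. L0_norm M (\<lambda>\<omega>. (\<Sum>i<Suc n. \<mu> (A i) \<omega>) - \<mu> (\<Union>i. A i) \<omega>)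
      + L0_norm M (\<lambda>\<omega>. (\<Sum>i<n. \<mu> (A i) \<omega>) - \<mu> (\<Union>i. A i) \<omega>)) \<longlonglongrightarrow> 0 + 0"
    by (intro tendsto_add lim LIMSEQ_Suc)
  moreover have "L0_norm M (\<mu> (A n)) \<le> L0_norm M (\<lambda>\<omega>. (\<Sum>i<Suc n. \<mu> (A i) \<omega>) - \<mu> (\<Union>i. A i) \<omega>)
      + L0_norm M (\<lambda>\<omega>. (\<Sum>i<n. \<mu> (A i) \<omega>) - \<mu> (\<Union>i. A i) \<omega>)" for n
    using L0_norm_diff[of "\<lambda>\<omega>. (\<Sum>i<Suc n. \<mu> (A i) \<omega>) - \<mu> (\<Union>i. A i) \<omega>"
        "\<lambda>\<omega>. (\<Sum>i<n. \<mu> (A i) \<omega>) - \<mu> (\<Union>i. A i) \<omega>"] by simp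
  ultimately show ?thesis
    by (rule tendsto_0_squeeze) (rule L0_norm_nonneg)
qed

lemma mu_decreasing_tendsto_0:
  assumes A: "\<And>i::nat. A i \<in> sets X" "decseq A" "(\<Inter>i. A i) = {}"
  shows "(\<lambda>n. L0_norm M (\<mu> (A n))) \<longlonglongrightarrow> 0"
proof -
  have [measurable]: "\<mu> (A i) \<in> borel_measurable M" for i by (intro measurable_mu A(1))
  define D where "D i = A i - A (Suc i)" for i
  have D: "D i \<in> sets X" for i using A(1) by (auto simp: D_def)
  have [measurable]: "\<mu> (D i) \<in> borel_measurable M" for i by (intro measurable_mu D)
  have sub: "i \<le> j \<Longrightarrow> A j \<subseteq> A i" for i j using A(2) by (auto simp: decseq_def)
  have disj: "disjoint_family D"
    unfolding disjoint_family_on_def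
  proof safe
    fix m n :: nat and x assume x: "m \<noteq> n" "x \<in> D m" "x \<in> D n"
    then have "Suc m \<le> n \<or> Suc n \<le> m" by auto
    then show "x \<in> {}" using x sub[of "Suc m" n] sub[of "Suc n" m] by (auto simp: D_def)
  qed
  have U: "(\<Union>i. D i) = A 0"
  proof
    show "(\<Union>i. D i) \<subseteq> A 0" using sub by (fastforce simp: D_def)
    show "A 0 \<subseteq> (\<Union>i. D i)"
    proof
      fix x assume x: "x \<in> A 0"
      have "\<exists>n. x \<notin> A n" using A(3) by auto
      define n where "n = (LEAST n. x \<notin> A n)"
      have n: "x \<notin> A n" unfolding n_def using \<open>\<exists>n. x \<notin> A n\<close> by (rule LeastI_ex)
      then obtain k where k: "n = Suc k" using x by (cases n) auto
      then have "x \<in> A k" using not_less_Least[of k "\<lambda>n. x \<notin> A n"] by (auto simp: n_def)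
      then show "x \<in> (\<Union>i. D i)" using n k by (auto simp: D_def)
    qed
  qed
  have "(\<lambda>n. L0_norm M (\<lambda>\<omega>. (\<Sum>i<n. \<mu> (D i) \<omega>) - \<mu> (A 0) \<omega>)) \<longlonglongrightarrow> 0"
    using sigma_additive[OF D disj] unfolding U by (subst (asm) conv_in_prob_iff) auto
  moreover have "L0_norm M (\<lambda>\<omega>. (\<Sum>i<n. \<mu> (D i) \<omega>) - \<mu> (A 0) \<omega>) = L0_norm M (\<lambda>\<omega>. - \<mu> (A n) \<omega>)" for n
  proof (rule L0_norm_cong_AE)
    have "AE \<omega> in M. \<forall>i. \<mu> (D i) \<omega> = \<mu> (A i) \<omega> - \<mu> (A (Suc i)) \<omega>"
      unfolding AE_all_countable D_def using A(1) sub by (intro allI mu_diff) auto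
    then show "AE \<omega> in M. (\<Sum>i<n. \<mu> (D i) \<omega>) - \<mu> (A 0) \<omega> = - \<mu> (A n) \<omega>"
    proof eventually_elim
      case (elim \<omega>)
      have "(\<Sum>i<n. \<mu> (D i) \<omega>) = \<mu> (A 0) \<omega> - \<mu> (A n) \<omega>" using elim by (induction n) auto
      then show ?case by simp
    qed
  qed auto
  ultimately show ?thesis by simp
qed

end

section \<open>The range of a stochastic measure is bounded in probability\<close>

lemma subset_avg_integral:
  assumes "finite I" "\<And>S. S \<subseteq> I \<Longrightarrow> integrable M (\<lambda>\<omega>. F \<omega> S)"
  shows "integrable M (\<lambda>\<omega>. subset_avg I q (F \<omega>))"
    and "(\<integral>\<omega>. subset_avg I q (F \<omega>) \<partial>M) = subset_avg I q (\<lambda>S. \<integral>\<omega>. F \<omega> S \<partial>M)"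
  using assms unfolding subset_avg_def by (auto intro!: Bochner_Integration.integrable_sum)

text \<open>The members of \<open>\<I>\<close> are the atoms of the algebra generated by \<open>\<C>\<close> inside its union.\<close>

lemma finite_refinement:
  assumes fin: "finite \<C>" and \<C>: "\<C> \<subseteq> sets X"
  shows "\<exists>\<I>. finite \<I> \<and> \<I> \<subseteq> sets X \<and> disjoint \<I> \<and> {} \<notin> \<I> \<and> \<Union>\<I> = \<Union>\<C>
    \<and> (\<forall>i\<in>\<I>. \<forall>C\<in>\<C>. i \<subseteq> C \<or> i \<inter> C = {}) \<and> (\<forall>C\<in>\<C>. \<Union>{i \<in> \<I>. i \<subseteq> C} = C)"
proof -
  define cell where "cell s = \<Inter>s - \<Union>(\<C> - s)" for s
  define \<I> where "\<I> = cell ` {s. s \<subseteq> \<C> \<and> s \<noteq> {}} - {{}}"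
  have 1: "finite \<I>" unfolding \<I>_def using fin by auto
  have 2: "\<I> \<subseteq> sets X"
  proof -
    have "cell s \<in> sets X" if "s \<subseteq> \<C>" "s \<noteq> {}" for s
    proof -
      have "(\<Inter>C\<in>s. C) \<in> sets X" using that fin \<C> by (intro sets.finite_INT) (auto intro: finite_subset)
      moreover have "\<Union>(\<C> - s) \<in> sets X" using fin \<C> by (intro sets.finite_Union) auto
      ultimately show ?thesis by (auto simp: cell_def)
    qed
    then show ?thesis by (auto simp: \<I>_def)
  qed
  have cell: "x \<in> cell s \<longleftrightarrow> s = {C \<in> \<C>. x \<in> C}" if "s \<subseteq> \<C>" "s \<noteq> {}" for x s
    using that by (auto simp: cell_def)
  have 3: "disjoint \<I>"
  proof (rule disjointI)
    fix i j assume ij: "i \<in> \<I>" "j \<in> \<I>" "i \<noteq> j"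
    from ij(1) obtain s where s: "s \<subseteq> \<C>" "s \<noteq> {}" "i = cell s" by (auto simp: \<I>_def)
    from ij(2) obtain t where t: "t \<subseteq> \<C>" "t \<noteq> {}" "j = cell t" by (auto simp: \<I>_def)
    show "i \<inter> j = {}"
    proof (rule ccontr)
      assume "i \<inter> j \<noteq> {}"
      then obtain x where x: "x \<in> i" "x \<in> j" by blast
      have "s = t" using x unfolding s(3) t(3) cell[OF s(1,2)] cell[OF t(1,2)] by simp
      then show False using ij s t by simp
    qed
  qed
  have 4: "{} \<notin> \<I>" by (simp add: \<I>_def)
  have 5: "i \<subseteq> C \<or> i \<inter> C = {}" if i: "i \<in> \<I>" and C: "C \<in> \<C>" for i C
  proof -
    obtain s where "s \<subseteq> \<C>" "s \<noteq> {}" "i = cell s" using i by (auto simp: \<I>_def)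
    then show ?thesis using C by (cases "C \<in> s") (auto simp: cell_def)
  qed
  have 6: "\<exists>i\<in>\<I>. x \<in> i" if x: "x \<in> \<Union>\<C>" for x
  proof -
    define s where "s = {C \<in> \<C>. x \<in> C}"
    have s: "s \<subseteq> \<C>" "s \<noteq> {}" using x by (auto simp: s_def)
    then have "x \<in> cell s" by (simp add: cell s_def)
    then show ?thesis using s by (intro bexI[of _ "cell s"]) (auto simp: \<I>_def)
  qed
  have sub: "\<Union>\<I> \<subseteq> \<Union>\<C>" by (auto simp: \<I>_def cell_def)
  have 7: "\<Union>{i \<in> \<I>. i \<subseteq> C} = C" if C: "C \<in> \<C>" for C
  proof
    show "C \<subseteq> \<Union>{i \<in> \<I>. i \<subseteq> C}"
    proof
      fix x assume x: "x \<in> C"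
      then obtain i where i: "i \<in> \<I>" "x \<in> i" using 6 C by blast
      then have "i \<subseteq> C" using 5[OF i(1) C] x by blast
      then show "x \<in> \<Union>{i \<in> \<I>. i \<subseteq> C}" using i by blast
    qed
  qed auto
  have 8: "\<Union>\<I> = \<Union>\<C>" using sub 6 by blast
  show ?thesis
    using 1 2 3 4 5 7 8 by (intro exI[of _ \<I>] conjI ballI)
qed

lemma sum_Un_le:
  fixes g :: "'b \<Rightarrow> real"
  assumes "finite A" "finite B" "\<And>x. 0 \<le> g x"
  shows "sum g (A \<union> B) \<le> sum g A + sum g B"
proof -
  have "sum g (A \<union> B) + sum g (A \<inter> B) = sum g A + sum g B" using assms by (intro sum.union_inter)
  moreover have "0 \<le> sum g (A \<inter> B)" using assms by (intro sum_nonneg) auto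
  ultimately show ?thesis by linarith
qed

lemma sum_geometric_half_le: "(\<Sum>T\<le>n. (1/2::real)^T) \<le> 2"
proof -
  have "(\<Sum>T\<le>n. (1/2::real)^T) = 2 - (1/2)^n" by (induction n) auto
  then show ?thesis by simp
qed

context prob_space
begin

lemma AE_prob_null:
  assumes "AE \<omega> in M. P \<omega>"
  obtains N where "N \<in> events" "prob N = 0" "\<And>\<omega>. \<omega> \<in> space M - N \<Longrightarrow> P \<omega>"
proof -
  obtain N where "{\<omega>\<in>space M. \<not> P \<omega>} \<subseteq> N" "N \<in> events" "emeasure M N = 0"
    using assms by (rule AE_E)
  then show thesis by (intro that[of N]) (auto simp: measure_def)
qed

end

context stochastic_meas
begin

text \<open>The event that the measures of \<open>B T \<inter> E\<close>, damped by \<open>(1/2) ^ T\<close>, are unbounded. The damping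
  lets the indicators of the \<open>B T\<close>, with the weights \<open>(1/2) ^ T\<close>, be added up to a bounded function
  later. This event need not grow with \<open>E\<close>, since cancellation may occur; it is subadditive.\<close>

definition unbounded_on :: "(nat \<Rightarrow> 'x set) \<Rightarrow> 'x set \<Rightarrow> 'a set" where
  "unbounded_on B E = {\<omega> \<in> space M. \<forall>n. \<exists>T. real n * 2 ^ T < \<bar>\<mu> (B T \<inter> E) \<omega>\<bar>}"

lemma unbounded_on_sets:
  assumes "\<And>T. B T \<in> sets X" "E \<in> sets X"
  shows "unbounded_on B E \<in> events"
proof -
  have [measurable]: "\<mu> (B T \<inter> E) \<in> borel_measurable M" for T
    using assms by (intro measurable_mu) auto
  show ?thesis unfolding unbounded_on_def by measurable
qed

lemma unbounded_on_Union:
  assumes B: "\<And>T. B T \<in> sets X" and I: "finite \<I>" "\<I> \<subseteq> sets X" "disjoint \<I>"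
  shows "AE \<omega> in M. \<omega> \<in> unbounded_on B (\<Union>\<I>) \<longrightarrow> (\<exists>i\<in>\<I>. \<omega> \<in> unbounded_on B i)"
proof -
  have disj: "disjoint_family_on (\<lambda>i. B T \<inter> i) \<I>" for T
    using disjointD[OF I(3)] unfolding disjoint_family_on_def by blast
  have "AE \<omega> in M. \<forall>T. \<mu> (\<Union>i\<in>\<I>. B T \<inter> i) \<omega> = (\<Sum>i\<in>\<I>. \<mu> (B T \<inter> i) \<omega>)"
    unfolding AE_all_countable
    by (intro allI mu_UNION disj) (use B I in auto)
  then show ?thesis
  proof (eventually_elim, safe)
    fix \<omega>
    assume *: "\<forall>T. \<mu> (\<Union>i\<in>\<I>. B T \<inter> i) \<omega> = (\<Sum>i\<in>\<I>. \<mu> (B T \<inter> i) \<omega>)" and \<omega>: "\<omega> \<in> unbounded_on B (\<Union>\<I>)"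
    show "\<exists>i\<in>\<I>. \<omega> \<in> unbounded_on B i"
    proof (rule ccontr)
      assume "\<not> ?thesis"
      then have "\<forall>i\<in>\<I>. \<exists>n. \<forall>T. \<bar>\<mu> (B T \<inter> i) \<omega>\<bar> \<le> real n * 2 ^ T"
        using \<omega> by (auto simp: unbounded_on_def not_less)
      then obtain n where n: "\<And>i T. i \<in> \<I> \<Longrightarrow> \<bar>\<mu> (B T \<inter> i) \<omega>\<bar> \<le> real (n i) * 2 ^ T" by metis
      obtain T where T: "real (\<Sum>i\<in>\<I>. n i) * 2 ^ T < \<bar>\<mu> (B T \<inter> \<Union>\<I>) \<omega>\<bar>"
        using \<omega> unfolding unbounded_on_def by blast
      have "\<bar>\<mu> (B T \<inter> \<Union>\<I>) \<omega>\<bar> = \<bar>\<Sum>i\<in>\<I>. \<mu> (B T \<inter> i) \<omega>\<bar>"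
        using *[rule_format, of T] by (simp add: Int_UN_distrib[symmetric])
      also have "\<dots> \<le> (\<Sum>i\<in>\<I>. \<bar>\<mu> (B T \<inter> i) \<omega>\<bar>)" by (rule sum_abs)
      also have "\<dots> \<le> (\<Sum>i\<in>\<I>. real (n i) * 2 ^ T)" by (intro sum_mono n)
      also have "\<dots> = real (\<Sum>i\<in>\<I>. n i) * 2 ^ T" by (simp add: sum_distrib_right)
      finally show False using T by simp
    qed
  qed
qed

text \<open>A pair \<open>d\<close> stands for the function \<open>(1/2) ^ fst d * indicator (snd d)\<close>. A splitting is a
  finite family of such functions with bounded sum from which, at every \<open>\<omega>\<close> off the exceptional
  set \<open>N\<close> at which \<open>\<mu>\<close> is unbounded on \<open>E\<close>, one can pick \<open>L\<close> functions with disjoint supports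
  and integrals of modulus at least \<open>R\<close>. It plays the role of a partition with many large
  members, which cannot be chosen independently of \<open>\<omega>\<close>.\<close>

definition is_splitting ::
  "(nat \<Rightarrow> 'x set) \<Rightarrow> real \<Rightarrow> nat \<Rightarrow> real \<Rightarrow> 'x set \<Rightarrow> (nat \<times> 'x set) set \<Rightarrow> 'a set \<Rightarrow> bool" where
  "is_splitting B R L \<eta> E \<Psi> N \<longleftrightarrow>
     finite \<Psi> \<and> (\<forall>d\<in>\<Psi>. snd d \<in> sets X \<and> snd d \<subseteq> E)
     \<and> (\<forall>x. (\<Sum>d\<in>\<Psi>. (1/2) ^ fst d * indicator (snd d) x) \<le> 4 * real L)
     \<and> N \<in> events \<and> prob N \<le> \<eta>
     \<and> (\<forall>\<omega>\<in>unbounded_on B E - N. \<exists>\<D>\<subseteq>\<Psi>. card \<D> = L \<and> disjoint_family_on snd \<D>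
           \<and> (\<forall>d\<in>\<D>. R * 2 ^ fst d \<le> \<bar>\<mu> (snd d) \<omega>\<bar>))"

text \<open>Induction on \<open>L\<close>, splitting \<open>E\<close> at the top by finitely many of the sets \<open>B T\<close>. For a given
  \<open>\<omega>\<close> some \<open>B T \<inter> E\<close> has a huge measure, and so has \<open>E - B T\<close>, because \<open>\<mu> E\<close> is tight.
  Some cell of the partition is again unbounded at \<open>\<omega>\<close>; it lies on one side of \<open>B T\<close>, the other
  side supplies the new function, and the induction hypothesis for the cell supplies the others.\<close>

lemma splitting_tree:
  assumes B: "\<And>T. B T \<in> sets X" and R: "0 < R"
  shows "E \<in> sets X \<Longrightarrow> 0 < \<eta> \<Longrightarrow> \<exists>\<Psi> N. is_splitting B R L \<eta> E \<Psi> N"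
proof (induction L arbitrary: E \<eta>)
  case 0
  then show ?case
    unfolding is_splitting_def
    by (intro exI[of _ "{}"]) (auto intro!: exI[of _ "{}"] simp: disjoint_family_on_def)
next
  case (Suc L)
  have E: "E \<in> sets X" by fact
  have [measurable]: "\<mu> E \<in> borel_measurable M" using E by (rule measurable_mu)
  have [measurable]: "\<mu> (B T \<inter> E) \<in> borel_measurable M" for T using E B by (intro measurable_mu) auto
  have U[measurable]: "unbounded_on B E \<in> events" using B E by (intro unbounded_on_sets)
  obtain r where r: "0 \<le> r" "tail_prob M (\<mu> E) r \<le> \<eta> / 4"
    using tail_small[of "\<mu> E" "\<eta> / 4"] Suc by auto
  define N1 where "N1 = {\<omega> \<in> space M. r < \<bar>\<mu> E \<omega>\<bar>}"
  have N1: "N1 \<in> events" "prob N1 \<le> \<eta> / 4" using r by (auto simp: N1_def)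
  obtain k :: nat where k: "R + r \<le> real k" using real_arch_simple by blast
  \<comment> \<open>finitely many of the sets \<open>B T\<close> serve all \<open>\<omega>\<close> outside an event of small probability\<close>
  define V where "V n = {\<omega> \<in> unbounded_on B E. \<forall>T\<le>n. \<bar>\<mu> (B T \<inter> E) \<omega>\<bar> \<le> real k * 2 ^ T}" for n
  have V: "V n \<in> events" for n
  proof -
    have "V n = unbounded_on B E \<inter> {\<omega> \<in> space M. \<forall>T\<le>n. \<bar>\<mu> (B T \<inter> E) \<omega>\<bar> \<le> real k * 2 ^ T}"
      by (auto simp: V_def unbounded_on_def)
    also have "\<dots> \<in> events" by measurable
    finally show ?thesis .
  qed
  have "(\<lambda>n. prob (V n)) \<longlonglongrightarrow> prob (\<Inter>n. V n)"
    by (rule finite_Lim_measure_decseq) (use V in \<open>auto simp: V_def decseq_def\<close>)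
  also have "(\<Inter>n. V n) = {}"
  proof -
    have "\<omega> \<notin> (\<Inter>n. V n)" for \<omega>
    proof
      assume *: "\<omega> \<in> (\<Inter>n. V n)"
      then have "\<omega> \<in> V 0" by blast
      then have "\<omega> \<in> unbounded_on B E" by (simp add: V_def)
      then obtain T where T: "real k * 2 ^ T < \<bar>\<mu> (B T \<inter> E) \<omega>\<bar>"
        unfolding unbounded_on_def by blast
      have "\<omega> \<in> V T" using * by blast
      then show False using T by (auto simp: V_def)
    qed
    then show ?thesis by blast
  qed
  finally have "\<forall>\<^sub>F n in sequentially. prob (V n) < \<eta> / 4"
    using Suc by (intro order_tendstoD) auto
  then obtain n where "\<forall>m\<ge>n. prob (V m) < \<eta> / 4" unfolding eventually_sequentially by blast
  then have n: "prob (V n) \<le> \<eta> / 4" by (meson order.refl less_imp_le)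
  have "AE \<omega> in M. \<forall>T. \<mu> (E - B T \<inter> E) \<omega> = \<mu> E \<omega> - \<mu> (B T \<inter> E) \<omega>"
    unfolding AE_all_countable by (intro allI mu_diff) (use E B in auto)
  then obtain N3 where N3: "N3 \<in> events" "prob N3 = 0"
    "\<And>\<omega> T. \<omega> \<in> space M - N3 \<Longrightarrow> \<mu> (E - B T \<inter> E) \<omega> = \<mu> E \<omega> - \<mu> (B T \<inter> E) \<omega>"
    by (rule AE_prob_null) blast
  define P1 where "P1 = (\<lambda>T. (T, B T \<inter> E)) ` {..n}"
  define P2 where "P2 = (\<lambda>T. (T, E - B T \<inter> E)) ` {..n}"
  have finP: "finite P1" "finite P2" by (auto simp: P1_def P2_def)
  have snd12: "\<forall>d\<in>P1 \<union> P2. snd d \<in> sets X \<and> snd d \<subseteq> E" using B E by (auto simp: P1_def P2_def)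
  have finS12: "finite (snd ` (P1 \<union> P2))" and setsS12: "snd ` (P1 \<union> P2) \<subseteq> sets X" using finP snd12 by auto
  obtain \<I> where \<I>: "finite \<I>" "\<I> \<subseteq> sets X" "disjoint \<I>" "{} \<notin> \<I>" "\<Union>\<I> = \<Union>(snd ` (P1 \<union> P2))"
    "\<forall>i\<in>\<I>. \<forall>C\<in>snd ` (P1 \<union> P2). i \<subseteq> C \<or> i \<inter> C = {}"
    using finite_refinement[OF finS12 setsS12] by (elim exE conjE) (rule that)
  have UE: "\<Union>\<I> = E"
  proof -
    have "B 0 \<inter> E \<in> snd ` (P1 \<union> P2)" "E - B 0 \<inter> E \<in> snd ` (P1 \<union> P2)"
      by (force simp: P1_def P2_def)+
    then show ?thesis unfolding \<I>(5) using snd12 by blast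
  qed
  have ae4: "AE \<omega> in M. \<omega> \<in> unbounded_on B E \<longrightarrow> (\<exists>i\<in>\<I>. \<omega> \<in> unbounded_on B i)"
    using unbounded_on_Union[OF B \<I>(1-3)] unfolding UE .
  obtain N4 where N4: "N4 \<in> events" "prob N4 = 0"
    "\<And>\<omega>. \<omega> \<in> space M - N4 \<Longrightarrow> \<omega> \<in> unbounded_on B E \<longrightarrow> (\<exists>i\<in>\<I>. \<omega> \<in> unbounded_on B i)"
    by (rule AE_prob_null[OF ae4]) (rule that)
  obtain N5 where N5: "N5 \<in> events" "prob N5 = 0" "\<And>\<omega>. \<omega> \<in> space M - N5 \<Longrightarrow> \<mu> {} \<omega> = 0"
    by (rule AE_prob_null[OF mu_empty]) (rule that)
  define \<eta>' where "\<eta>' = \<eta> / 4 / real (card \<I> + 1)"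
  have \<eta>': "0 < \<eta>'" using Suc by (simp add: \<eta>'_def)
  have "\<exists>\<Psi> N. is_splitting B R L \<eta>' i \<Psi> N" if "i \<in> \<I>" for i
    using Suc.IH[OF _ \<eta>'] \<I>(2) that by blast
  then obtain \<Psi> N where split: "\<And>i. i \<in> \<I> \<Longrightarrow> is_splitting B R L \<eta>' i (\<Psi> i) (N i)"
    by metis
  have \<Psi>: "\<And>i. i \<in> \<I> \<Longrightarrow> finite (\<Psi> i)"
      "\<And>i d. i \<in> \<I> \<Longrightarrow> d \<in> \<Psi> i \<Longrightarrow> snd d \<in> sets X \<and> snd d \<subseteq> i"
      "\<And>i x. i \<in> \<I> \<Longrightarrow> (\<Sum>d\<in>\<Psi> i. (1/2) ^ fst d * indicator (snd d) x) \<le> 4 * real L"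
    and N: "\<And>i. i \<in> \<I> \<Longrightarrow> N i \<in> events" "\<And>i. i \<in> \<I> \<Longrightarrow> prob (N i) \<le> \<eta>'"
    using split unfolding is_splitting_def by blast+
  have \<Psi>_large: "\<exists>\<D>\<subseteq>\<Psi> i. card \<D> = L \<and> disjoint_family_on snd \<D> \<and> (\<forall>d\<in>\<D>. R * 2 ^ fst d \<le> \<bar>\<mu> (snd d) \<omega>\<bar>)"
    if "i \<in> \<I>" "\<omega> \<in> unbounded_on B i - N i" for i \<omega>
    using split[OF that(1)] that(2) unfolding is_splitting_def by blast
  define \<Psi>' where "\<Psi>' = (P1 \<union> P2) \<union> (\<Union>i\<in>\<I>. \<Psi> i)"
  define N' where "N' = (N1 \<union> V n) \<union> (N3 \<union> (N4 \<union> (N5 \<union> (\<Union>i\<in>\<I>. N i))))"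
  have fin\<Psi>': "finite \<Psi>'" using finP \<I>(1) \<Psi>(1) by (auto simp: \<Psi>'_def)
  have snd': "\<forall>d\<in>\<Psi>'. snd d \<in> sets X \<and> snd d \<subseteq> E"
    using snd12 \<Psi>(2) UE unfolding \<Psi>'_def by blast
  have sum': "(\<Sum>d\<in>\<Psi>'. (1/2) ^ fst d * indicator (snd d) x) \<le> 4 * real (Suc L)" for x
  proof -
    let ?g = "\<lambda>d. (1/2) ^ fst d * indicator (snd d) x :: real"
    have g0: "0 \<le> ?g d" for d by simp
    have half: "(\<Sum>d\<in>(\<lambda>T. (T, C T)) ` {..n}. ?g d) \<le> 2" for C
    proof -
      have "(\<Sum>d\<in>(\<lambda>T. (T, C T)) ` {..n}. ?g d) = (\<Sum>T\<le>n. (1/2)^T * indicator (C T) x)"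
        by (subst sum.reindex) (auto simp: inj_on_def)
      also have "\<dots> \<le> (\<Sum>T\<le>n. (1/2)^T * 1)" by (intro sum_mono mult_left_mono) (auto simp: indicator_def)
      also have "\<dots> \<le> 2" using sum_geometric_half_le[of n] by simp
      finally show ?thesis .
    qed
    have "sum ?g (\<Union>i\<in>\<I>. \<Psi> i) \<le> 4 * real L"
    proof (cases "\<exists>i\<in>\<I>. x \<in> i")
      case True
      then obtain i where i: "i \<in> \<I>" "x \<in> i" by blast
      have "sum ?g (\<Union>i\<in>\<I>. \<Psi> i) = sum ?g (\<Psi> i)"
      proof (rule sum.mono_neutral_right)
        show "finite (\<Union>i\<in>\<I>. \<Psi> i)" using \<I>(1) \<Psi>(1) by auto
        show "\<Psi> i \<subseteq> (\<Union>i\<in>\<I>. \<Psi> i)" using i by auto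
        show "\<forall>d\<in>(\<Union>i\<in>\<I>. \<Psi> i) - \<Psi> i. ?g d = 0"
        proof
          fix d assume "d \<in> (\<Union>i\<in>\<I>. \<Psi> i) - \<Psi> i"
          then obtain j where j: "j \<in> \<I>" "d \<in> \<Psi> j" "j \<noteq> i" by blast
          then have "i \<inter> j = {}" using i \<I>(3) by (auto dest: disjointD)
          then have "x \<notin> snd d" using \<Psi>(2)[OF j(1,2)] i by blast
          then show "?g d = 0" by simp
        qed
      qed
      then show ?thesis using \<Psi>(3)[OF i(1)] by simp
    next
      case False
      have "sum ?g (\<Union>i\<in>\<I>. \<Psi> i) = 0"
      proof (rule sum.neutral, rule ballI)
        fix d assume "d \<in> (\<Union>i\<in>\<I>. \<Psi> i)"
        then obtain j where j: "j \<in> \<I>" "d \<in> \<Psi> j" by blast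
        then have "x \<notin> snd d" using \<Psi>(2)[OF j] False by blast
        then show "?g d = 0" by simp
      qed
      then show ?thesis by simp
    qed
    moreover have "sum ?g (P1 \<union> P2) \<le> sum ?g P1 + sum ?g P2" using finP by (intro sum_Un_le) auto
    moreover have "sum ?g P1 \<le> 2" "sum ?g P2 \<le> 2" unfolding P1_def P2_def by (rule half)+
    moreover have "sum ?g \<Psi>' \<le> sum ?g (P1 \<union> P2) + sum ?g (\<Union>i\<in>\<I>. \<Psi> i)"
      unfolding \<Psi>'_def using finP \<I>(1) \<Psi>(1) by (intro sum_Un_le) auto
    ultimately show ?thesis by simp
  qed
  have Nev: "(\<Union>i\<in>\<I>. N i) \<in> events" using N(1) \<I>(1) by auto
  have N'ev: "N' \<in> events" unfolding N'_def using N1 V N3 N4 N5 Nev by auto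
  have N'prob: "prob N' \<le> \<eta>"
  proof -
    have "prob (\<Union>i\<in>\<I>. N i) \<le> (\<Sum>i\<in>\<I>. prob (N i))"
      using \<I>(1) N by (intro finite_measure_subadditive_finite) auto
    also have "\<dots> \<le> (\<Sum>i\<in>\<I>. \<eta>')" by (intro sum_mono N)
    also have "\<dots> \<le> \<eta> / 4" using Suc by (simp add: \<eta>'_def field_simps)
    finally have a: "prob (\<Union>i\<in>\<I>. N i) \<le> \<eta> / 4" .
    have "prob (N5 \<union> (\<Union>i\<in>\<I>. N i)) \<le> prob N5 + prob (\<Union>i\<in>\<I>. N i)" using N5 Nev by (intro measure_Un_le) auto
    moreover have "prob (N4 \<union> (N5 \<union> (\<Union>i\<in>\<I>. N i))) \<le> prob N4 + prob (N5 \<union> (\<Union>i\<in>\<I>. N i))"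
      using N4 N5 Nev by (intro measure_Un_le) auto
    moreover have "prob (N3 \<union> (N4 \<union> (N5 \<union> (\<Union>i\<in>\<I>. N i)))) \<le> prob N3 + prob (N4 \<union> (N5 \<union> (\<Union>i\<in>\<I>. N i)))"
      using N3 N4 N5 Nev by (intro measure_Un_le) auto
    moreover have "prob (N1 \<union> V n) \<le> prob N1 + prob (V n)" using N1 V by (intro measure_Un_le) auto
    moreover have "prob N' \<le> prob (N1 \<union> V n) + prob (N3 \<union> (N4 \<union> (N5 \<union> (\<Union>i\<in>\<I>. N i))))"
      unfolding N'_def using N1 V N3 N4 N5 Nev by (intro measure_Un_le) auto
    ultimately show ?thesis using a N1(2) N3(2) N4(2) N5(2) n Suc.prems(2) by linarith
  qed
  have "\<exists>\<D>\<subseteq>\<Psi>'. card \<D> = Suc L \<and> disjoint_family_on snd \<D> \<and> (\<forall>d\<in>\<D>. R * 2 ^ fst d \<le> \<bar>\<mu> (snd d) \<omega>\<bar>)"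
    if \<omega>: "\<omega> \<in> unbounded_on B E - N'" for \<omega>
  proof -
    have \<omega>U: "\<omega> \<in> unbounded_on B E" and \<omega>N: "\<omega> \<notin> N1" "\<omega> \<notin> V n" "\<omega> \<notin> N3" "\<omega> \<notin> N4" "\<omega> \<notin> N5"
      "\<And>i. i \<in> \<I> \<Longrightarrow> \<omega> \<notin> N i"
      using \<omega> by (auto simp: N'_def)
    have \<omega>M: "\<omega> \<in> space M" using \<omega>U by (simp add: unbounded_on_def)
    obtain i where i: "i \<in> \<I>" "\<omega> \<in> unbounded_on B i" using N4(3)[of \<omega>] \<omega>M \<omega>N \<omega>U by blast
    obtain \<D> where \<D>: "\<D> \<subseteq> \<Psi> i" "card \<D> = L" "disjoint_family_on snd \<D>" "\<forall>d\<in>\<D>. R * 2 ^ fst d \<le> \<bar>\<mu> (snd d) \<omega>\<bar>"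
      using \<Psi>_large[OF i(1), of \<omega>] i \<omega>N by blast
    obtain T where T: "T \<le> n" "real k * 2 ^ T < \<bar>\<mu> (B T \<inter> E) \<omega>\<bar>"
      using \<omega>U \<omega>N(2) by (auto simp: V_def not_le)
    have kT: "(R + r) * 2 ^ T \<le> real k * 2 ^ T" using k by (intro mult_right_mono) auto
    have rT: "r * 1 \<le> r * 2 ^ T" using r by (intro mult_left_mono) auto
    have diff: "\<mu> (E - B T \<inter> E) \<omega> = \<mu> E \<omega> - \<mu> (B T \<inter> E) \<omega>" using N3(3) \<omega>M \<omega>N by blast
    have \<mu>E: "\<bar>\<mu> E \<omega>\<bar> \<le> r" using \<omega>N(1) \<omega>M by (auto simp: N1_def)
    have PT: "(T, B T \<inter> E) \<in> P1" "(T, E - B T \<inter> E) \<in> P2" using T by (auto simp: P1_def P2_def)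
    \<comment> \<open>the side of \<open>B T\<close> that does not meet the cell \<open>i\<close>\<close>
    have "\<exists>d\<in>P1 \<union> P2. snd d \<inter> i = {} \<and> R * 2 ^ fst d \<le> \<bar>\<mu> (snd d) \<omega>\<bar>"
    proof (cases "i \<inter> (B T \<inter> E) = {}")
      case True
      have "R * 2 ^ T \<le> \<bar>\<mu> (B T \<inter> E) \<omega>\<bar>" using T kT rT r by (simp add: algebra_simps)
      then show ?thesis using True PT by (intro bexI[of _ "(T, B T \<inter> E)"]) auto
    next
      case False
      have "B T \<inter> E \<in> snd ` (P1 \<union> P2)" using PT(1) by force
      then have "i \<subseteq> B T \<inter> E" using \<I>(6) i(1) False by blast
      then have "(E - B T \<inter> E) \<inter> i = {}" by blast
      moreover have "R * 2 ^ T \<le> \<bar>\<mu> (E - B T \<inter> E) \<omega>\<bar>"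
        unfolding diff using T kT rT \<mu>E by (simp add: algebra_simps)
      ultimately show ?thesis using PT by (intro bexI[of _ "(T, E - B T \<inter> E)"]) auto
    qed
    then obtain d where d: "d \<in> P1 \<union> P2" "snd d \<inter> i = {}" "R * 2 ^ fst d \<le> \<bar>\<mu> (snd d) \<omega>\<bar>" by blast
    have sndi: "snd e \<subseteq> i" if "e \<in> \<D>" for e using \<Psi>(2)[OF i(1)] \<D>(1) that by blast
    \<comment> \<open>a set in \<open>\<D>\<close> that is disjoint from \<open>i\<close> would be empty\<close>
    have "d \<notin> \<D>"
    proof
      assume "d \<in> \<D>"
      then have "snd d = {}" using sndi d(2) by blast
      moreover have "0 < R * 2 ^ fst d" using R by simp
      ultimately show False using d(3) N5(3)[of \<omega>] \<omega>M \<omega>N by simp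
    qed
    moreover have "finite \<D>" using \<D>(1) \<Psi>(1)[OF i(1)] finite_subset by blast
    ultimately have "card (insert d \<D>) = Suc L" using \<D>(2) by simp
    moreover have "disjoint_family_on snd (insert d \<D>)"
    proof -
      have "snd d \<inter> snd e = {}" if "e \<in> \<D>" for e using sndi[OF that] d(2) by blast
      then have "snd d \<inter> (\<Union>e\<in>\<D>. snd e) = {}" by blast
      then show ?thesis using disjoint_family_on_insert[OF \<open>d \<notin> \<D>\<close>, of snd] \<D>(3) by blast
    qed
    moreover have "insert d \<D> \<subseteq> \<Psi>'" using d(1) \<D>(1) i(1) by (auto simp: \<Psi>'_def)
    ultimately show ?thesis using d(3) \<D>(4) by (intro exI[of _ "insert d \<D>"]) auto
  qed
  then have "is_splitting B R (Suc L) \<eta> E \<Psi>' N'"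
    unfolding is_splitting_def
    by (intro conjI[OF fin\<Psi>' conjI[OF snd' conjI[OF allI[OF sum'] conjI[OF N'ev conjI[OF N'prob ballI]]]]])
  then show ?case by blast
qed


lemma min_1_sum_le:
  fixes z :: "'b \<Rightarrow> real"
  assumes "finite A" "\<And>i. i \<in> A \<Longrightarrow> 0 \<le> z i" "1 \<le> (\<Sum>i\<in>A. z i)"
  shows "1 \<le> (\<Sum>i\<in>A. min 1 (z i))"
proof (cases "\<exists>i\<in>A. 1 \<le> z i")
  case True
  then obtain i where i: "i \<in> A" "1 \<le> z i" by blast
  have "min 1 (z i) \<le> (\<Sum>i\<in>A. min 1 (z i))" using assms i by (intro member_le_sum) auto
  then show ?thesis using i by simp
next
  case False
  then have "(\<Sum>i\<in>A. min 1 (z i)) = (\<Sum>i\<in>A. z i)" by (intro sum.cong) auto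
  then show ?thesis using assms by simp
qed

text \<open>If the squares over each of the \<open>L\<close> disjoint sets add up to more than 1, then the truncated
  squares over each of them add up to at least 1.\<close>

lemma thinning_alternative:
  fixes y :: "'x set \<Rightarrow> real" and L :: nat
  assumes fin: "finite \<I>" "finite \<D>" and I: "{} \<notin> \<I>"
    and D: "card \<D> = L" "disjoint_family_on snd \<D>"
  shows "real L \<le> (\<Sum>i\<in>\<I>. min 1 ((y i)\<^sup>2)) \<or> (\<exists>d\<in>\<D>. (\<Sum>i | i \<in> \<I> \<and> i \<subseteq> snd d. (y i)\<^sup>2) \<le> 1)"
proof (rule disjCI)
  assume *: "\<not> (\<exists>d\<in>\<D>. (\<Sum>i | i \<in> \<I> \<and> i \<subseteq> snd d. (y i)\<^sup>2) \<le> 1)"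
  let ?c = "\<lambda>d. {i. i \<in> \<I> \<and> i \<subseteq> snd d}"
  have "real L = (\<Sum>d\<in>\<D>. 1)" using D by simp
  also have "\<dots> \<le> (\<Sum>d\<in>\<D>. \<Sum>i\<in>?c d. min 1 ((y i)\<^sup>2))"
  proof (rule sum_mono)
    fix d assume "d \<in> \<D>"
    then have "1 \<le> (\<Sum>i\<in>?c d. (y i)\<^sup>2)" using * by force
    then show "1 \<le> (\<Sum>i\<in>?c d. min 1 ((y i)\<^sup>2))" using fin by (intro min_1_sum_le) auto
  qed
  also have "\<dots> = (\<Sum>i\<in>(\<Union>d\<in>\<D>. ?c d). min 1 ((y i)\<^sup>2))"
  proof (rule sum.UNION_disjoint[symmetric])
    show "\<forall>d\<in>\<D>. \<forall>e\<in>\<D>. d \<noteq> e \<longrightarrow> ?c d \<inter> ?c e = {}"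
    proof (intro ballI impI)
      fix d e assume de: "d \<in> \<D>" "e \<in> \<D>" "d \<noteq> e"
      then have "snd d \<inter> snd e = {}" using D(2) by (auto simp: disjoint_family_on_def)
      then have "i = {}" if "i \<in> ?c d" "i \<in> ?c e" for i using that by blast
      then show "?c d \<inter> ?c e = {}" using I by blast
    qed
  qed (use fin in auto)
  also have "\<dots> \<le> (\<Sum>i\<in>\<I>. min 1 ((y i)\<^sup>2))"
    using fin by (intro sum_mono2) auto
  finally show "real L \<le> (\<Sum>i\<in>\<I>. min 1 ((y i)\<^sup>2))" .
qed

text \<open>One step of the construction. The state is a family \<open>\<Q>\<close> of disjoint sets rather than its
  union, because the event \<open>unbounded_on\<close> is only subadditive. A cell that is unbounded at \<open>\<omega>\<close> is
  selected with probability at most \<open>p\<close>, so on average the family \<open>\<Q>'\<close> of the cells left over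
  loses at most the probability \<open>p\<close>.\<close>

lemma random_thinning_exists:
  assumes B: "\<And>T. B T \<in> sets X" and Q: "finite \<Q>" "\<Q> \<subseteq> sets X" "disjoint \<Q>"
    and a: "0 < a" "a \<le> prob (\<Union>J\<in>\<Q>. unbounded_on B J)" and \<epsilon>: "0 < \<epsilon>"
  shows "\<exists>A \<Q>'. A \<in> sets X \<and> A \<subseteq> \<Union>\<Q> \<and> finite \<Q>' \<and> \<Q>' \<subseteq> sets X \<and> disjoint \<Q>' \<and> \<Union>\<Q>' \<subseteq> \<Union>\<Q> - A
    \<and> prob (\<Union>J\<in>\<Q>. unbounded_on B J) - \<epsilon> \<le> prob (\<Union>J\<in>\<Q>'. unbounded_on B J)
    \<and> a / 160 \<le> prob {\<omega> \<in> space M. 1 \<le> \<bar>\<mu> A \<omega>\<bar>}"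
proof -
  define W where "W \<A> = (\<Union>J\<in>\<A>. unbounded_on B J)" for \<A>
  have W: "W \<A> \<in> events" if "finite \<A>" "\<A> \<subseteq> sets X" for \<A>
    unfolding W_def using that B by (intro sets.finite_UN unbounded_on_sets) auto
  \<comment> \<open>\<open>p\<close> makes the expected loss a small multiple of \<open>\<epsilon>\<close>; \<open>L\<close> and \<open>R\<close> meet the two alternatives of \<open>weighted_thinning_large\<close>\<close>
  define p where "p = min (1/2) (\<epsilon> * a / 160)"
  have p: "0 < p" "p \<le> 1/2" "p \<le> \<epsilon> * a / 160" using a \<epsilon> by (auto simp: p_def)
  obtain L :: nat where L0: "64 / p \<le> real L" using real_arch_simple by blast
  have L: "0 < real L" using L0 p by (rule_tac less_le_trans[OF _ L0]) auto
  define R where "R = 48 * real L / p"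
  have R: "0 < R" using L p by (simp add: R_def)
  define \<eta> where "\<eta> = a / 2 / (real (card \<Q>) + 1)"
  have \<eta>: "0 < \<eta>" using a by (simp add: \<eta>_def)
  have "\<exists>\<Psi> N. is_splitting B R L \<eta> J \<Psi> N" if "J \<in> \<Q>" for J
    by (rule splitting_tree[OF B R _ \<eta>]) (use Q(2) that in blast)
  then obtain \<Psi> N where split: "\<And>J. J \<in> \<Q> \<Longrightarrow> is_splitting B R L \<eta> J (\<Psi> J) (N J)"
    by metis
  have \<Psi>: "\<And>J. J \<in> \<Q> \<Longrightarrow> finite (\<Psi> J)"
      "\<And>J d. J \<in> \<Q> \<Longrightarrow> d \<in> \<Psi> J \<Longrightarrow> snd d \<in> sets X \<and> snd d \<subseteq> J"
      "\<And>J x. J \<in> \<Q> \<Longrightarrow> (\<Sum>d\<in>\<Psi> J. (1/2) ^ fst d * indicator (snd d) x) \<le> 4 * real L"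
    and N: "\<And>J. J \<in> \<Q> \<Longrightarrow> N J \<in> events" "\<And>J. J \<in> \<Q> \<Longrightarrow> prob (N J) \<le> \<eta>"
    using split unfolding is_splitting_def by blast+
  have \<Psi>_large: "\<exists>\<D>\<subseteq>\<Psi> J. card \<D> = L \<and> disjoint_family_on snd \<D> \<and> (\<forall>d\<in>\<D>. R * 2 ^ fst d \<le> \<bar>\<mu> (snd d) \<omega>\<bar>)"
    if "J \<in> \<Q>" "\<omega> \<in> unbounded_on B J - N J" for J \<omega>
    using split[OF that(1)] that(2) unfolding is_splitting_def by blast
  define C where "C = (\<Union>J\<in>\<Q>. \<Psi> J)"
  have finC: "finite C" using Q(1) \<Psi>(1) by (auto simp: C_def)
  have C: "snd d \<in> sets X" if "d \<in> C" for d using that \<Psi>(2) unfolding C_def by blast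
  have finQC: "finite (\<Q> \<union> snd ` C)" and setsQC: "\<Q> \<union> snd ` C \<subseteq> sets X" using Q(1,2) finC C by auto
  obtain \<I> where \<I>: "finite \<I>" "\<I> \<subseteq> sets X" "disjoint \<I>" "{} \<notin> \<I>" "\<Union>\<I> = \<Union>(\<Q> \<union> snd ` C)"
    "\<forall>D\<in>\<Q> \<union> snd ` C. \<Union>{i \<in> \<I>. i \<subseteq> D} = D"
    using finite_refinement[OF finQC setsQC] by (elim exE conjE) (rule that)
  have UI: "\<Union>\<I> = \<Union>\<Q>"
  proof -
    have "snd d \<subseteq> \<Union>\<Q>" if "d \<in> C" for d using that \<Psi>(2) unfolding C_def by blast
    then show ?thesis unfolding \<I>(5) by blast
  qed
  have cells: "{i \<in> \<I>. i \<subseteq> D} \<subseteq> sets X" "finite {i \<in> \<I>. i \<subseteq> D}" "disjoint {i \<in> \<I>. i \<subseteq> D}" for D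
    using \<I>(1,2) pairwise_subset[OF \<I>(3), of "{i \<in> \<I>. i \<subseteq> D}"] by auto
  have "AE \<omega> in M. \<forall>d\<in>C. \<mu> (\<Union>{i \<in> \<I>. i \<subseteq> snd d}) \<omega> = (\<Sum>i\<in>{i \<in> \<I>. i \<subseteq> snd d}. \<mu> i \<omega>)"
    by (intro AE_ball_countable[THEN iffD2] ballI mu_Union cells countable_finite finC)
  moreover have "AE \<omega> in M. \<forall>J\<in>\<Q>. \<omega> \<in> unbounded_on B (\<Union>{i \<in> \<I>. i \<subseteq> J}) \<longrightarrow> (\<exists>i\<in>{i \<in> \<I>. i \<subseteq> J}. \<omega> \<in> unbounded_on B i)"
    by (intro AE_ball_countable[THEN iffD2] ballI unbounded_on_Union B cells countable_finite Q)
  ultimately have ae: "AE \<omega> in M. (\<forall>d\<in>C. \<mu> (snd d) \<omega> = (\<Sum>i | i \<in> \<I> \<and> i \<subseteq> snd d. \<mu> i \<omega>))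
      \<and> (\<forall>J\<in>\<Q>. \<omega> \<in> unbounded_on B J \<longrightarrow> (\<exists>i\<in>\<I>. \<omega> \<in> unbounded_on B i))"
  proof eventually_elim
    case (elim \<omega>)
    have "\<Union>{i \<in> \<I>. i \<subseteq> snd d} = snd d" if "d \<in> C" for d using \<I>(6) that by blast
    moreover have "\<Union>{i \<in> \<I>. i \<subseteq> J} = J" if "J \<in> \<Q>" for J using \<I>(6) that by blast
    ultimately show ?case using elim by auto
  qed
  obtain N0 where N0: "N0 \<in> events" "prob N0 = 0" and
    N0': "\<And>\<omega>. \<omega> \<in> space M - N0 \<Longrightarrow> (\<forall>d\<in>C. \<mu> (snd d) \<omega> = (\<Sum>i | i \<in> \<I> \<and> i \<subseteq> snd d. \<mu> i \<omega>))
      \<and> (\<forall>J\<in>\<Q>. \<omega> \<in> unbounded_on B J \<longrightarrow> (\<exists>i\<in>\<I>. \<omega> \<in> unbounded_on B i))"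
    by (rule AE_prob_null[OF ae]) (rule that)
  define N' where "N' = N0 \<union> (\<Union>J\<in>\<Q>. N J)"
  have UN: "(\<Union>J\<in>\<Q>. N J) \<in> events" using N(1) Q(1) by auto
  have N'ev: "N' \<in> events" using UN N0 by (auto simp: N'_def)
  have N'prob: "prob N' \<le> a / 2"
  proof -
    have "prob (\<Union>J\<in>\<Q>. N J) \<le> (\<Sum>J\<in>\<Q>. prob (N J))"
      using Q(1) N by (intro finite_measure_subadditive_finite) auto
    also have "\<dots> \<le> (\<Sum>J\<in>\<Q>. \<eta>)" by (intro sum_mono N)
    also have "\<dots> \<le> a / 2" using a by (simp add: \<eta>_def field_simps)
    finally have "prob (\<Union>J\<in>\<Q>. N J) \<le> a / 2" .
    moreover have "prob N' \<le> prob N0 + prob (\<Union>J\<in>\<Q>. N J)"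
      unfolding N'_def using N0 UN by (intro measure_Un_le) auto
    ultimately show ?thesis using N0 by simp
  qed
  define \<psi> where "\<psi> d i = (1/2) ^ fst d / (4 * real L) * of_bool (i \<subseteq> snd d)" for d :: "nat \<times> 'x set" and i
  have \<psi>0: "0 \<le> \<psi> d i" for d i using L by (simp add: \<psi>_def)
  have \<psi>1: "(\<Sum>d\<in>C. \<psi> d i) \<le> 1" if i: "i \<in> \<I>" for i
  proof -
    obtain x where x: "x \<in> i" using \<I>(4) i by (cases "i = {}") auto
    obtain J where J: "J \<in> \<Q>" "x \<in> J" using UI x i by blast
    let ?g = "\<lambda>d. (1/2) ^ fst d * indicator (snd d) x :: real"
    have "(\<Sum>d\<in>C. \<psi> d i) \<le> (\<Sum>d\<in>C. ?g d / (4 * real L))"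
      by (intro sum_mono) (use x L in \<open>auto simp: \<psi>_def field_simps\<close>)
    also have "\<dots> = sum ?g C / (4 * real L)" by (simp add: sum_divide_distrib)
    also have "sum ?g C = sum ?g (\<Psi> J)"
    proof (rule sum.mono_neutral_right[OF finC])
      show "\<Psi> J \<subseteq> C" using J by (auto simp: C_def)
      show "\<forall>d\<in>C - \<Psi> J. ?g d = 0"
      proof
        fix d assume "d \<in> C - \<Psi> J"
        then obtain K where K: "K \<in> \<Q>" "d \<in> \<Psi> K" "K \<noteq> J" unfolding C_def by blast
        then have "J \<inter> K = {}" using J Q(3) by (auto dest: disjointD)
        then have "x \<notin> snd d" using \<Psi>(2)[OF K(1,2)] J by blast
        then show "?g d = 0" by simp
      qed
    qed
    also have "\<dots> / (4 * real L) \<le> 1" using \<Psi>(3)[OF J(1), of x] L by simp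
    finally show ?thesis .
  qed
  define q where "q c i = p * (1/4 + (\<Sum>d\<in>c. \<psi> d i) / 2)" for c i
  have q: "0 \<le> q c i" "q c i \<le> p" if "c \<subseteq> C" "i \<in> \<I>" for c i
  proof -
    have "0 \<le> (\<Sum>d\<in>c. \<psi> d i)" using \<psi>0 by (intro sum_nonneg) auto
    moreover have "(\<Sum>d\<in>c. \<psi> d i) \<le> (\<Sum>d\<in>C. \<psi> d i)" using that \<psi>0 finC by (intro sum_mono2) auto
    ultimately have s: "0 \<le> (\<Sum>d\<in>c. \<psi> d i)" "(\<Sum>d\<in>c. \<psi> d i) \<le> 1" using \<psi>1[OF that(2)] by auto
    then show "0 \<le> q c i" unfolding q_def using p by simp
    have "q c i \<le> p * 1" unfolding q_def using s p by (intro mult_left_mono) auto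
    then show "q c i \<le> p" by simp
  qed
  have q1: "q c i \<le> 1" if "c \<subseteq> C" "i \<in> \<I>" for c i using q(2)[OF that] p by linarith
  define F where "F \<omega> S = (of_bool (1 \<le> \<bar>\<Sum>i\<in>S. \<mu> i \<omega>\<bar>) :: real)" for \<omega> S
  define G where "G \<omega> S = (of_bool (\<omega> \<in> W \<Q> - W (\<I> - S)) :: real)" for \<omega> S
  have \<mu>m: "\<mu> i \<in> borel_measurable M" if "i \<in> \<I>" for i using that \<I>(2) by (intro measurable_mu) auto
  have WQ: "W \<Q> \<in> events" using Q by (intro W)
  have WI: "W (\<I> - S) \<in> events" for S using \<I>(1,2) by (intro W) auto
  have sumS: "(\<lambda>\<omega>. \<Sum>i\<in>S. \<mu> i \<omega>) \<in> borel_measurable M" if "S \<subseteq> \<I>" for S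
    using \<mu>m that by (intro borel_measurable_sum) auto
  have Fev: "{\<omega> \<in> space M. 1 \<le> \<bar>\<Sum>i\<in>S. \<mu> i \<omega>\<bar>} \<in> events" if "S \<subseteq> \<I>" for S
    using sumS[OF that] by measurable
  have Fint: "integrable M (\<lambda>\<omega>. F \<omega> S)" "(\<integral>\<omega>. F \<omega> S \<partial>M) = prob {\<omega> \<in> space M. 1 \<le> \<bar>\<Sum>i\<in>S. \<mu> i \<omega>\<bar>}"
    if "S \<subseteq> \<I>" for S
  proof -
    let ?E = "{\<omega> \<in> space M. 1 \<le> \<bar>\<Sum>i\<in>S. \<mu> i \<omega>\<bar>}"
    have 1: "integrable M (indicator ?E :: 'a \<Rightarrow> real)" using Fev[OF that]
      by (intro integrable_real_indicator) (auto simp: emeasure_eq_measure)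
    have 2: "F \<omega> S = indicator ?E \<omega>" if "\<omega> \<in> space M" for \<omega> using that by (simp add: F_def indicator_def)
    show "integrable M (\<lambda>\<omega>. F \<omega> S)" using 1 by (subst Bochner_Integration.integrable_cong[OF refl 2])
    show "(\<integral>\<omega>. F \<omega> S \<partial>M) = prob ?E"
      using Fev[OF that] by (subst Bochner_Integration.integral_cong[OF refl 2]) auto
  qed
  have Gint: "integrable M (\<lambda>\<omega>. G \<omega> S)" "(\<integral>\<omega>. G \<omega> S \<partial>M) = prob (W \<Q> - W (\<I> - S))" for S
  proof -
    have E: "W \<Q> - W (\<I> - S) \<in> events" using WQ WI by auto
    have 2: "(\<lambda>\<omega>. G \<omega> S) = indicator (W \<Q> - W (\<I> - S))" by (simp add: G_def indicator_def fun_eq_iff)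
    show "integrable M (\<lambda>\<omega>. G \<omega> S)" unfolding 2 using E by (intro integrable_real_indicator) (auto simp: emeasure_eq_measure)
    show "(\<integral>\<omega>. G \<omega> S \<partial>M) = prob (W \<Q> - W (\<I> - S))" unfolding 2 using E by simp
  qed
  define AV where "AV H = subset_avg C (\<lambda>_. 1/2) (\<lambda>c. subset_avg \<I> (q c) H)" for H :: "'x set set \<Rightarrow> real"
  have AV_int: "integrable M (\<lambda>\<omega>. AV (H \<omega>))" "(\<integral>\<omega>. AV (H \<omega>) \<partial>M) = AV (\<lambda>S. \<integral>\<omega>. H \<omega> S \<partial>M)"
    if "\<And>S. S \<subseteq> \<I> \<Longrightarrow> integrable M (\<lambda>\<omega>. H \<omega> S)" for H
  proof -
    have i: "integrable M (\<lambda>\<omega>. subset_avg \<I> (q c) (H \<omega>))" for c by (rule subset_avg_integral(1)[OF \<I>(1) that])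
    show "integrable M (\<lambda>\<omega>. AV (H \<omega>))" unfolding AV_def by (rule subset_avg_integral(1)[OF finC i])
    have "(\<integral>\<omega>. AV (H \<omega>) \<partial>M) = subset_avg C (\<lambda>_. 1/2) (\<lambda>c. \<integral>\<omega>. subset_avg \<I> (q c) (H \<omega>) \<partial>M)"
      unfolding AV_def by (rule subset_avg_integral(2)[OF finC i])
    also have "\<dots> = AV (\<lambda>S. \<integral>\<omega>. H \<omega> S \<partial>M)"
      unfolding AV_def by (intro subset_avg_cong subset_avg_integral(2)[OF \<I>(1) that]) auto
    finally show "(\<integral>\<omega>. AV (H \<omega>) \<partial>M) = AV (\<lambda>S. \<integral>\<omega>. H \<omega> S \<partial>M)" .
  qed
  have AV_mono: "AV H \<le> AV H'" if "\<And>S. S \<subseteq> \<I> \<Longrightarrow> H S \<le> H' S" for H H'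
    unfolding AV_def by (intro subset_avg_mono) (use q(1) q1 that in auto)
  have F_large: "1/40 * indicator (W \<Q> - N') \<omega> \<le> AV (F \<omega>)" for \<omega>
  proof (cases "\<omega> \<in> W \<Q> - N'")
    case True
    then obtain J where J: "J \<in> \<Q>" "\<omega> \<in> unbounded_on B J" by (auto simp: W_def)
    have \<omega>M: "\<omega> \<in> space M - N0" using J True by (auto simp: unbounded_on_def N'_def)
    have "\<omega> \<in> unbounded_on B J - N J" using J True by (auto simp: N'_def)
    then obtain \<D> where \<D>: "\<D> \<subseteq> \<Psi> J" "card \<D> = L" "disjoint_family_on snd \<D>"
      "\<forall>d\<in>\<D>. R * 2 ^ fst d \<le> \<bar>\<mu> (snd d) \<omega>\<bar>"
      using \<Psi>_large[OF J(1)] by blast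
    have \<D>C: "\<D> \<subseteq> C" using \<D>(1) J(1) by (auto simp: C_def)
    have fin\<D>: "finite \<D>" using \<D>C finC finite_subset by blast
    have "1/40 \<le> subset_avg C (\<lambda>_. 1/2) (\<lambda>c. subset_avg \<I> (\<lambda>i. p * (1/4 + (\<Sum>d\<in>c. \<psi> d i) / 2))
        (\<lambda>S. of_bool (1 \<le> \<bar>\<Sum>i\<in>S. \<mu> i \<omega>\<bar>)))"
    proof (rule weighted_thinning_large[OF \<I>(1) finC p(1,2) \<psi>0 \<psi>1])
      from thinning_alternative[OF \<I>(1) fin\<D> \<I>(4) \<D>(2,3), of "\<lambda>i. \<mu> i \<omega>"]
      show "64 / p \<le> (\<Sum>i\<in>\<I>. min 1 ((\<mu> i \<omega>)\<^sup>2)) \<or>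
        (\<exists>d\<in>C. 12 / p \<le> \<bar>\<Sum>i\<in>\<I>. \<psi> d i * \<mu> i \<omega>\<bar> \<and> (\<Sum>i | i \<in> \<I> \<and> \<psi> d i \<noteq> 0. (\<mu> i \<omega>)\<^sup>2) \<le> 1)"
      proof
        assume "real L \<le> (\<Sum>i\<in>\<I>. min 1 ((\<mu> i \<omega>)\<^sup>2))"
        then show ?thesis using L0 by linarith
      next
        assume "\<exists>d\<in>\<D>. (\<Sum>i | i \<in> \<I> \<and> i \<subseteq> snd d. (\<mu> i \<omega>)\<^sup>2) \<le> 1"
        then obtain d where d: "d \<in> \<D>" "(\<Sum>i | i \<in> \<I> \<and> i \<subseteq> snd d. (\<mu> i \<omega>)\<^sup>2) \<le> 1" by blast
        define w where "w = (1/2) ^ fst d / (4 * real L)"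
        have w: "0 < w" using L by (simp add: w_def)
        have nz: "\<psi> d i \<noteq> 0 \<longleftrightarrow> i \<subseteq> snd d" for i using w by (simp add: \<psi>_def w_def[symmetric])
        have "(\<Sum>i\<in>\<I>. \<psi> d i * \<mu> i \<omega>) = (\<Sum>i | i \<in> \<I> \<and> i \<subseteq> snd d. w * \<mu> i \<omega>)"
          by (rule sum.mono_neutral_cong_right) (use \<I>(1) in \<open>auto simp: \<psi>_def w_def\<close>)
        also have "\<dots> = w * \<mu> (snd d) \<omega>"
          using N0'[OF \<omega>M] d(1) \<D>C by (auto simp: sum_distrib_left)
        finally have "\<bar>\<Sum>i\<in>\<I>. \<psi> d i * \<mu> i \<omega>\<bar> = w * \<bar>\<mu> (snd d) \<omega>\<bar>" using w by (simp add: abs_mult)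
        also have "\<dots> \<ge> w * (R * 2 ^ fst d)" using \<D>(4) d(1) w by (intro mult_left_mono) auto
        also have "w * (R * 2 ^ fst d) = 12 / p"
          using L p by (simp add: w_def R_def field_simps)
        finally have "12 / p \<le> \<bar>\<Sum>i\<in>\<I>. \<psi> d i * \<mu> i \<omega>\<bar>" .
        moreover have "(\<Sum>i | i \<in> \<I> \<and> \<psi> d i \<noteq> 0. (\<mu> i \<omega>)\<^sup>2) \<le> 1" using d(2) by (simp only: nz)
        moreover have "d \<in> C" using d(1) \<D>C by (rule subsetD[rotated])
        ultimately show ?thesis by (intro disjI2 bexI[of _ d] conjI)
      qed
    qed
    then show ?thesis using True by (simp add: AV_def q_def[abs_def] F_def[abs_def])
  next
    case False
    have "AV (\<lambda>_. 0) \<le> AV (F \<omega>)" by (rule AV_mono) (simp add: F_def)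
    moreover have "AV (\<lambda>_. 0) = 0" using finC \<I>(1) by (simp add: AV_def)
    ultimately show ?thesis using False by simp
  qed
  have "a / 80 \<le> 1/40 * prob (W \<Q> - N')"
  proof -
    have "prob (W \<Q>) \<le> prob ((W \<Q> - N') \<union> N')" using WQ N'ev by (intro finite_measure_mono) auto
    also have "\<dots> \<le> prob (W \<Q> - N') + prob N'" using WQ N'ev by (intro measure_Un_le) auto
    finally show ?thesis using a N'prob by (simp add: W_def)
  qed
  also have "\<dots> = (\<integral>\<omega>. 1/40 * indicator (W \<Q> - N') \<omega> \<partial>M)" using WQ N'ev by auto
  also have "\<dots> \<le> (\<integral>\<omega>. AV (F \<omega>) \<partial>M)"
  proof (rule integral_mono)
    show "integrable M (\<lambda>\<omega>. 1/40 * indicator (W \<Q> - N') \<omega> :: real)" using WQ N'ev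
      by (intro integrable_mult_right integrable_real_indicator) (auto simp: emeasure_eq_measure)
  qed (use F_large AV_int(1)[OF Fint(1)] in auto)
  also have "\<dots> = AV (\<lambda>S. \<integral>\<omega>. F \<omega> S \<partial>M)" by (rule AV_int(2)[OF Fint(1)])
  finally have AF: "a / 80 \<le> AV (\<lambda>S. \<integral>\<omega>. F \<omega> S \<partial>M)" .
  have G_small: "AV (G \<omega>) \<le> p" if \<omega>: "\<omega> \<in> space M - N0" for \<omega>
  proof (cases "\<omega> \<in> W \<Q>")
    case True
    then obtain i where i: "i \<in> \<I>" "\<omega> \<in> unbounded_on B i" using N0'[OF \<omega>] unfolding W_def by blast
    have "AV (G \<omega>) \<le> AV (\<lambda>S. of_bool (i \<in> S))"
      by (rule AV_mono) (use i in \<open>auto simp: G_def W_def\<close>)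
    also have "\<dots> = subset_avg C (\<lambda>_. 1/2) (\<lambda>c. q c i)"
      unfolding AV_def using \<I>(1) i(1) by (simp add: subset_avg_member)
    also have "\<dots> \<le> subset_avg C (\<lambda>_. 1/2) (\<lambda>c. p)" using q i by (intro subset_avg_mono) auto
    finally show ?thesis using finC by simp
  next
    case False
    then have "AV (G \<omega>) = AV (\<lambda>_. 0)" by (simp add: G_def[abs_def])
    then show ?thesis using finC \<I>(1) p by (simp add: AV_def)
  qed
  have "AV (\<lambda>S. \<integral>\<omega>. G \<omega> S \<partial>M) = (\<integral>\<omega>. AV (G \<omega>) \<partial>M)" by (rule AV_int(2)[OF Gint(1), symmetric])
  also have "\<dots> \<le> (\<integral>\<omega>. p \<partial>M)"
  proof (rule integral_mono_AE)
    have "N0 \<in> null_sets M" using N0 by (simp add: null_sets_def emeasure_eq_measure)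
    then have "AE \<omega> in M. \<omega> \<notin> N0" by (rule AE_not_in)
    then show "AE \<omega> in M. AV (G \<omega>) \<le> p" using AE_space by eventually_elim (use G_small in auto)
  qed (use AV_int(1)[OF Gint(1)] in auto)
  finally have AG: "AV (\<lambda>S. \<integral>\<omega>. G \<omega> S \<partial>M) \<le> p" by (simp add: prob_space)
  \<comment> \<open>one functional for both requirements: a large value at a single \<open>S\<close> forces a large measure and a small loss\<close>
  define H where "H S = (\<integral>\<omega>. F \<omega> S \<partial>M) - 1 / \<epsilon> * (\<integral>\<omega>. G \<omega> S \<partial>M)" for S
  have "a / 160 \<le> a / 80 - 1 / \<epsilon> * p" using p \<epsilon> by (simp add: field_simps)
  also have "\<dots> \<le> AV (\<lambda>S. \<integral>\<omega>. F \<omega> S \<partial>M) - 1 / \<epsilon> * AV (\<lambda>S. \<integral>\<omega>. G \<omega> S \<partial>M)"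
    using AF AG \<epsilon> by (intro diff_mono mult_left_mono) auto
  also have "\<dots> = AV H" by (simp only: AV_def H_def[abs_def] subset_avg_diff subset_avg_cmult)
  finally have AH: "a / 160 \<le> AV H" .
  obtain c where c: "c \<subseteq> C" "AV H \<le> subset_avg \<I> (q c) H"
    using subset_avg_ex[OF finC, of "\<lambda>_. 1/2" "\<lambda>c. subset_avg \<I> (q c) H"] by (auto simp: AV_def)
  have "\<exists>S\<subseteq>\<I>. subset_avg \<I> (q c) H \<le> H S"
    by (rule subset_avg_ex[OF \<I>(1)]) (use q(1) q1 c(1) in auto)
  then obtain S where S: "S \<subseteq> \<I>" "a / 160 \<le> H S" using AH c(2) by force
  define A where "A = \<Union>S"
  have Ssets: "finite S" "S \<subseteq> sets X" "disjoint S" 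
    using S(1) \<I>(1,2) pairwise_subset[OF \<I>(3) S(1)] by (auto intro: finite_subset)
  have Asets: "A \<in> sets X" unfolding A_def using Ssets by (intro sets.finite_Union)
  have [measurable]: "\<mu> A \<in> borel_measurable M" using Asets by (rule measurable_mu)
  have PF: "prob {\<omega> \<in> space M. 1 \<le> \<bar>\<mu> A \<omega>\<bar>} = (\<integral>\<omega>. F \<omega> S \<partial>M)"
    unfolding Fint(2)[OF S(1)]
  proof (rule finite_measure_eq_AE)
    show "AE \<omega> in M. (\<omega> \<in> {\<omega> \<in> space M. 1 \<le> \<bar>\<mu> A \<omega>\<bar>}) = (\<omega> \<in> {\<omega> \<in> space M. 1 \<le> \<bar>\<Sum>i\<in>S. \<mu> i \<omega>\<bar>})"
      using mu_Union[OF Ssets] by eventually_elim (simp add: A_def)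
    show "{\<omega> \<in> space M. 1 \<le> \<bar>\<mu> A \<omega>\<bar>} \<in> events" by measurable
  qed (rule Fev[OF S(1)])
  define g where "g = (\<integral>\<omega>. G \<omega> S \<partial>M)"
  define f where "f = (\<integral>\<omega>. F \<omega> S \<partial>M)"
  have g0: "0 \<le> g" unfolding g_def Gint(2) by simp
  have f1: "f \<le> 1" unfolding f_def Fint(2)[OF S(1)] by simp
  have fg: "a / 160 \<le> f - 1 / \<epsilon> * g" using S(2) by (simp add: H_def f_def g_def)
  have "0 \<le> 1 / \<epsilon> * g" using g0 \<epsilon> by simp
  then have f_large: "a / 160 \<le> f" using fg by linarith
  have "1 / \<epsilon> * g \<le> 1" using fg f1 a by linarith
  then have g\<epsilon>: "g \<le> \<epsilon>" using \<epsilon> by (simp add: field_simps)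
  have "prob (W \<Q>) \<le> prob ((W \<Q> - W (\<I> - S)) \<union> W (\<I> - S))"
    using WQ WI by (intro finite_measure_mono) auto
  also have "\<dots> \<le> prob (W \<Q> - W (\<I> - S)) + prob (W (\<I> - S))" using WQ WI by (intro measure_Un_le) auto
  finally have PW: "prob (W \<Q>) - \<epsilon> \<le> prob (W (\<I> - S))" using g\<epsilon> by (simp add: g_def Gint(2))
  have disj: "\<Union>(\<I> - S) \<subseteq> \<Union>\<Q> - A"
  proof
    fix x assume "x \<in> \<Union>(\<I> - S)"
    then obtain i where i: "i \<in> \<I>" "i \<notin> S" "x \<in> i" by blast
    have "x \<notin> j" if "j \<in> S" for j using disjointD[OF \<I>(3) i(1), of j] that S(1) i by blast
    then show "x \<in> \<Union>\<Q> - A" using i UI by (auto simp: A_def)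
  qed
  have "A \<subseteq> \<Union>\<Q>" using S(1) UI by (auto simp: A_def)
  moreover have "finite (\<I> - S)" "\<I> - S \<subseteq> sets X" "disjoint (\<I> - S)"
    using \<I>(1,2) pairwise_subset[OF \<I>(3), of "\<I> - S"] by auto
  moreover have "prob (\<Union>J\<in>\<Q>. unbounded_on B J) - \<epsilon> \<le> prob (\<Union>J\<in>\<I> - S. unbounded_on B J)"
    using PW by (simp only: W_def)
  moreover have "a / 160 \<le> prob {\<omega> \<in> space M. 1 \<le> \<bar>\<mu> A \<omega>\<bar>}" using f_large by (simp only: PF f_def)
  ultimately show ?thesis
    using Asets disj by (intro exI[of _ A] exI[of _ "\<I> - S"] conjI)
qed


text \<open>The theorem of Talagrand and of Kalton, Peck and Roberts.\<close>

theorem range_bounded_in_prob: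
  assumes "0 < \<eta>"
  shows "\<exists>t. \<forall>A\<in>sets X. tail_prob M (\<mu> A) t \<le> \<eta>"
proof (rule ccontr)
  assume neg: "\<not> ?thesis"
  have "\<forall>T. \<exists>A. A \<in> sets X \<and> \<eta> < tail_prob M (\<mu> A) (4 ^ T)" for T :: nat
  proof
    fix T :: nat
    have "\<not> (\<forall>A\<in>sets X. tail_prob M (\<mu> A) (4 ^ T) \<le> \<eta>)" using neg by blast
    then show "\<exists>A. A \<in> sets X \<and> \<eta> < tail_prob M (\<mu> A) (4 ^ T)" by (auto simp: not_le)
  qed
  then obtain B :: "nat \<Rightarrow> 'x set" where B: "\<And>T. B T \<in> sets X" and B_large: "\<And>T. \<eta> < tail_prob M (\<mu> (B T)) (4 ^ T)"
    by metis
  have [measurable]: "\<mu> (B T) \<in> borel_measurable M" for T by (intro measurable_mu B)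
  have U0: "\<eta> \<le> prob (unbounded_on B (space X))"
  proof -
    define G where "G T = {\<omega> \<in> space M. 4 ^ T < \<bar>\<mu> (B T) \<omega>\<bar>}" for T
    have G: "G T \<in> events" for T unfolding G_def by measurable
    define V where "V n = (\<Union>T\<in>{n..}. G T)" for n
    have V: "V n \<in> events" for n unfolding V_def using G by auto
    have "(\<lambda>n. prob (V n)) \<longlonglongrightarrow> prob (\<Inter>n. V n)"
      by (rule finite_Lim_measure_decseq) (use V in \<open>force simp: V_def decseq_def\<close>)+
    moreover have "\<eta> \<le> prob (V n)" for n
    proof -
      have "prob (G n) \<le> prob (V n)" using V by (intro finite_measure_mono) (auto simp: V_def)
      then show ?thesis using B_large[of n] by (simp add: G_def)
    qed
    ultimately have "\<eta> \<le> prob (\<Inter>n. V n)" by (intro LIMSEQ_le_const) auto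
    also have "\<dots> \<le> prob (unbounded_on B (space X))"
    proof (rule finite_measure_mono)
      show "(\<Inter>n. V n) \<subseteq> unbounded_on B (space X)"
      proof
        fix \<omega> assume \<omega>: "\<omega> \<in> (\<Inter>n. V n)"
        have "\<exists>T. real n * 2 ^ T < \<bar>\<mu> (B T \<inter> space X) \<omega>\<bar>" for n
        proof -
          have "\<omega> \<in> V n" using \<omega> by blast
          then obtain T where T: "n \<le> T" "4 ^ T < \<bar>\<mu> (B T) \<omega>\<bar>" by (auto simp: V_def G_def)
          have "real n \<le> real T" using T by simp
          also have "\<dots> \<le> 2 ^ T" using of_nat_less_two_power[of T] by (simp add: less_imp_le)
          finally have "real n * 2 ^ T \<le> 2 ^ T * 2 ^ T" by (intro mult_right_mono) auto
          also have "\<dots> = (4::real) ^ T" by (simp add: power_mult_distrib[symmetric])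
          finally have "real n * 2 ^ T < \<bar>\<mu> (B T) \<omega>\<bar>" using T by simp
          moreover have "B T \<inter> space X = B T" using sets.sets_into_space[OF B] by blast
          ultimately show ?thesis by metis
        qed
        moreover have "\<omega> \<in> space M" using \<omega> unfolding V_def G_def by blast
        ultimately show "\<omega> \<in> unbounded_on B (space X)" unfolding unbounded_on_def by blast
      qed
    qed (intro unbounded_on_sets B sets.top)
    finally show ?thesis .
  qed
  define W where "W \<A> = (\<Union>J\<in>\<A>. unbounded_on B J)" for \<A>
  \<comment> \<open>the losses \<open>\<eta> / 4 / 2 ^ n\<close> leave at least half of the probability forever\<close>
  define good where "good n s \<longleftrightarrow> finite (snd s) \<and> snd s \<subseteq> sets X \<and> disjoint (snd s)
      \<and> \<eta> / 2 + \<eta> / 2 / 2 ^ n \<le> prob (W (snd s))" for n :: nat and s :: "'x set \<times> 'x set set"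
  define step where "step s s' \<longleftrightarrow> fst s' \<in> sets X \<and> fst s' \<subseteq> \<Union>(snd s) \<and> \<Union>(snd s') \<subseteq> \<Union>(snd s) - fst s'
      \<and> \<eta> / 2 / 160 \<le> prob {\<omega> \<in> space M. 1 \<le> \<bar>\<mu> (fst s') \<omega>\<bar>}" for s s' :: "'x set \<times> 'x set set"
  have "\<exists>f. \<forall>n. good n (f n) \<and> step (f n) (f (Suc n))"
  proof (rule dependent_nat_choice)
    show "\<exists>s. good 0 s"
      using U0 by (intro exI[of _ "({}, {space X})"]) (auto simp: good_def W_def)
  next
    fix s n assume s: "good n s"
    have fin: "finite (snd s)" "snd s \<subseteq> sets X" "disjoint (snd s)" and
      Ws: "\<eta> / 2 + \<eta> / 2 / 2 ^ n \<le> prob (W (snd s))" using s by (auto simp: good_def)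
    have pos: "0 < \<eta> / 2" "0 < \<eta> / 4 / 2 ^ n" "0 < \<eta> / 2 / 2 ^ n" using assms by auto
    have le: "\<eta> / 2 \<le> prob (\<Union>J\<in>snd s. unbounded_on B J)"
      using Ws pos unfolding W_def by linarith
    obtain A \<Q>' where *: "A \<in> sets X" "A \<subseteq> \<Union>(snd s)" "finite \<Q>'" "\<Q>' \<subseteq> sets X" "disjoint \<Q>'"
      "\<Union>\<Q>' \<subseteq> \<Union>(snd s) - A" "prob (W (snd s)) - \<eta> / 4 / 2 ^ n \<le> prob (W \<Q>')"
      "\<eta> / 2 / 160 \<le> prob {\<omega> \<in> space M. 1 \<le> \<bar>\<mu> A \<omega>\<bar>}"
      using random_thinning_exists[OF B fin pos(1) le pos(2), folded W_def] by (elim exE conjE) (rule that)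
    have "\<eta> / 2 + \<eta> / 2 / 2 ^ n - \<eta> / 4 / 2 ^ n = \<eta> / 2 + \<eta> / 2 / 2 ^ Suc n" by (simp add: field_simps)
    then have "\<eta> / 2 + \<eta> / 2 / 2 ^ Suc n \<le> prob (W \<Q>')" using *(7) Ws by linarith
    then have "good (Suc n) (A, \<Q>') \<and> step s (A, \<Q>')" using * by (simp add: good_def step_def)
    then show "\<exists>s'. good (Suc n) s' \<and> step s s'" by blast
  qed
  then obtain f where f: "\<And>n. good n (f n)" "\<And>n. step (f n) (f (Suc n))" by blast
  define A where "A n = fst (f (Suc n))" for n
  have A: "A n \<in> sets X" for n using f(2)[of n] by (simp add: step_def A_def)
  have [measurable]: "\<mu> (A n) \<in> borel_measurable M" for n by (intro measurable_mu A)
  have dec: "\<Union>(snd (f (m + k))) \<subseteq> \<Union>(snd (f m))" for m k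
  proof (induction k)
    case (Suc k)
    have "\<Union>(snd (f (Suc (m + k)))) \<subseteq> \<Union>(snd (f (m + k)))" using f(2)[of "m + k"] by (auto simp: step_def)
    then show ?case using Suc by simp
  qed simp
  have A_disj: "A m \<inter> A n = {}" if "m < n" for m n
  proof -
    have "A n \<subseteq> \<Union>(snd (f n))" using f(2)[of n] by (simp add: step_def A_def)
    also have "\<dots> \<subseteq> \<Union>(snd (f (Suc m)))" using dec[of "Suc m" "n - Suc m"] that by simp
    also have "\<dots> \<inter> A m = {}" using f(2)[of m] by (auto simp: step_def A_def)
    finally show ?thesis by blast
  qed
  have "disjoint_family A" unfolding disjoint_family_on_def using A_disj by (metis Int_commute neqE)
  then have "(\<lambda>n. L0_norm M (\<mu> (A n))) \<longlonglongrightarrow> 0" by (intro mu_disjoint_tendsto_0 A)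
  moreover have "\<eta> / 640 \<le> L0_norm M (\<mu> (A n))" for n
  proof -
    have "\<eta> / 2 / 160 \<le> prob {\<omega> \<in> space M. 1 \<le> \<bar>\<mu> (A n) \<omega>\<bar>}" using f(2)[of n] by (simp add: step_def A_def)
    also have "\<dots> \<le> tail_prob M (\<mu> (A n)) (1/2)" by (rule finite_measure_mono) auto
    finally show ?thesis using tail_le_L0_norm[of "\<mu> (A n)" "1/2"] by simp
  qed
  ultimately have "\<eta> / 640 \<le> 0" by (intro LIMSEQ_le_const) auto
  then show False using assms by simp
qed

end

section \<open>Integrals of bounded simple functions\<close>

context prob_space
begin

text \<open>A lower bound in the random subset that holds at each \<open>\<omega>\<close> of an event is transferred to the
  average of the tails by Fubini's theorem.\<close>

lemma subset_avg_tail_le: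
  fixes Y :: "'i set \<Rightarrow> 'a \<Rightarrow> real"
  assumes fin: "finite I" and q: "\<And>i. i \<in> I \<Longrightarrow> 0 \<le> q i \<and> q i \<le> 1"
    and E: "E \<in> events" and Y: "\<And>S. S \<subseteq> I \<Longrightarrow> Y S \<in> borel_measurable M"
    and le: "\<And>\<omega>. \<omega> \<in> E \<Longrightarrow> c \<le> subset_avg I q (\<lambda>S. of_bool (t < \<bar>Y S \<omega>\<bar>))"
  shows "c * prob E \<le> subset_avg I q (\<lambda>S. tail_prob M (Y S) t)"
proof -
  have ev: "{\<omega> \<in> space M. t < \<bar>Y S \<omega>\<bar>} \<in> events" if "S \<subseteq> I" for S
    using Y[OF that] by measurable
  let ?F = "\<lambda>\<omega> S. indicator {\<omega> \<in> space M. t < \<bar>Y S \<omega>\<bar>} \<omega> :: real"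
  have int: "integrable M (\<lambda>\<omega>. ?F \<omega> S)" if "S \<subseteq> I" for S
    using ev[OF that] by (intro integrable_real_indicator) (auto simp: emeasure_eq_measure)
  have "c * prob E = (\<integral>\<omega>. c * indicator E \<omega> \<partial>M)" using E by simp
  also have "\<dots> \<le> (\<integral>\<omega>. subset_avg I q (?F \<omega>) \<partial>M)"
  proof (rule integral_mono)
    show "integrable M (\<lambda>\<omega>. c * indicator E \<omega>)" using E
      by (intro integrable_mult_right integrable_real_indicator) (auto simp: emeasure_eq_measure)
    show "integrable M (\<lambda>\<omega>. subset_avg I q (?F \<omega>))" by (rule subset_avg_integral(1)[OF fin int])
    fix \<omega> assume \<omega>: "\<omega> \<in> space M"
    have F: "?F \<omega> = (\<lambda>S. of_bool (t < \<bar>Y S \<omega>\<bar>))" using \<omega> by (auto simp: indicator_def fun_eq_iff)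
    have "subset_avg I q (\<lambda>_. 0) \<le> subset_avg I q (?F \<omega>)" by (rule subset_avg_mono) (use q in auto)
    then show "c * indicator E \<omega> \<le> subset_avg I q (?F \<omega>)"
      using le[of \<omega>] fin unfolding F by (cases "\<omega> \<in> E") auto
  qed
  also have "\<dots> = subset_avg I q (\<lambda>S. \<integral>\<omega>. ?F \<omega> S \<partial>M)" by (rule subset_avg_integral(2)[OF fin int])
  also have "\<dots> = subset_avg I q (\<lambda>S. tail_prob M (Y S) t)"
  proof (rule subset_avg_cong)
    fix S assume "S \<subseteq> I"
    then show "(\<integral>\<omega>. ?F \<omega> S \<partial>M) = tail_prob M (Y S) t" using ev[of S] by simp
  qed simp
  finally show ?thesis .
qed

text \<open>Rounding the coefficients \<open>q i\<close> at random to 0 or 1 preserves the mean. Keeping them away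
  from 0 and 1 makes the rounded sum comparable with its mean with a fixed probability.\<close>

lemma tail_weighted_sum_le:
  assumes fin: "finite I" and q: "\<And>i. i \<in> I \<Longrightarrow> 1/4 \<le> q i \<and> q i \<le> 3/4"
    and Y: "\<And>i. i \<in> I \<Longrightarrow> Y i \<in> borel_measurable M" and t: "0 \<le> t"
  shows "1/20 * tail_prob M (\<lambda>\<omega>. \<Sum>i\<in>I. q i * Y i \<omega>) (2 * t) \<le> subset_avg I q (\<lambda>S. tail_prob M (\<lambda>\<omega>. \<Sum>i\<in>S. Y i \<omega>) t)"
proof (rule subset_avg_tail_le[OF fin])
  show "{\<omega> \<in> space M. 2 * t < \<bar>\<Sum>i\<in>I. q i * Y i \<omega>\<bar>} \<in> events"
  proof -
    have [measurable]: "(\<lambda>\<omega>. \<Sum>i\<in>I. q i * Y i \<omega>) \<in> borel_measurable M"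
      using Y by (intro borel_measurable_sum borel_measurable_times) auto
    show ?thesis by measurable
  qed
  show "(\<lambda>\<omega>. \<Sum>i\<in>S. Y i \<omega>) \<in> borel_measurable M" if "S \<subseteq> I" for S
    using Y that by (intro borel_measurable_sum) auto
  show "0 \<le> q i \<and> q i \<le> 1" if "i \<in> I" for i using q[OF that] by auto
  fix \<omega> assume "\<omega> \<in> {\<omega> \<in> space M. 2 * t < \<bar>\<Sum>i\<in>I. q i * Y i \<omega>\<bar>}"
  then have m: "2 * t < \<bar>\<Sum>i\<in>I. q i * Y i \<omega>\<bar>" by simp
  define m where "m = (\<Sum>i\<in>I. q i * Y i \<omega>)"
  define V where "V = (\<Sum>i\<in>I. q i * (1 - q i) * (Y i \<omega>)\<^sup>2)"
  have V0: "0 \<le> V" unfolding V_def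
  proof (intro sum_nonneg mult_nonneg_nonneg)
    fix i assume "i \<in> I" then show "0 \<le> q i" "0 \<le> 1 - q i" using q[of i] by auto
  qed auto
  have "1/20 \<le> subset_avg I q (\<lambda>S. of_bool ((m + centred_sum I q (\<lambda>i. Y i \<omega>) S)\<^sup>2 \<ge> (m\<^sup>2 + V) / 4))"
    by (rule subset_avg_paley_zygmund[OF fin q]) (auto simp: V_def)
  also have "\<dots> \<le> subset_avg I q (\<lambda>S. of_bool (t < \<bar>\<Sum>i\<in>S. Y i \<omega>\<bar>))"
  proof (rule subset_avg_mono)
    show "0 \<le> q i \<and> q i \<le> 1" if "i \<in> I" for i using q[OF that] by auto
    fix S assume "S \<subseteq> I"
    have *: "m + centred_sum I q (\<lambda>i. Y i \<omega>) S = (\<Sum>i\<in>S. Y i \<omega>)" by (simp add: m_def centred_sum_def)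
    have "(2 * t)\<^sup>2 < \<bar>m\<bar>\<^sup>2" using m t unfolding m_def by (intro power_strict_mono) auto
    then have "t\<^sup>2 < (m\<^sup>2 + V) / 4" using V0 by simp
    then have "t < \<bar>\<Sum>i\<in>S. Y i \<omega>\<bar>" if "(m\<^sup>2 + V) / 4 \<le> (\<Sum>i\<in>S. Y i \<omega>)\<^sup>2"
      using that t by (intro power_less_imp_less_base[of t 2]) auto
    then show "of_bool ((m\<^sup>2 + V) / 4 \<le> (m + centred_sum I q (\<lambda>i. Y i \<omega>) S)\<^sup>2) \<le> (of_bool (t < \<bar>\<Sum>i\<in>S. Y i \<omega>\<bar>) :: real)"
      unfolding * by (auto simp: of_bool_def)
  qed
  finally show "1/20 \<le> subset_avg I q (\<lambda>S. of_bool (t < \<bar>\<Sum>i\<in>S. Y i \<omega>\<bar>))" .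
qed

text \<open>Khinchin's inequality in probability: random signs detect the sum of the squares.\<close>

lemma tail_square_sum_le:
  assumes fin: "finite I" and Y: "\<And>i. i \<in> I \<Longrightarrow> Y i \<in> borel_measurable M" and t: "0 \<le> t"
  shows "1/20 * prob {\<omega> \<in> space M. 4 * t\<^sup>2 < (\<Sum>i\<in>I. (Y i \<omega>)\<^sup>2)}
    \<le> subset_avg I (\<lambda>_. 1/2) (\<lambda>S. tail_prob M (\<lambda>\<omega>. signed_sum I (\<lambda>i. Y i \<omega>) S) t)"
proof (rule subset_avg_tail_le[OF fin])
  show "{\<omega> \<in> space M. 4 * t\<^sup>2 < (\<Sum>i\<in>I. (Y i \<omega>)\<^sup>2)} \<in> events"
  proof -
    have [measurable]: "(\<lambda>\<omega>. \<Sum>i\<in>I. (Y i \<omega>)\<^sup>2) \<in> borel_measurable M"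
      using Y by (intro borel_measurable_sum borel_measurable_power) auto
    show ?thesis by measurable
  qed
  show "(\<lambda>\<omega>. signed_sum I (\<lambda>i. Y i \<omega>) S) \<in> borel_measurable M" for S
    unfolding signed_sum_def using Y by (intro borel_measurable_sum borel_measurable_times) auto
  fix \<omega> assume "\<omega> \<in> {\<omega> \<in> space M. 4 * t\<^sup>2 < (\<Sum>i\<in>I. (Y i \<omega>)\<^sup>2)}"
  then have big: "4 * t\<^sup>2 < (\<Sum>i\<in>I. (Y i \<omega>)\<^sup>2)" by simp
  define V where "V = (\<Sum>i\<in>I. 1/2 * (1 - 1/2) * (Y i \<omega>)\<^sup>2)"
  have V: "4 * V = (\<Sum>i\<in>I. (Y i \<omega>)\<^sup>2)" by (simp add: V_def sum_distrib_left)
  have "1/20 \<le> subset_avg I (\<lambda>_. 1/2) (\<lambda>S. of_bool ((0 + centred_sum I (\<lambda>_. 1/2) (\<lambda>i. Y i \<omega>) S)\<^sup>2 \<ge> (0\<^sup>2 + V) / 4))"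
    by (rule subset_avg_paley_zygmund[OF fin]) (auto simp: V_def)
  also have "\<dots> \<le> subset_avg I (\<lambda>_. 1/2) (\<lambda>S. of_bool (t < \<bar>signed_sum I (\<lambda>i. Y i \<omega>) S\<bar>))"
  proof (rule subset_avg_mono)
    fix S assume S: "S \<subseteq> I"
    let ?W = "centred_sum I (\<lambda>_. 1/2) (\<lambda>i. Y i \<omega>) S" and ?Z = "signed_sum I (\<lambda>i. Y i \<omega>) S"
    have Z: "?Z = 2 * ?W" using fin S by (rule signed_sum_eq_centred_sum)
    have "t < \<bar>?Z\<bar>" if "V / 4 \<le> ?W\<^sup>2"
    proof (rule power_less_imp_less_base[of t 2])
      have "t\<^sup>2 < V" using big V by simp
      also have "V \<le> (2 * ?W)\<^sup>2" using that by (simp add: power_mult_distrib)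
      finally show "t\<^sup>2 < \<bar>?Z\<bar>\<^sup>2" unfolding Z by simp
    qed auto
    then show "of_bool ((0\<^sup>2 + V) / 4 \<le> (0 + ?W)\<^sup>2) \<le> (of_bool (t < \<bar>?Z\<bar>) :: real)"
      by (auto simp: of_bool_def)
  qed auto
  finally show "1/20 \<le> subset_avg I (\<lambda>_. 1/2) (\<lambda>S. of_bool (t < \<bar>signed_sum I (\<lambda>i. Y i \<omega>) S\<bar>))" .
qed auto

end

context stochastic_meas
begin

text \<open>Boundedness passes from sets to combinations with coefficients in \<open>[-1, 1]\<close>. Convexity is of
  no help in the space of all random variables, where an average of variables that are uniformly
  bounded in probability need not be so; random rounding of the coefficients replaces it.\<close>

lemma combinations_bounded_in_prob:
  assumes "0 < \<eta>"
  shows "\<exists>t>0. \<forall>I c a. finite I \<longrightarrow> (\<forall>i\<in>I. c i \<in> sets X) \<longrightarrow> disjoint_family_on c I \<longrightarrow> (\<forall>i\<in>I. \<bar>a i\<bar> \<le> 1)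
    \<longrightarrow> tail_prob M (\<lambda>\<omega>. \<Sum>i\<in>(I::'i set). a i * \<mu> (c i) \<omega>) t \<le> \<eta>"
proof -
  obtain t0 where t0: "\<And>A. A \<in> sets X \<Longrightarrow> tail_prob M (\<mu> A) t0 \<le> \<eta> / 21"
    using range_bounded_in_prob[of "\<eta> / 21"] assms by auto
  define t where "t = max t0 1"
  have t: "0 < t" by (simp add: t_def)
  have small: "tail_prob M (\<mu> A) t \<le> \<eta> / 21" if "A \<in> sets X" for A
    using tail_antimono[OF measurable_mu[OF that], of t0 t] t0[OF that] by (simp add: t_def)
  have "tail_prob M (\<lambda>\<omega>. \<Sum>i\<in>I. a i * \<mu> (c i) \<omega>) (10 * t) \<le> \<eta>"
    if fin: "finite I" and c: "\<forall>i\<in>I. c i \<in> sets X" and disj: "disjoint_family_on c I" and a: "\<forall>i\<in>I. \<bar>a i\<bar> \<le> 1"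
    for I :: "'i set" and c a
  proof -
    have m: "\<mu> (c i) \<in> borel_measurable M" if "i \<in> I" for i using c that by (intro measurable_mu) auto
    have sumS: "tail_prob M (\<lambda>\<omega>. \<Sum>i\<in>S. \<mu> (c i) \<omega>) t \<le> \<eta> / 21" if S: "S \<subseteq> I" for S
    proof -
      have U: "(\<Union>i\<in>S. c i) \<in> sets X" using S c fin by (intro sets.finite_UN) (auto intro: finite_subset)
      have "tail_prob M (\<mu> (\<Union>i\<in>S. c i)) t = tail_prob M (\<lambda>\<omega>. \<Sum>i\<in>S. \<mu> (c i) \<omega>) t"
      proof (rule tail_cong_AE)
        show "AE \<omega> in M. \<mu> (\<Union>i\<in>S. c i) \<omega> = (\<Sum>i\<in>S. \<mu> (c i) \<omega>)"
          using S c fin disj by (intro mu_UNION) (auto intro: finite_subset disjoint_family_on_mono)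
      qed (use U S c in \<open>auto intro!: measurable_mu borel_measurable_sum\<close>)
      then show ?thesis using small[OF U] by simp
    qed
    \<comment> \<open>maps \<open>[-1, 1]\<close> onto \<open>[1/4, 3/4]\<close>\<close>
    define q where "q i = 1/2 + a i / 4" for i
    have q: "1/4 \<le> q i \<and> q i \<le> 3/4" if "i \<in> I" for i using a that by (auto simp: q_def abs_le_iff)
    have "1/20 * tail_prob M (\<lambda>\<omega>. \<Sum>i\<in>I. q i * \<mu> (c i) \<omega>) (2 * t)
        \<le> subset_avg I q (\<lambda>S. tail_prob M (\<lambda>\<omega>. \<Sum>i\<in>S. \<mu> (c i) \<omega>) t)"
      using t m q by (intro tail_weighted_sum_le[OF fin]) auto
    also have "\<dots> \<le> subset_avg I q (\<lambda>_. \<eta> / 21)"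
    proof (rule subset_avg_mono)
      show "0 \<le> q i \<and> q i \<le> 1" if "i \<in> I" for i using q[OF that] by auto
    qed (rule sumS)
    finally have q20: "tail_prob M (\<lambda>\<omega>. \<Sum>i\<in>I. q i * \<mu> (c i) \<omega>) (2 * t) \<le> 20 * (\<eta> / 21)" using fin by simp
    have m1: "(\<lambda>\<omega>. \<Sum>i\<in>I. q i * \<mu> (c i) \<omega>) \<in> borel_measurable M"
      using m by (intro borel_measurable_sum borel_measurable_times) auto
    have m2: "(\<lambda>\<omega>. \<Sum>i\<in>I. \<mu> (c i) \<omega>) \<in> borel_measurable M" using m by (intro borel_measurable_sum) auto
    have eq: "(\<Sum>i\<in>I. a i * \<mu> (c i) \<omega>) = 4 * (\<Sum>i\<in>I. q i * \<mu> (c i) \<omega>) + (- 2) * (\<Sum>i\<in>I. \<mu> (c i) \<omega>)" for \<omega>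
      by (simp add: q_def algebra_simps sum.distrib sum_distrib_left sum_subtractf sum_negf)
    have s: "10 * t = 4 * (2 * t) + 2 * t" by simp
    have "tail_prob M (\<lambda>\<omega>. \<Sum>i\<in>I. a i * \<mu> (c i) \<omega>) (10 * t)
        \<le> tail_prob M (\<lambda>\<omega>. 4 * (\<Sum>i\<in>I. q i * \<mu> (c i) \<omega>)) (4 * (2 * t)) + tail_prob M (\<lambda>\<omega>. (- 2) * (\<Sum>i\<in>I. \<mu> (c i) \<omega>)) (2 * t)"
      unfolding eq s by (rule tail_add) (use m1 m2 in auto)
    also have "tail_prob M (\<lambda>\<omega>. 4 * (\<Sum>i\<in>I. q i * \<mu> (c i) \<omega>)) (4 * (2 * t)) = tail_prob M (\<lambda>\<omega>. \<Sum>i\<in>I. q i * \<mu> (c i) \<omega>) (2 * t)"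
      by (simp add: abs_mult)
    also have "tail_prob M (\<lambda>\<omega>. (- 2) * (\<Sum>i\<in>I. \<mu> (c i) \<omega>)) (2 * t) = tail_prob M (\<lambda>\<omega>. \<Sum>i\<in>I. \<mu> (c i) \<omega>) t"
      by (simp add: abs_mult)
    also have "tail_prob M (\<lambda>\<omega>. \<Sum>i\<in>I. q i * \<mu> (c i) \<omega>) (2 * t) + tail_prob M (\<lambda>\<omega>. \<Sum>i\<in>I. \<mu> (c i) \<omega>) t \<le> \<eta>"
      using q20 sumS[of I] by simp
    finally show ?thesis .
  qed
  then show ?thesis using t by (intro exI[of _ "10 * t"]) auto
qed

abbreviation sint :: "'x set \<Rightarrow> ('x \<Rightarrow> real) \<Rightarrow> 'a \<Rightarrow> real" where
  "sint \<equiv> sm_simple_integral X \<mu>"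

lemma sint_measurable:
  assumes "A \<in> sets X" "simple_function X f"
  shows "sint A f \<in> borel_measurable M"
proof -
  have "sint A f = (\<lambda>\<omega>. \<Sum>y\<in>f ` space X. y * \<mu> (A \<inter> (f -` {y} \<inter> space X)) \<omega>)"
    by (simp add: sm_simple_integral_def fun_eq_iff)
  also have "\<dots> \<in> borel_measurable M"
    using assms by (intro borel_measurable_sum borel_measurable_times measurable_mu) (auto dest: simple_functionD)
  finally show ?thesis .
qed

text \<open>The integral may be computed from any representation that is constant on the level sets of a
  simple function; with pairs as values this yields additivity.\<close>

lemma sint_partition:
  assumes A: "A \<in> sets X" and p: "simple_function X p"
  shows "AE \<omega> in M. sint A (\<lambda>x. F (p x)) \<omega> = (\<Sum>z\<in>p ` space X. F z * \<mu> (A \<inter> (p -` {z} \<inter> space X)) \<omega>)"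
proof -
  let ?Z = "p ` space X" and ?c = "\<lambda>z. A \<inter> (p -` {z} \<inter> space X)"
  have fin: "finite ?Z" using p by (rule simple_functionD)
  have cz: "?c z \<in> sets X" for z using A simple_functionD(2)[OF p, of "{z}"] by auto
  have im: "(\<lambda>x. F (p x)) ` space X = F ` ?Z" by auto
  have "AE \<omega> in M. \<forall>y\<in>F ` ?Z. \<mu> (\<Union>z\<in>{z \<in> ?Z. F z = y}. ?c z) \<omega> = (\<Sum>z\<in>{z \<in> ?Z. F z = y}. \<mu> (?c z) \<omega>)"
    by (intro AE_ball_countable[THEN iffD2] ballI mu_UNION countable_finite finite_imageI fin)
       (use fin cz in \<open>auto simp: disjoint_family_on_def\<close>)
  then show ?thesis
  proof eventually_elim
    case (elim \<omega>)
    have "sint A (\<lambda>x. F (p x)) \<omega> = (\<Sum>y\<in>F ` ?Z. y * \<mu> (A \<inter> ((\<lambda>x. F (p x)) -` {y} \<inter> space X)) \<omega>)"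
      by (simp only: sm_simple_integral_def im)
    also have "\<dots> = (\<Sum>y\<in>F ` ?Z. \<Sum>z\<in>{z \<in> ?Z. F z = y}. F z * \<mu> (?c z) \<omega>)"
    proof (rule sum.cong)
      fix y assume y: "y \<in> F ` ?Z"
      have eq: "A \<inter> ((\<lambda>x. F (p x)) -` {y} \<inter> space X) = (\<Union>z\<in>{z \<in> ?Z. F z = y}. ?c z)" by auto
      have "y * \<mu> (A \<inter> ((\<lambda>x. F (p x)) -` {y} \<inter> space X)) \<omega> = y * (\<Sum>z\<in>{z \<in> ?Z. F z = y}. \<mu> (?c z) \<omega>)"
        unfolding eq using bspec[OF elim y] by (rule arg_cong)
      also have "\<dots> = (\<Sum>z\<in>{z \<in> ?Z. F z = y}. F z * \<mu> (?c z) \<omega>)"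
        unfolding sum_distrib_left by (rule sum.cong) auto
      finally show "y * \<mu> (A \<inter> ((\<lambda>x. F (p x)) -` {y} \<inter> space X)) \<omega> = (\<Sum>z\<in>{z \<in> ?Z. F z = y}. F z * \<mu> (?c z) \<omega>)" .
    qed simp
    also have "\<dots> = (\<Sum>z\<in>?Z. F z * \<mu> (?c z) \<omega>)" by (rule sum.image_gen[OF fin, symmetric])
    finally show ?case .
  qed
qed

lemma sint_add:
  assumes A: "A \<in> sets X" and f: "simple_function X f" "simple_function X g"
  shows "AE \<omega> in M. sint A (\<lambda>x. f x + g x) \<omega> = sint A f \<omega> + sint A g \<omega>"
proof -
  let ?p = "\<lambda>x. (f x, g x)"
  have p: "simple_function X ?p" using f by (rule simple_function_Pair)
  show ?thesis
    using sint_partition[OF A p, of "\<lambda>z. fst z + snd z"] sint_partition[OF A p, of fst] sint_partition[OF A p, of snd]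
    by eventually_elim (simp add: sum.distrib[symmetric] algebra_simps)
qed

lemma sint_cmult:
  assumes A: "A \<in> sets X" and f: "simple_function X f"
  shows "AE \<omega> in M. sint A (\<lambda>x. c * f x) \<omega> = c * sint A f \<omega>"
  using sint_partition[OF A f, of "\<lambda>z. c * z"] sint_partition[OF A f, of "\<lambda>z. z"]
  by eventually_elim (simp add: sum_distrib_left algebra_simps)

lemma sint_sum:
  assumes A: "A \<in> sets X" and K: "finite K" and f: "\<And>k. k \<in> K \<Longrightarrow> simple_function X (f k)"
  shows "AE \<omega> in M. sint A (\<lambda>x. \<Sum>k\<in>K. b k * f k x) \<omega> = (\<Sum>k\<in>K. b k * sint A (f k) \<omega>)"
  using K f
proof (induction K)
  case empty
  show ?case by (intro AE_I2) (auto simp: sm_simple_integral_def intro!: sum.neutral)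
next
  case (insert k K)
  have s1: "simple_function X (\<lambda>x. b k * f k x)" using insert by (intro simple_function_mult simple_function_const) auto
  have s2: "simple_function X (\<lambda>x. \<Sum>k\<in>K. b k * f k x)"
    using insert by (intro simple_function_sum simple_function_mult simple_function_const) auto
  have "AE \<omega> in M. sint A (\<lambda>x. \<Sum>k\<in>K. b k * f k x) \<omega> = (\<Sum>k\<in>K. b k * sint A (f k) \<omega>)"
    using insert by auto
  moreover have "AE \<omega> in M. sint A (\<lambda>x. b k * f k x) \<omega> = b k * sint A (f k) \<omega>"
    using insert by (intro sint_cmult A) auto
  moreover note sint_add[OF A s1 s2]
  ultimately show ?case by eventually_elim (use insert in simp)
qed

lemma sint_bounded_in_prob:
  assumes "0 < \<eta>"
  shows "\<exists>t>0. \<forall>f A C. simple_function X f \<longrightarrow> A \<in> sets X \<longrightarrow> 0 < C \<longrightarrow> (\<forall>x\<in>A. \<bar>f x\<bar> \<le> C)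
    \<longrightarrow> tail_prob M (sint A f) (C * t) \<le> \<eta>"
proof -
  obtain t where t: "0 < t" and bound: "\<And>(I :: real set) c a. finite I \<Longrightarrow> (\<forall>i\<in>I. c i \<in> sets X) \<Longrightarrow> disjoint_family_on c I
      \<Longrightarrow> (\<forall>i\<in>I. \<bar>a i\<bar> \<le> 1) \<Longrightarrow> tail_prob M (\<lambda>\<omega>. \<Sum>i\<in>I. a i * \<mu> (c i) \<omega>) t \<le> \<eta>"
    using combinations_bounded_in_prob[OF assms, where 'i = real] by blast
  have "tail_prob M (sint A f) (C * t) \<le> \<eta>"
    if f: "simple_function X f" and A: "A \<in> sets X" and C: "0 < C" and fC: "\<forall>x\<in>A. \<bar>f x\<bar> \<le> C" for f A C
  proof -
    let ?c = "\<lambda>y. A \<inter> (f -` {y} \<inter> space X)"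
    define a where "a y = (if \<bar>y\<bar> \<le> C then y / C else 0)" for y
    have cs: "?c y \<in> sets X" for y using A simple_functionD(2)[OF f, of "{y}"] by auto
    have a1: "\<bar>a y\<bar> \<le> 1" for y using C by (simp add: a_def)
    have fin: "finite (f ` space X)" using f by (rule simple_functionD)
    have meas: "(\<lambda>\<omega>. C * (\<Sum>y\<in>f ` space X. a y * \<mu> (?c y) \<omega>)) \<in> borel_measurable M"
      using cs by (intro borel_measurable_times borel_measurable_sum measurable_mu) auto
    have "AE \<omega> in M. sint A f \<omega> = C * (\<Sum>y\<in>f ` space X. a y * \<mu> (?c y) \<omega>)"
      using mu_empty
    proof eventually_elim
      case (elim \<omega>)
      have eq: "y * \<mu> (?c y) \<omega> = C * (a y * \<mu> (?c y) \<omega>)" for y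
      proof (cases "\<bar>y\<bar> \<le> C")
        case True then show ?thesis using C by (simp add: a_def)
      next
        case False
        then have "?c y = {}" using fC by auto
        then show ?thesis using elim by simp
      qed
      show ?case unfolding sm_simple_integral_def sum_distrib_left by (rule sum.cong[OF refl eq])
    qed
    then have "tail_prob M (sint A f) (C * t) = tail_prob M (\<lambda>\<omega>. C * (\<Sum>y\<in>f ` space X. a y * \<mu> (?c y) \<omega>)) (C * t)"
      by (intro tail_cong_AE sint_measurable A f meas)
    also have "\<dots> = tail_prob M (\<lambda>\<omega>. \<Sum>y\<in>f ` space X. a y * \<mu> (?c y) \<omega>) t"
      using C by (simp add: abs_mult)
    also have "\<dots> \<le> \<eta>" using fin cs a1 by (intro bound) (auto simp: disjoint_family_on_def)
    finally show ?thesis .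
  qed
  then show ?thesis using t by blast
qed

lemma sint_stochastic_measure:
  assumes f: "simple_function X f"
  shows "stochastic_measure M X (\<lambda>A. sint A f)"
  unfolding stochastic_measure_def
proof (intro conjI ballI allI impI)
  fix A assume "A \<in> sets X" then show "sint A f \<in> borel_measurable M" using f by (intro sint_measurable)
next
  fix A :: "nat \<Rightarrow> 'x set" assume A: "range A \<subseteq> sets X" "disjoint_family A"
  let ?F = "\<lambda>y. f -` {y} \<inter> space X"
  have F: "?F y \<in> sets X" for y using f by (rule simple_functionD)
  have fin: "finite (f ` space X)" using f by (rule simple_functionD)
  have AF: "A i \<inter> ?F y \<in> sets X" for i y using A F[of y] by auto
  have UFs: "(\<Union>i. A i) \<inter> ?F y \<in> sets X" for y
    by (rule sets.Int[OF sets.countable_nat_UN[OF A(1)] F])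
  have UF: "(\<Union>i. A i) \<inter> ?F y = (\<Union>i. A i \<inter> ?F y)" for y by auto
  have "conv_in_prob M (\<lambda>n \<omega>. \<Sum>y\<in>f ` space X. y * (\<Sum>i<n. \<mu> (A i \<inter> ?F y) \<omega>)) (\<lambda>\<omega>. \<Sum>y\<in>f ` space X. y * \<mu> ((\<Union>i. A i) \<inter> ?F y) \<omega>)"
  proof (rule conv_in_prob_sum[OF fin])
    fix y
    have "conv_in_prob M (\<lambda>n \<omega>. \<Sum>i<n. \<mu> (A i \<inter> ?F y) \<omega>) (\<mu> (\<Union>i. A i \<inter> ?F y))"
      using A by (intro sigma_additive AF) (auto simp: disjoint_family_on_def)
    then show "conv_in_prob M (\<lambda>n \<omega>. y * (\<Sum>i<n. \<mu> (A i \<inter> ?F y) \<omega>)) (\<lambda>\<omega>. y * \<mu> ((\<Union>i. A i) \<inter> ?F y) \<omega>)"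
      unfolding UF by (rule conv_in_prob_cmult)
    show "(\<lambda>\<omega>. y * (\<Sum>i<n. \<mu> (A i \<inter> ?F y) \<omega>)) \<in> borel_measurable M" for n
      by (intro borel_measurable_times borel_measurable_sum measurable_mu AF) auto
    show "(\<lambda>\<omega>. y * \<mu> ((\<Union>i. A i) \<inter> ?F y) \<omega>) \<in> borel_measurable M"
      by (intro borel_measurable_times measurable_mu UFs) auto
  qed
  moreover have "(\<Sum>i<n. sint (A i) f \<omega>) = (\<Sum>y\<in>f ` space X. y * (\<Sum>i<n. \<mu> (A i \<inter> ?F y) \<omega>))" for n \<omega>
    unfolding sm_simple_integral_def sum_distrib_left by (rule sum.swap)
  ultimately show "conv_in_prob M (\<lambda>n \<omega>. \<Sum>i<n. sint (A i) f \<omega>) (sint (\<Union>i. A i) f)"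
    by (simp add: sm_simple_integral_def[abs_def])
qed

end

section \<open>Nikodym convergence and limits of integrals\<close>

context stochastic_meas
begin

text \<open>Otherwise each \<open>E N\<close> has a subset \<open>B N\<close> with large measure. Cutting \<open>B N\<close> off at a later
  \<open>E k\<close> changes its measure little and produces disjoint sets, against \<open>\<sigma>\<close>-additivity.\<close>

lemma mu_uniformly_small:
  assumes E: "\<And>i::nat. E i \<in> sets X" "decseq E" "(\<Inter>i. E i) = {}" and \<epsilon>: "0 < \<epsilon>"
  shows "\<exists>N. \<forall>B\<in>sets X. B \<subseteq> E N \<longrightarrow> L0_norm M (\<mu> B) \<le> \<epsilon>"
proof (rule ccontr)
  assume "\<not> ?thesis"
  then have "\<forall>N. \<exists>B. B \<in> sets X \<and> B \<subseteq> E N \<and> \<epsilon> < L0_norm M (\<mu> B)" by (auto simp: not_le)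
  then obtain B where B: "\<And>N. B N \<in> sets X" "\<And>N. B N \<subseteq> E N" "\<And>N. \<epsilon> < L0_norm M (\<mu> (B N))" by metis
  have sub: "i \<le> j \<Longrightarrow> E j \<subseteq> E i" for i j using E(2) by (auto simp: decseq_def)
  have "\<exists>k>N. \<epsilon> / 2 \<le> L0_norm M (\<mu> (B N - E k))" for N
  proof -
    have "(\<lambda>k. L0_norm M (\<mu> (B N \<inter> E k))) \<longlonglongrightarrow> 0"
    proof (rule mu_decreasing_tendsto_0)
      show "B N \<inter> E k \<in> sets X" for k using B E(1) by auto
      show "decseq (\<lambda>k. B N \<inter> E k)" using sub by (auto simp: decseq_def)
      show "(\<Inter>k. B N \<inter> E k) = {}" using E(3) by blast
    qed
    then have "\<forall>\<^sub>F k in sequentially. L0_norm M (\<mu> (B N \<inter> E k)) < \<epsilon> / 2"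
      using \<epsilon> by (intro order_tendstoD) auto
    then obtain K where K: "\<forall>k\<ge>K. L0_norm M (\<mu> (B N \<inter> E k)) < \<epsilon> / 2" unfolding eventually_sequentially by blast
    define k where "k = max K (Suc N)"
    have k: "k > N" "L0_norm M (\<mu> (B N \<inter> E k)) < \<epsilon> / 2" using K by (auto simp: k_def)
    have s: "B N \<inter> E k \<in> sets X" "B N - B N \<inter> E k \<in> sets X" using B(1) E(1) by auto
    have "L0_norm M (\<mu> (B N)) = L0_norm M (\<lambda>\<omega>. \<mu> (B N - B N \<inter> E k) \<omega> + \<mu> (B N \<inter> E k) \<omega>)"
    proof (rule L0_norm_cong_AE)
      have "AE \<omega> in M. \<mu> (B N - B N \<inter> E k) \<omega> = \<mu> (B N) \<omega> - \<mu> (B N \<inter> E k) \<omega>"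
        using s B(1) by (intro mu_diff) auto
      then show "AE \<omega> in M. \<mu> (B N) \<omega> = \<mu> (B N - B N \<inter> E k) \<omega> + \<mu> (B N \<inter> E k) \<omega>" by eventually_elim simp
    qed (use s B(1) in \<open>auto intro!: measurable_mu borel_measurable_add\<close>)
    also have "\<dots> \<le> L0_norm M (\<mu> (B N - B N \<inter> E k)) + L0_norm M (\<mu> (B N \<inter> E k))"
      using s by (intro L0_norm_triangle measurable_mu)
    also have "B N - B N \<inter> E k = B N - E k" by auto
    finally have "\<epsilon> / 2 \<le> L0_norm M (\<mu> (B N - E k))" using B(3)[of N] k by simp
    then show ?thesis using k by blast
  qed
  then obtain h where h: "\<And>N. N < h N" "\<And>N. \<epsilon> / 2 \<le> L0_norm M (\<mu> (B N - E (h N)))" by metis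
  define r where "r i = (h ^^ i) 0" for i
  have rSuc: "r (Suc i) = h (r i)" for i by (simp add: r_def)
  have mono: "i \<le> j \<Longrightarrow> r i \<le> r j" for i j
    by (rule lift_Suc_mono_le[of r]) (use h(1) rSuc in \<open>auto simp: less_imp_le\<close>)
  define C where "C i = B (r i) - E (h (r i))" for i
  have C: "C i \<in> sets X" for i using B(1) E(1) by (auto simp: C_def)
  have Cd: "C i \<inter> C j = {}" if "i < j" for i j
  proof -
    have "C j \<subseteq> E (r j)" using B(2) by (auto simp: C_def)
    also have "\<dots> \<subseteq> E (r (Suc i))" using that by (intro sub mono) auto
    finally show ?thesis unfolding rSuc by (auto simp: C_def)
  qed
  have "disjoint_family C" unfolding disjoint_family_on_def using Cd by (metis Int_commute neqE)
  then have "(\<lambda>i. L0_norm M (\<mu> (C i))) \<longlonglongrightarrow> 0" using C by (intro mu_disjoint_tendsto_0)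
  moreover have "\<epsilon> / 2 \<le> L0_norm M (\<mu> (C i))" for i using h(2) by (simp add: C_def)
  ultimately have "\<epsilon> / 2 \<le> 0" by (intro LIMSEQ_le_const) auto
  then show False using \<epsilon> by simp
qed


end

text \<open>One step of a gliding hump. The difference of two measures \<open>\<nu> n\<close> and \<open>\<nu> n'\<close> is large on a set
  \<open>F\<close>, small on the set \<open>H\<close> used so far, since the sequence converges there, and small on all
  subsets of the later set \<open>E N'\<close>, from which all further choices will be made.\<close>

lemma (in prob_space) nikodym_gliding_hump:
  fixes \<nu> :: "nat \<Rightarrow> 'x set \<Rightarrow> 'a \<Rightarrow> real" and \<nu>' :: "'x set \<Rightarrow> 'a \<Rightarrow> real"
  assumes sm: "\<And>n. stochastic_measure M X (\<nu> n)"
    and lim: "\<And>A. A \<in> sets X \<Longrightarrow> (\<lambda>n. L0_norm M (\<lambda>\<omega>. \<nu> n A \<omega> - \<nu>' A \<omega>)) \<longlonglongrightarrow> 0"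
    and \<nu>': "\<And>A. A \<in> sets X \<Longrightarrow> \<nu>' A \<in> borel_measurable M"
    and E: "\<And>i::nat. E i \<in> sets X" "decseq E" "(\<Inter>i. E i) = {}"
    and \<epsilon>: "0 < \<epsilon>" and big: "\<And>N. \<exists>n\<ge>N. 8 * \<epsilon> \<le> L0_norm M (\<nu>' (E n))"
    and H: "H \<in> sets X"
  shows "\<exists>n n' N' F. k \<le> n \<and> k \<le> n' \<and> N \<le> N' \<and> F \<in> sets X \<and> F \<subseteq> E N \<and> F \<inter> E N' = {}
    \<and> (\<forall>B\<in>sets X. B \<subseteq> E N' \<longrightarrow> L0_norm M (\<nu> n B) \<le> \<epsilon> \<and> L0_norm M (\<nu> n' B) \<le> \<epsilon>)
    \<and> L0_norm M (\<lambda>\<omega>. \<nu> n' H \<omega> - \<nu> n H \<omega>) \<le> \<epsilon>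
    \<and> 5 * \<epsilon> \<le> L0_norm M (\<lambda>\<omega>. \<nu> n' F \<omega> - \<nu> n F \<omega>)"
proof -
  have sm': "stochastic_meas M X (\<nu> n)" for n by unfold_locales (rule sm)
  have m: "\<nu> n A \<in> borel_measurable M" if "A \<in> sets X" for n A using sm that by (simp add: stochastic_measure_def)
  have close: "\<exists>n\<ge>k. \<forall>j\<ge>n. L0_norm M (\<lambda>\<omega>. \<nu> j A \<omega> - \<nu>' A \<omega>) \<le> \<delta>" if "A \<in> sets X" "0 < \<delta>" for A \<delta> and k :: nat
  proof -
    have "\<forall>\<^sub>F n in sequentially. L0_norm M (\<lambda>\<omega>. \<nu> n A \<omega> - \<nu>' A \<omega>) < \<delta>"
      using that by (intro order_tendstoD(2)[OF lim]) auto
    then obtain n0 where n0: "\<forall>n\<ge>n0. L0_norm M (\<lambda>\<omega>. \<nu> n A \<omega> - \<nu>' A \<omega>) < \<delta>"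
      unfolding eventually_sequentially by blast
    show ?thesis using n0 by (intro exI[of _ "max n0 k"]) (auto intro: less_imp_le)
  qed
  have sub: "i \<le> j \<Longrightarrow> E j \<subseteq> E i" for i j using E(2) by (auto simp: decseq_def)
  obtain n where n: "k \<le> n" "\<And>j. j \<ge> n \<Longrightarrow> L0_norm M (\<lambda>\<omega>. \<nu> j H \<omega> - \<nu>' H \<omega>) \<le> \<epsilon> / 2"
    using close[OF H, of "\<epsilon> / 2" k] \<epsilon> by auto
  obtain N0 where N0: "\<forall>B\<in>sets X. B \<subseteq> E N0 \<longrightarrow> L0_norm M (\<nu> n B) \<le> \<epsilon>"
    using stochastic_meas.mu_uniformly_small[OF sm' E \<epsilon>] by blast
  obtain N1 where N1: "max N N0 \<le> N1" "8 * \<epsilon> \<le> L0_norm M (\<nu>' (E N1))" using big by blast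
  obtain n' where n': "n \<le> n'" "L0_norm M (\<lambda>\<omega>. \<nu> n' (E N1) \<omega> - \<nu>' (E N1) \<omega>) \<le> \<epsilon>"
    using close[OF E(1)[of N1] \<epsilon>, of n] by blast
  obtain N2 where N2: "\<forall>B\<in>sets X. B \<subseteq> E N2 \<longrightarrow> L0_norm M (\<nu> n' B) \<le> \<epsilon>"
    using stochastic_meas.mu_uniformly_small[OF sm' E \<epsilon>] by blast
  define N' where "N' = max N1 N2"
  define F where "F = E N1 - E N'"
  have EN': "E N' \<subseteq> E N1" "E N' \<subseteq> E N2" "E N1 \<subseteq> E N" "E N1 \<subseteq> E N0"
    using N1 by (auto simp: N'_def intro!: sub)
  have F: "F \<in> sets X" using E(1) by (auto simp: F_def)
  have small: "L0_norm M (\<nu> n B) \<le> \<epsilon> \<and> L0_norm M (\<nu> n' B) \<le> \<epsilon>" if "B \<in> sets X" "B \<subseteq> E N'" for B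
  proof -
    have "B \<subseteq> E N0" "B \<subseteq> E N2" using that(2) EN' by auto
    then show ?thesis using N0[rule_format, OF that(1)] N2[rule_format, OF that(1)] by simp
  qed
  have H': "L0_norm M (\<lambda>\<omega>. \<nu> n' H \<omega> - \<nu> n H \<omega>) \<le> \<epsilon>"
  proof -
    have "L0_norm M (\<lambda>\<omega>. (\<nu> n' H \<omega> - \<nu>' H \<omega>) - (\<nu> n H \<omega> - \<nu>' H \<omega>)) \<le> \<epsilon> / 2 + \<epsilon> / 2"
      by (rule order_trans[OF L0_norm_diff add_mono]) (use n n'(1) m[OF H] \<nu>'[OF H] in auto)
    then show ?thesis by simp
  qed
  have "8 * \<epsilon> \<le> L0_norm M (\<nu>' (E N1))" by (rule N1)
  also have "\<nu>' (E N1) = (\<lambda>\<omega>. \<nu> n' (E N1) \<omega> - (\<nu> n' (E N1) \<omega> - \<nu>' (E N1) \<omega>))" by simp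
  also have "L0_norm M \<dots> \<le> L0_norm M (\<nu> n' (E N1)) + L0_norm M (\<lambda>\<omega>. \<nu> n' (E N1) \<omega> - \<nu>' (E N1) \<omega>)"
    using m[OF E(1)] \<nu>'[OF E(1)] by (intro L0_norm_diff) auto
  finally have a1: "7 * \<epsilon> \<le> L0_norm M (\<nu> n' (E N1))" using n'(2) by linarith
  have "L0_norm M (\<nu> n' (E N1)) = L0_norm M (\<lambda>\<omega>. \<nu> n' F \<omega> + \<nu> n' (E N') \<omega>)"
  proof (rule L0_norm_cong_AE)
    have "AE \<omega> in M. \<nu> n' F \<omega> = \<nu> n' (E N1) \<omega> - \<nu> n' (E N') \<omega>"
      unfolding F_def using E(1) EN' by (intro stochastic_meas.mu_diff[OF sm']) auto
    then show "AE \<omega> in M. \<nu> n' (E N1) \<omega> = \<nu> n' F \<omega> + \<nu> n' (E N') \<omega>" by eventually_elim simp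
  qed (use m E(1) F in \<open>auto intro!: borel_measurable_add\<close>)
  also have "\<dots> \<le> L0_norm M (\<nu> n' F) + L0_norm M (\<nu> n' (E N'))" by (intro L0_norm_triangle m E(1) F)
  finally have a2: "6 * \<epsilon> \<le> L0_norm M (\<nu> n' F)" using a1 small[OF E(1)[of N'] order_refl] by linarith
  have a3: "L0_norm M (\<nu> n F) \<le> \<epsilon>" using N0 F EN' by (auto simp: F_def)
  have "\<nu> n' F = (\<lambda>\<omega>. (\<nu> n' F \<omega> - \<nu> n F \<omega>) + \<nu> n F \<omega>)" by simp
  then have "L0_norm M (\<nu> n' F) = L0_norm M (\<lambda>\<omega>. (\<nu> n' F \<omega> - \<nu> n F \<omega>) + \<nu> n F \<omega>)" by (rule arg_cong)
  also have "\<dots> \<le> L0_norm M (\<lambda>\<omega>. \<nu> n' F \<omega> - \<nu> n F \<omega>) + L0_norm M (\<nu> n F)"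
    using m[OF F] by (intro L0_norm_triangle) auto
  finally have a4: "5 * \<epsilon> \<le> L0_norm M (\<lambda>\<omega>. \<nu> n' F \<omega> - \<nu> n F \<omega>)" using a2 a3 by linarith
  have "k \<le> n'" "N \<le> N'" "F \<subseteq> E N" "F \<inter> E N' = {}" using n n'(1) N1(1) EN' by (auto simp: N'_def F_def)
  then show ?thesis using n(1) F small H' a4 by (intro exI[of _ n] exI[of _ n'] exI[of _ N'] exI[of _ F] conjI ballI impI) auto
qed

text \<open>On the union of all humps the differences \<open>\<nu> (n' k) - \<nu> (n k)\<close> would stay away from 0, although
  the sequence converges there.\<close>

lemma (in prob_space) nikodym_convergence:
  fixes \<nu> :: "nat \<Rightarrow> 'x set \<Rightarrow> 'a \<Rightarrow> real" and \<nu>' :: "'x set \<Rightarrow> 'a \<Rightarrow> real"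
  assumes sm: "\<And>n. stochastic_measure M X (\<nu> n)"
    and lim: "\<And>A. A \<in> sets X \<Longrightarrow> (\<lambda>n. L0_norm M (\<lambda>\<omega>. \<nu> n A \<omega> - \<nu>' A \<omega>)) \<longlonglongrightarrow> 0"
    and \<nu>': "\<And>A. A \<in> sets X \<Longrightarrow> \<nu>' A \<in> borel_measurable M"
    and E: "\<And>i::nat. E i \<in> sets X" "decseq E" "(\<Inter>i. E i) = {}"
  shows "(\<lambda>n. L0_norm M (\<nu>' (E n))) \<longlonglongrightarrow> 0"
proof (rule ccontr)
  assume "\<not> ?thesis"
  then obtain r where r: "0 < r" "\<And>N. \<exists>n\<ge>N. r \<le> L0_norm M (\<nu>' (E n))"
    unfolding LIMSEQ_def using L0_norm_nonneg by (force simp: not_less dist_real_def)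
  define \<epsilon> where "\<epsilon> = r / 8"
  have \<epsilon>: "0 < \<epsilon>" and big: "\<exists>n\<ge>N. 8 * \<epsilon> \<le> L0_norm M (\<nu>' (E n))" for N using r by (auto simp: \<epsilon>_def)
  have sm': "stochastic_meas M X (\<nu> n)" for n by unfold_locales (rule sm)
  have m: "\<nu> n A \<in> borel_measurable M" if "A \<in> sets X" for n A using sm that by (simp add: stochastic_measure_def)
  have sub: "i \<le> j \<Longrightarrow> E j \<subseteq> E i" for i j using E(2) by (auto simp: decseq_def)
  define good where "good k n n' N N' H F \<longleftrightarrow> k \<le> n \<and> k \<le> n' \<and> N \<le> N' \<and> F \<in> sets X \<and> F \<subseteq> E N \<and> F \<inter> E N' = {}
    \<and> (\<forall>B\<in>sets X. B \<subseteq> E N' \<longrightarrow> L0_norm M (\<nu> n B) \<le> \<epsilon> \<and> L0_norm M (\<nu> n' B) \<le> \<epsilon>)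
    \<and> L0_norm M (\<lambda>\<omega>. \<nu> n' H \<omega> - \<nu> n H \<omega>) \<le> \<epsilon>
    \<and> 5 * \<epsilon> \<le> L0_norm M (\<lambda>\<omega>. \<nu> n' F \<omega> - \<nu> n F \<omega>)" for k n n' N N' :: nat and H F
  have step: "\<exists>n n' N' F. good k n n' N N' H F" if "H \<in> sets X" for k N H
    unfolding good_def by (rule nikodym_gliding_hump[OF sm lim \<nu>' E \<epsilon> big that])
  have "\<exists>f. \<forall>k. (snd (f k) \<in> sets X \<and> snd (f k) \<inter> E (fst (f k)) = {}) \<and>
      (\<exists>n n' F. good k n n' (fst (f k)) (fst (f (Suc k))) (snd (f k)) F \<and> snd (f (Suc k)) = snd (f k) \<union> F)"
  proof (rule dependent_nat_choice)
    show "\<exists>s :: nat \<times> 'x set. snd s \<in> sets X \<and> snd s \<inter> E (fst s) = {}" by (intro exI[of _ "(0, {})"]) simp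
  next
    fix s :: "nat \<times> 'x set" and k assume s: "snd s \<in> sets X \<and> snd s \<inter> E (fst s) = {}"
    obtain n n' N' F where g: "good k n n' (fst s) N' (snd s) F" using step[of "snd s"] s by blast
    then have F: "F \<in> sets X" "F \<inter> E N' = {}" "fst s \<le> N'" by (simp_all add: good_def)
    then have "(snd s \<union> F) \<inter> E N' = {}" using sub[of "fst s" N'] s by blast
    then show "\<exists>s'. (snd s' \<in> sets X \<and> snd s' \<inter> E (fst s') = {}) \<and>
      (\<exists>n n' F. good k n n' (fst s) (fst s') (snd s) F \<and> snd s' = snd s \<union> F)"
      using g s F by (intro exI[of _ "(N', snd s \<union> F)"]) auto
  qed
  then obtain f where f: "\<And>k. snd (f k) \<in> sets X" "\<And>k. snd (f k) \<inter> E (fst (f k)) = {}"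
    "\<And>k. \<exists>n n' F. good k n n' (fst (f k)) (fst (f (Suc k))) (snd (f k)) F \<and> snd (f (Suc k)) = snd (f k) \<union> F"
    by blast
  define N where "N k = fst (f k)" for k
  define H where "H k = snd (f k)" for k
  have "\<forall>k. \<exists>n n' F. good k n n' (N k) (N (Suc k)) (H k) F \<and> H (Suc k) = H k \<union> F"
    using f(3) unfolding N_def H_def by blast
  then obtain n n' F where g: "\<And>k. good k (n k) (n' k) (N k) (N (Suc k)) (H k) (F k)" and HS: "\<And>k. H (Suc k) = H k \<union> F k"
    by metis
  note g' = g[unfolded good_def]
  have Hs: "H k \<in> sets X" for k using f(1) by (simp add: H_def)
  have Fs: "F k \<in> sets X" for k using g' by blast
  have Nmono: "i \<le> j \<Longrightarrow> N i \<le> N j" for i j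
    by (rule lift_Suc_mono_le[of N]) (use g' in auto)
  have HE: "H k \<inter> E (N k) = {}" for k using f(2) by (simp add: H_def N_def)
  define A where "A = (\<Union>k. H k)"
  have As: "A \<in> sets X" using Hs by (auto simp: A_def)
  have tailH: "H (i + j) - H i \<subseteq> E (N i)" for i j
  proof (induction j)
    case (Suc j)
    have "F (i + j) \<subseteq> E (N (i + j))" using g' by blast
    also have "\<dots> \<subseteq> E (N i)" by (intro sub Nmono) auto
    finally show ?case using Suc by (auto simp: HS)
  qed simp
  \<comment> \<open>all humps from the index \<open>i\<close> on lie in \<open>E (N i)\<close>\<close>
  have tailA: "A - H i \<subseteq> E (N i)" for i
  proof
    fix x assume x: "x \<in> A - H i"
    then obtain j where "x \<in> H j" by (auto simp: A_def)
    moreover have "H j \<subseteq> H (i + j)" by (rule lift_Suc_mono_le[of H]) (auto simp: HS)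
    ultimately show "x \<in> E (N i)" using tailH[of i j] x by blast
  qed
  have large: "2 * \<epsilon> \<le> L0_norm M (\<lambda>\<omega>. \<nu> (n' k) A \<omega> - \<nu> (n k) A \<omega>)" for k
  proof -
    define T where "T = A - H (Suc k)"
    have Ts: "T \<in> sets X" using As Hs by (auto simp: T_def)
    have T_small: "L0_norm M (\<nu> (n k) T) \<le> \<epsilon>" "L0_norm M (\<nu> (n' k) T) \<le> \<epsilon>"
      using g'[of k] Ts tailA[of "Suc k"] by (auto simp: T_def)
    have HF: "H k \<inter> F k = {}" using HE[of k] g'[of k] by blast
    have HA: "H (Suc k) \<subseteq> A" by (auto simp: A_def)
    have split: "AE \<omega> in M. \<nu> l (F k) \<omega> = \<nu> l A \<omega> - (\<nu> l (H k) \<omega> + \<nu> l T \<omega>)" for l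
    proof -
      have "AE \<omega> in M. \<nu> l T \<omega> = \<nu> l A \<omega> - \<nu> l (H (Suc k)) \<omega>"
        unfolding T_def by (rule stochastic_meas.mu_diff[OF sm' As Hs HA])
      moreover have "AE \<omega> in M. \<nu> l (H (Suc k)) \<omega> = \<nu> l (H k) \<omega> + \<nu> l (F k) \<omega>"
        unfolding HS by (rule stochastic_meas.mu_union[OF sm' Hs Fs HF])
      ultimately show ?thesis by eventually_elim simp
    qed
    let ?D = "\<lambda>B \<omega>. \<nu> (n' k) B \<omega> - \<nu> (n k) B \<omega>"
    have D: "?D B \<in> borel_measurable M" if "B \<in> sets X" for B using m[OF that] by (intro borel_measurable_diff)
    have "5 * \<epsilon> \<le> L0_norm M (?D (F k))" using g'[of k] by blast
    also have "\<dots> = L0_norm M (\<lambda>\<omega>. ?D A \<omega> - (?D (H k) \<omega> + ?D T \<omega>))"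
    proof (rule L0_norm_cong_AE)
      show "AE \<omega> in M. ?D (F k) \<omega> = ?D A \<omega> - (?D (H k) \<omega> + ?D T \<omega>)"
        using split[of "n' k"] split[of "n k"] by eventually_elim simp
    qed (intro D Fs borel_measurable_diff[of "?D A"] borel_measurable_add[of "?D (H k)"] As Hs Ts)+
    also have "\<dots> \<le> L0_norm M (?D A) + L0_norm M (\<lambda>\<omega>. ?D (H k) \<omega> + ?D T \<omega>)"
      by (intro L0_norm_diff D borel_measurable_add[of "?D (H k)"] As Hs Ts)
    also have "L0_norm M (\<lambda>\<omega>. ?D (H k) \<omega> + ?D T \<omega>) \<le> L0_norm M (?D (H k)) + L0_norm M (?D T)"
      by (intro L0_norm_triangle D Hs Ts)
    also have "L0_norm M (?D T) \<le> L0_norm M (\<nu> (n' k) T) + L0_norm M (\<nu> (n k) T)"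
      by (intro L0_norm_diff m Ts)
    finally have "5 * \<epsilon> \<le> L0_norm M (?D A) + (L0_norm M (?D (H k)) + (L0_norm M (\<nu> (n' k) T) + L0_norm M (\<nu> (n k) T)))"
      by simp
    moreover have "L0_norm M (?D (H k)) \<le> \<epsilon>" using g'[of k] by blast
    ultimately show ?thesis using T_small by linarith
  qed
  have conv: "(\<lambda>k. L0_norm M (\<lambda>\<omega>. \<nu> (h k) A \<omega> - \<nu>' A \<omega>)) \<longlonglongrightarrow> 0" if "\<And>k. k \<le> h k" for h
  proof -
    have "filterlim h sequentially sequentially"
      by (rule filterlim_at_top_mono[OF filterlim_ident]) (use that in auto)
    then show ?thesis by (rule filterlim_compose[OF lim[OF As]])
  qed
  have "(\<lambda>k. L0_norm M (\<lambda>\<omega>. \<nu> (n' k) A \<omega> - \<nu>' A \<omega>) + L0_norm M (\<lambda>\<omega>. \<nu> (n k) A \<omega> - \<nu>' A \<omega>)) \<longlonglongrightarrow> 0 + 0"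
    using g' by (intro tendsto_add conv) auto
  moreover have "2 * \<epsilon> \<le> L0_norm M (\<lambda>\<omega>. \<nu> (n' k) A \<omega> - \<nu>' A \<omega>) + L0_norm M (\<lambda>\<omega>. \<nu> (n k) A \<omega> - \<nu>' A \<omega>)" for k
  proof -
    have "L0_norm M (\<lambda>\<omega>. (\<nu> (n' k) A \<omega> - \<nu>' A \<omega>) - (\<nu> (n k) A \<omega> - \<nu>' A \<omega>))
      \<le> L0_norm M (\<lambda>\<omega>. \<nu> (n' k) A \<omega> - \<nu>' A \<omega>) + L0_norm M (\<lambda>\<omega>. \<nu> (n k) A \<omega> - \<nu>' A \<omega>)"
      using m[OF As] \<nu>'[OF As] by (intro L0_norm_diff) auto
    then show ?thesis using large[of k] by simp
  qed
  ultimately have "2 * \<epsilon> \<le> 0 + 0" by (intro LIMSEQ_le_const) auto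
  then show False using \<epsilon> by simp
qed


context stochastic_meas
begin

text \<open>Off the set \<open>E N\<close> the approximating functions are bounded by \<open>C + 1\<close> from the index \<open>N\<close> on, so
  that the bound for simple functions applies; on \<open>E N\<close> the limit is small for large \<open>N\<close> by the
  Nikodym convergence theorem.\<close>

lemma integral_limit_bounded:
  assumes t: "\<And>f A C. simple_function X f \<Longrightarrow> A \<in> sets X \<Longrightarrow> 0 < C \<Longrightarrow> (\<forall>x\<in>A. \<bar>f x\<bar> \<le> C) \<Longrightarrow> tail_prob M (sint A f) (C * t) \<le> \<eta>"
    and \<eta>: "0 < \<eta>"
    and gs: "\<And>n. simple_function X (gs n)" "\<And>x. x \<in> space X \<Longrightarrow> (\<lambda>n. gs n x) \<longlonglongrightarrow> g x"
    and g: "\<And>x. x \<in> space X \<Longrightarrow> \<bar>g x\<bar> \<le> C" and C: "0 \<le> C"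
    and \<nu>: "\<And>A. A \<in> sets X \<Longrightarrow> \<nu> A \<in> borel_measurable M"
      "\<And>A. A \<in> sets X \<Longrightarrow> conv_in_prob M (\<lambda>n. sint A (gs n)) (\<nu> A)"
    and A: "A \<in> sets X"
  shows "tail_prob M (\<nu> A) ((C + 1) * t + 2) \<le> 3 * \<eta>"
proof -
  have sm': "stochastic_measure M X (\<lambda>A. sint A (gs n))" for n using gs(1) by (rule sint_stochastic_measure)
  have m: "sint A (gs n) \<in> borel_measurable M" if "A \<in> sets X" for A n using that gs(1) by (rule sint_measurable)
  have [measurable]: "gs n \<in> borel_measurable X" for n using gs(1) by (rule borel_measurable_simple_function)
  define E where "E N = {x \<in> space X. \<exists>n\<ge>N. C + 1 < \<bar>gs n x\<bar>}" for N
  have Es: "E N \<in> sets X" for N unfolding E_def by measurable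
  have Edec: "decseq E" unfolding decseq_def E_def by (auto intro: order_trans)
  have E0: "(\<Inter>N. E N) = {}"
  proof -
    have "x \<notin> (\<Inter>N. E N)" for x
    proof
      assume *: "x \<in> (\<Inter>N. E N)"
      then have x: "x \<in> space X" by (auto simp: E_def)
      have "(\<lambda>n. \<bar>gs n x\<bar>) \<longlonglongrightarrow> \<bar>g x\<bar>" using gs(2)[OF x] by (rule tendsto_rabs)
      moreover have "\<bar>g x\<bar> < C + 1" using g[OF x] by simp
      ultimately have "\<forall>\<^sub>F n in sequentially. \<bar>gs n x\<bar> < C + 1" by (rule order_tendstoD)
      then obtain N where N: "\<forall>n\<ge>N. \<bar>gs n x\<bar> < C + 1" unfolding eventually_sequentially by blast
      have "x \<in> E N" using * by blast
      then show False using N by (auto simp: E_def dest: less_asym)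
    qed
    then show ?thesis by blast
  qed
  have lim: "(\<lambda>n. L0_norm M (\<lambda>\<omega>. sint B (gs n) \<omega> - \<nu> B \<omega>)) \<longlonglongrightarrow> 0" if "B \<in> sets X" for B
    using \<nu>(2)[OF that] by (subst (asm) conv_in_prob_iff) (use m \<nu>(1) that in auto)
  have tail1: "tail_prob M Y 1 \<le> L0_norm M Y" if "Y \<in> borel_measurable M" for Y
    using tail_le_L0_norm[OF that, of 1] by simp
  have AEs: "A \<inter> E N \<in> sets X" "A - A \<inter> E N \<in> sets X" for N using A Es by auto
  have "(\<lambda>N. L0_norm M (\<nu> (A \<inter> E N))) \<longlonglongrightarrow> 0"
  proof (rule nikodym_convergence[OF sm' lim \<nu>(1)])
    show "A \<inter> E N \<in> sets X" for N by (rule AEs)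
    show "decseq (\<lambda>N. A \<inter> E N)" using Edec by (auto simp: decseq_def)
    show "(\<Inter>N. A \<inter> E N) = {}" using E0 by blast
  qed
  then have "\<forall>\<^sub>F N in sequentially. L0_norm M (\<nu> (A \<inter> E N)) < \<eta>" using \<eta> by (intro order_tendstoD) auto
  then obtain N where "L0_norm M (\<nu> (A \<inter> E N)) < \<eta>" unfolding eventually_sequentially by blast
  then have p1: "tail_prob M (\<nu> (A \<inter> E N)) 1 \<le> \<eta>" using tail1[OF \<nu>(1)[OF AEs(1)[of N]]] by simp
  let ?B = "A - A \<inter> E N"
  have "\<forall>\<^sub>F n in sequentially. L0_norm M (\<lambda>\<omega>. sint ?B (gs n) \<omega> - \<nu> ?B \<omega>) < \<eta>"
    using \<eta> by (intro order_tendstoD(2)[OF lim] AEs)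
  then obtain n0 where n0: "\<forall>n\<ge>n0. L0_norm M (\<lambda>\<omega>. sint ?B (gs n) \<omega> - \<nu> ?B \<omega>) < \<eta>"
    unfolding eventually_sequentially by blast
  define n where "n = max n0 N"
  have n: "L0_norm M (\<lambda>\<omega>. sint ?B (gs n) \<omega> - \<nu> ?B \<omega>) < \<eta>" "N \<le> n" using n0 by (auto simp: n_def)
  have mB: "sint ?B (gs n) \<in> borel_measurable M" "\<nu> ?B \<in> borel_measurable M" "\<nu> (A \<inter> E N) \<in> borel_measurable M" "\<nu> A \<in> borel_measurable M"
    using AEs A by (auto intro: m \<nu>(1))
  have mD: "(\<lambda>\<omega>. sint ?B (gs n) \<omega> - \<nu> ?B \<omega>) \<in> borel_measurable M" using mB by auto
  have p2: "tail_prob M (\<lambda>\<omega>. sint ?B (gs n) \<omega> - \<nu> ?B \<omega>) 1 \<le> \<eta>" using tail1[OF mD] n(1) by simp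
  have p2': "tail_prob M (\<lambda>\<omega>. - (sint ?B (gs n) \<omega> - \<nu> ?B \<omega>)) 1 \<le> \<eta>" using p2 by (simp add: abs_minus_commute)
  have p3: "tail_prob M (sint ?B (gs n)) ((C + 1) * t) \<le> \<eta>"
  proof (rule t[OF gs(1) AEs(2)])
    show "\<forall>x\<in>?B. \<bar>gs n x\<bar> \<le> C + 1"
    proof
      fix x assume x: "x \<in> ?B"
      then have "x \<in> space X" using sets.sets_into_space[OF A] by blast
      then show "\<bar>gs n x\<bar> \<le> C + 1" using x n(2) by (auto simp: E_def not_less)
    qed
  qed (use C in simp)
  have "AE \<omega> in M. \<nu> A \<omega> = \<nu> (A \<inter> E N) \<omega> + \<nu> ?B \<omega>"
  proof (rule conv_in_prob_unique[of "\<lambda>n. sint A (gs n)"])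
    show "conv_in_prob M (\<lambda>n. sint A (gs n)) (\<nu> A)" using A by (rule \<nu>(2))
    show "conv_in_prob M (\<lambda>n. sint A (gs n)) (\<lambda>\<omega>. \<nu> (A \<inter> E N) \<omega> + \<nu> ?B \<omega>)"
    proof (rule conv_in_prob_cong_AE)
      show "conv_in_prob M (\<lambda>n \<omega>. sint (A \<inter> E N) (gs n) \<omega> + sint ?B (gs n) \<omega>) (\<lambda>\<omega>. \<nu> (A \<inter> E N) \<omega> + \<nu> ?B \<omega>)"
        by (intro conv_in_prob_add m \<nu> AEs)
      fix n
      have "AE \<omega> in M. sint ?B (gs n) \<omega> = sint A (gs n) \<omega> - sint (A \<inter> E N) (gs n) \<omega>"
        using sm' A AEs(1) by (intro stochastic_meas.mu_diff[of M X "\<lambda>A. sint A (gs n)"]) (auto intro!: stochastic_meas.intro stochastic_meas_axioms.intro prob_space_axioms)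
      then show "AE \<omega> in M. sint (A \<inter> E N) (gs n) \<omega> + sint ?B (gs n) \<omega> = sint A (gs n) \<omega>"
        by eventually_elim simp
    qed (use m AEs A mB in \<open>auto intro!: borel_measurable_add\<close>)
  qed (use m A mB in \<open>auto intro!: borel_measurable_add\<close>)
  then have "tail_prob M (\<nu> A) ((C + 1) * t + 2)
      = tail_prob M (\<lambda>\<omega>. (\<nu> (A \<inter> E N) \<omega> + - (sint ?B (gs n) \<omega> - \<nu> ?B \<omega>)) + sint ?B (gs n) \<omega>) ((1 + 1) + (C + 1) * t)"
    by (subst tail_cong_AE[of "\<nu> A" "\<lambda>\<omega>. \<nu> (A \<inter> E N) \<omega> + \<nu> ?B \<omega>"]) (use mB in \<open>auto simp: algebra_simps\<close>)
  also have "\<dots> \<le> tail_prob M (\<lambda>\<omega>. \<nu> (A \<inter> E N) \<omega> + - (sint ?B (gs n) \<omega> - \<nu> ?B \<omega>)) (1 + 1) + tail_prob M (sint ?B (gs n)) ((C + 1) * t)"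
    using mB by (intro tail_add) auto
  also have "tail_prob M (\<lambda>\<omega>. \<nu> (A \<inter> E N) \<omega> + - (sint ?B (gs n) \<omega> - \<nu> ?B \<omega>)) (1 + 1)
      \<le> tail_prob M (\<nu> (A \<inter> E N)) 1 + tail_prob M (\<lambda>\<omega>. - (sint ?B (gs n) \<omega> - \<nu> ?B \<omega>)) 1"
    using mB by (intro tail_add) auto
  finally show ?thesis using p1 p2' p3 by linarith
qed

end

section \<open>Almost everywhere convergence of orthogonal series\<close>

lemma cos_has_integral_period:
  assumes "m \<noteq> (0::int)"
  shows "((\<lambda>t. cos (of_int m * t)) has_integral 0) {0..2*pi}"
proof -
  have "((\<lambda>t. cos (of_int m * t)) has_integral (sin (of_int m * (2*pi)) / of_int m - sin (of_int m * 0) / of_int m)) {0..2*pi}"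
    by (rule fundamental_theorem_of_calculus)
       (use assms in \<open>auto intro!: derivative_eq_intros simp: has_real_derivative_iff_has_vector_derivative[symmetric]\<close>)
  moreover have "sin (of_int m * (2*pi)) = 0" by (simp add: sin_zero_iff_int2) (metis mult.commute of_int_mult of_int_numeral mult.left_commute)
  ultimately show ?thesis by simp
qed

lemma cos_orthogonal:
  assumes "1 \<le> k" "1 \<le> l"
  shows "((\<lambda>t. cos (real k * t) * cos (real l * t)) has_integral (if k = l then pi else 0)) {0..2*pi}"
    and "((\<lambda>t. sin (real k * t) * sin (real l * t)) has_integral (if k = l then pi else 0)) {0..2*pi}"
proof -
  have plus: "((\<lambda>t. cos (of_int (int k + int l) * t)) has_integral 0) {0..2*pi}"
    using assms by (intro cos_has_integral_period) auto
  have minus: "((\<lambda>t. cos (of_int (int k - int l) * t)) has_integral (if k = l then 2 * pi else 0)) {0..2*pi}"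
  proof (cases "k = l")
    case True
    then show ?thesis using has_integral_const_real[of "1::real" 0 "2 * pi"] by simp
  next
    case False
    then show ?thesis using cos_has_integral_period[of "int k - int l"] by simp
  qed
  have arg: "of_int (int k - int l) * t = real k * t - real l * t" "of_int (int k + int l) * t = real k * t + real l * t" for t :: real
    by (simp_all add: algebra_simps)
  have c: "cos (real k * t) * cos (real l * t) = (1/2) * (cos (of_int (int k - int l) * t) + cos (of_int (int k + int l) * t))" for t
    unfolding arg by (simp add: cos_times_cos)
  have s: "sin (real k * t) * sin (real l * t) = (1/2) * (cos (of_int (int k - int l) * t) - cos (of_int (int k + int l) * t))" for t
    unfolding arg by (simp add: sin_times_sin)
  show "((\<lambda>t. cos (real k * t) * cos (real l * t)) has_integral (if k = l then pi else 0)) {0..2*pi}"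
    unfolding c using has_integral_mult_right[OF has_integral_add[OF minus plus], of "1/2"] by (simp split: if_splits)
  show "((\<lambda>t. sin (real k * t) * sin (real l * t)) has_integral (if k = l then pi else 0)) {0..2*pi}"
    unfolding s using has_integral_mult_right[OF has_integral_diff[OF minus plus], of "1/2"] by (simp split: if_splits)
qed

lemma orthogonal_sum_square:
  fixes e :: "nat \<Rightarrow> real \<Rightarrow> real"
  assumes orth: "\<And>k l. k \<in> B \<Longrightarrow> l \<in> B \<Longrightarrow> ((\<lambda>t. e k t * e l t) has_integral (if k = l then \<kappa> else 0)) D"
    and fin: "finite B"
  shows "((\<lambda>t. (\<Sum>k\<in>B. c k * e k t)\<^sup>2) has_integral (\<kappa> * (\<Sum>k\<in>B. (c k)\<^sup>2))) D"
proof -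
  have "((\<lambda>t. \<Sum>k\<in>B. \<Sum>l\<in>B. (c k * c l) * (e k t * e l t)) has_integral (\<Sum>k\<in>B. \<Sum>l\<in>B. (c k * c l) * (if k = l then \<kappa> else 0))) D"
    by (intro has_integral_sum fin has_integral_mult_right orth)
  moreover have "(\<Sum>k\<in>B. c k * e k t)\<^sup>2 = (\<Sum>k\<in>B. \<Sum>l\<in>B. (c k * c l) * (e k t * e l t))" for t
    by (simp add: power2_eq_square sum_product algebra_simps)
  moreover have "(\<Sum>k\<in>B. \<Sum>l\<in>B. (c k * c l) * (if k = l then \<kappa> else 0)) = \<kappa> * (\<Sum>k\<in>B. (c k)\<^sup>2)"
    using fin by (simp add: if_distrib sum.delta power2_eq_square sum_distrib_left algebra_simps cong: if_cong)
  ultimately show ?thesis by simp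
qed

lemma sum_square_blocks:
  fixes h :: "nat \<Rightarrow> real"
  shows "(\<Sum>k=1..J\<^sup>2. h k) = (\<Sum>j<J. \<Sum>k\<in>{j\<^sup>2<..(Suc j)\<^sup>2}. h k)"
proof (induction J)
  case (Suc J)
  have le: "J\<^sup>2 \<le> (Suc J)\<^sup>2" by (intro power_mono) auto
  have "{1..(Suc J)\<^sup>2} = {1..J\<^sup>2} \<union> {J\<^sup>2<..(Suc J)\<^sup>2}" by (auto intro: order_trans[OF _ le])
  then have "(\<Sum>k=1..(Suc J)\<^sup>2. h k) = (\<Sum>k=1..J\<^sup>2. h k) + (\<Sum>k\<in>{J\<^sup>2<..(Suc J)\<^sup>2}. h k)"
    by (simp only:) (rule sum.union_disjoint; auto)
  then show ?case using Suc by simp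
qed simp

text \<open>The terms are grouped into the blocks between consecutive squares. With the weights \<open>w j\<close> the
  squares of the block sums are summable almost everywhere, and since the \<open>1 / w j\<close> are summable
  too, the block sums are absolutely summable. A block has \<open>2 * j + 1\<close> terms, which the weights
  absorb when the Cauchy-Schwarz inequality is applied to an incomplete block.\<close>

lemma orthogonal_series_converges_AE:
  fixes e :: "nat \<Rightarrow> real \<Rightarrow> real" and c :: "nat \<Rightarrow> real"
  assumes orth: "\<And>k l. 1 \<le> k \<Longrightarrow> 1 \<le> l \<Longrightarrow> ((\<lambda>t. e k t * e l t) has_integral (if k = l then \<kappa> else 0)) D"
    and \<kappa>: "0 \<le> \<kappa>" and e: "\<And>k t. \<bar>e k t\<bar> \<le> 1" and meas: "\<And>k. e k \<in> borel_measurable borel"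
    and D: "D \<in> sets borel"
    and c: "summable (\<lambda>k. real k powr (3/4) * (c k)\<^sup>2)"
  shows "AE t in lborel. t \<in> D \<longrightarrow> convergent (\<lambda>n. \<Sum>k=1..n. c k * e k t)"
proof -
  define B where "B j = {j\<^sup>2<..(Suc j)\<^sup>2}" for j :: nat
  have finB: "finite (B j)" for j by (simp add: B_def)
  have cardB: "card (B j) = 2 * j + 1" for j by (simp add: B_def power2_eq_square)
  have B1: "1 \<le> k" if "k \<in> B j" for j k using that by (auto simp: B_def)
  define w where "w j = real (Suc j) powr (3/2)" for j
  have w1: "1 \<le> w j" for j unfolding w_def by (rule ge_one_powr_ge_zero) auto
  define b where "b j = (\<Sum>k\<in>B j. real k powr (3/4) * (c k)\<^sup>2)" for j
  have b0: "0 \<le> b j" for j unfolding b_def by (intro sum_nonneg) auto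
  have b: "summable b"
  proof (rule summableI_nonneg_bounded[OF b0])
    fix J
    have "(\<Sum>j<J. b j) = (\<Sum>k=1..J\<^sup>2. real k powr (3/4) * (c k)\<^sup>2)"
      unfolding b_def B_def by (rule sum_square_blocks[symmetric])
    also have "\<dots> \<le> (\<Sum>k. real k powr (3/4) * (c k)\<^sup>2)" using c by (intro sum_le_suminf) auto
    finally show "(\<Sum>j<J. b j) \<le> (\<Sum>k. real k powr (3/4) * (c k)\<^sup>2)" .
  qed
  have wb: "w j * (\<Sum>k\<in>B j. (c k)\<^sup>2) \<le> 2 * b j" for j
    unfolding b_def sum_distrib_left
  proof (rule sum_mono)
    fix k assume k: "k \<in> B j"
    have "Suc (j\<^sup>2) \<le> k" using k by (simp add: B_def)
    then have "real (j\<^sup>2) + 1 \<le> real k" by linarith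
    moreover have "0 \<le> (real j - 1)\<^sup>2" by simp
    ultimately have "(real (Suc j))\<^sup>2 \<le> 2 * real k" by (simp add: power2_eq_square algebra_simps)
    then have "((real (Suc j))\<^sup>2) powr (3/4) \<le> (2 * real k) powr (3/4)" by (intro powr_mono2) auto
    also have "((real (Suc j))\<^sup>2) powr (3/4) = w j"
    proof -
      have "(real (Suc j))\<^sup>2 = real (Suc j) powr 2" by (rule powr_numeral[symmetric]) simp
      then have "((real (Suc j))\<^sup>2) powr (3/4) = real (Suc j) powr (2 * (3/4))" by (simp only: powr_powr)
      also have "2 * (3/4) = (3/2 :: real)" by simp
      finally show ?thesis by (simp only: w_def)
    qed
    also have "(2 * real k) powr (3/4) = 2 powr (3/4) * real k powr (3/4)" by (rule powr_mult)
    also have "\<dots> \<le> 2 powr 1 * real k powr (3/4)" by (intro mult_right_mono powr_mono) auto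
    finally have "w j * (c k)\<^sup>2 \<le> 2 * real k powr (3/4) * (c k)\<^sup>2" by (intro mult_right_mono) auto
    then show "w j * (c k)\<^sup>2 \<le> 2 * (real k powr (3/4) * (c k)\<^sup>2)" by simp
  qed
  define inc where "inc j t = (\<Sum>k\<in>B j. c k * e k t)" for j t
  have [measurable]: "inc j \<in> borel_measurable borel" for j
    unfolding inc_def using meas by (intro borel_measurable_sum borel_measurable_times) auto
  have [measurable]: "D \<in> sets borel" by (rule D)
  have nn: "(\<integral>\<^sup>+t. ennreal (indicator D t * (w j * (inc j t)\<^sup>2)) \<partial>lborel) \<le> ennreal (2 * \<kappa> * b j)" for j
  proof -
    have "((\<lambda>t. (inc j t)\<^sup>2) has_integral (\<kappa> * (\<Sum>k\<in>B j. (c k)\<^sup>2))) D"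
      unfolding inc_def by (rule orthogonal_sum_square[OF orth finB]) (use B1 in auto)
    then have "((\<lambda>t. w j * (inc j t)\<^sup>2) has_integral (w j * (\<kappa> * (\<Sum>k\<in>B j. (c k)\<^sup>2)))) D"
      by (rule has_integral_mult_right)
    then have "(\<integral>\<^sup>+t. ennreal (indicator D t * (w j * (inc j t)\<^sup>2)) \<partial>lborel) = ennreal (w j * (\<kappa> * (\<Sum>k\<in>B j. (c k)\<^sup>2)))"
      by (intro nn_integral_has_integral_lebesgue) (use w1[of j] in auto)
    also have "w j * (\<kappa> * (\<Sum>k\<in>B j. (c k)\<^sup>2)) = \<kappa> * (w j * (\<Sum>k\<in>B j. (c k)\<^sup>2))" by simp
    also have "\<dots> \<le> \<kappa> * (2 * b j)" using wb \<kappa> by (intro mult_left_mono)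
    finally show ?thesis by (simp add: ennreal_leI mult.assoc mult.left_commute)
  qed
  have "(\<integral>\<^sup>+t. (\<Sum>j. ennreal (indicator D t * (w j * (inc j t)\<^sup>2))) \<partial>lborel) = (\<Sum>j. \<integral>\<^sup>+t. ennreal (indicator D t * (w j * (inc j t)\<^sup>2)) \<partial>lborel)"
    by (rule nn_integral_suminf) measurable
  also have "\<dots> \<le> (\<Sum>j. ennreal (2 * \<kappa> * b j))" by (intro suminf_le nn) auto
  also have "\<dots> = ennreal (\<Sum>j. 2 * \<kappa> * b j)" using b \<kappa> b0 by (intro suminf_ennreal2 summable_mult) auto
  also have "\<dots> < \<infinity>" by simp
  finally have "(\<integral>\<^sup>+t. (\<Sum>j. ennreal (indicator D t * (w j * (inc j t)\<^sup>2))) \<partial>lborel) \<noteq> \<infinity>" by simp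
  then have "AE t in lborel. (\<Sum>j. ennreal (indicator D t * (w j * (inc j t)\<^sup>2))) \<noteq> \<infinity>"
    by (rule nn_integral_PInf_AE[rotated]) measurable
  then show ?thesis
  proof eventually_elim
    case (elim t)
    show ?case
    proof
      assume t: "t \<in> D"
      have "summable (\<lambda>j. w j * (inc j t)\<^sup>2)"
        using elim t w1 by (intro summable_suminf_not_top) (auto intro!: mult_nonneg_nonneg order_trans[OF zero_le_one w1])
      moreover have "summable (\<lambda>j. 1 / w j)"
      proof -
        have "summable (\<lambda>j. real (Suc j) powr (- (3/2)))"
          by (subst summable_Suc_iff) (simp add: summable_real_powr_iff)
        then show ?thesis by (simp add: w_def powr_minus_divide)
      qed
      ultimately have "summable (\<lambda>j. w j * (inc j t)\<^sup>2 + 1 / w j)" by (rule summable_add)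
      then have "summable (\<lambda>j. inc j t)"
      proof (rule summable_comparison_test'[where N = 0])
        fix j :: nat
        have wp: "0 < w j" using w1[of j] by simp
        have "0 \<le> (w j * \<bar>inc j t\<bar> - 1)\<^sup>2 / w j" using wp by simp
        also have "\<dots> = w j * (inc j t)\<^sup>2 + 1 / w j - 2 * \<bar>inc j t\<bar>"
          using wp by (simp add: power2_diff field_simps power2_eq_square)
        finally show "norm (inc j t) \<le> w j * (inc j t)\<^sup>2 + 1 / w j" by simp
      qed
      then obtain L where L: "(\<lambda>J. \<Sum>j<J. inc j t) \<longlonglongrightarrow> L" by (auto simp: summable_def sums_def)
      define P where "P n = (\<Sum>k=1..n. c k * e k t)" for n
      have PL: "(\<lambda>J. P (J\<^sup>2)) \<longlonglongrightarrow> L"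
        using L unfolding P_def sum_square_blocks inc_def B_def .
      define d where "d j = sqrt (4 * b j)" for j
      have d: "d \<longlonglongrightarrow> 0"
        using tendsto_real_sqrt[OF tendsto_mult[OF tendsto_const[of 4] summable_LIMSEQ_zero[OF b]]] by (simp add: d_def[abs_def])
      have Pd: "\<bar>P n - P (j\<^sup>2)\<bar> \<le> d j" if n: "j\<^sup>2 \<le> n" "n \<le> (Suc j)\<^sup>2" for n j
      proof -
        have "{1..n} = {1..j\<^sup>2} \<union> {j\<^sup>2<..n}" using n by auto
        then have "P n = P (j\<^sup>2) + (\<Sum>k\<in>{j\<^sup>2<..n}. c k * e k t)"
          unfolding P_def by (simp only:) (rule sum.union_disjoint; auto)
        then have "\<bar>P n - P (j\<^sup>2)\<bar> = \<bar>\<Sum>k\<in>{j\<^sup>2<..n}. c k * e k t\<bar>" by simp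
        also have "\<dots> \<le> (\<Sum>k\<in>{j\<^sup>2<..n}. \<bar>c k * e k t\<bar>)" by (rule sum_abs)
        also have "\<dots> \<le> (\<Sum>k\<in>{j\<^sup>2<..n}. \<bar>c k\<bar>)"
          using e by (intro sum_mono) (simp add: abs_mult mult_left_le)
        also have "\<dots> \<le> (\<Sum>k\<in>B j. \<bar>c k\<bar>)" using n by (intro sum_mono2) (auto simp: B_def)
        also have "\<dots> \<le> d j" unfolding d_def
        proof (rule real_le_rsqrt)
          have "(\<Sum>k\<in>B j. \<bar>c k\<bar>)\<^sup>2 \<le> (\<Sum>k\<in>B j. \<bar>c k\<bar>\<^sup>2) * card (B j)" by (rule sum_squared_le_sum_of_squares)
          also have "\<dots> = (2 * real j + 1) * (\<Sum>k\<in>B j. (c k)\<^sup>2)" by (simp add: cardB)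
          also have "\<dots> \<le> (2 * w j) * (\<Sum>k\<in>B j. (c k)\<^sup>2)"
          proof (rule mult_right_mono)
            have "real (Suc j) powr 1 \<le> w j" unfolding w_def by (intro powr_mono) auto
            then show "2 * real j + 1 \<le> 2 * w j" by simp
          qed (intro sum_nonneg; simp)
          also have "\<dots> \<le> 4 * b j" using wb[of j] by simp
          finally show "(\<Sum>k\<in>B j. \<bar>c k\<bar>)\<^sup>2 \<le> 4 * b j" .
        qed
        finally show ?thesis .
      qed
      define r where "r n = nat \<lfloor>sqrt (real n)\<rfloor>" for n
      have r: "(r n)\<^sup>2 \<le> n" "n \<le> (Suc (r n))\<^sup>2" for n
      proof -
        have lo: "real (r n) \<le> sqrt (real n)" and hi: "sqrt (real n) \<le> real (Suc (r n))" by (auto simp: r_def) linarith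
        have sq: "(sqrt (real n))\<^sup>2 = real n" by simp
        have "(real (r n))\<^sup>2 \<le> (sqrt (real n))\<^sup>2" using lo by (intro power_mono) auto
        then show "(r n)\<^sup>2 \<le> n" unfolding sq of_nat_power[symmetric] by (simp only: of_nat_le_iff)
        have "(sqrt (real n))\<^sup>2 \<le> (real (Suc (r n)))\<^sup>2" using hi by (intro power_mono) auto
        then show "n \<le> (Suc (r n))\<^sup>2" unfolding sq of_nat_power[symmetric] by (simp only: of_nat_le_iff)
      qed
      have r_lim: "filterlim r sequentially sequentially"
      proof (rule filterlim_at_top_mono[where f = "\<lambda>n. nat \<lfloor>sqrt (real n)\<rfloor>"])
        show "filterlim (\<lambda>n. nat \<lfloor>sqrt (real n)\<rfloor>) sequentially sequentially"
          by (intro filterlim_compose[OF filterlim_nat_sequentially] filterlim_compose[OF filterlim_floor_sequentially]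
              filterlim_compose[OF sqrt_at_top] filterlim_real_sequentially)
      qed (simp add: r_def)
      have "(\<lambda>n. P n - P ((r n)\<^sup>2)) \<longlonglongrightarrow> 0"
        by (rule Lim_null_comparison[OF _ filterlim_compose[OF d r_lim]]) (use Pd r in auto)
      from tendsto_add[OF this filterlim_compose[OF PL r_lim]] have "P \<longlonglongrightarrow> L" by simp
      then show "convergent (\<lambda>n. \<Sum>k=1..n. c k * e k t)" unfolding P_def[abs_def] by (rule convergentI)
    qed
  qed
qed

section \<open>Random trigonometric sums and square summable coefficients\<close>

text \<open>Hoeffding's lemma for a fair sign.\<close>

lemma cosh_le_exp_square: "(exp x + exp (- x)) / 2 \<le> exp (x\<^sup>2 / 2)" for x :: real
proof -
  have *: "(exp x + exp (- x)) / 2 \<le> exp (x\<^sup>2 / 2)" if "0 \<le> x" for x :: real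
  proof -
    have pos: "0 < 1 + 1/2 * (exp (2 * x) - 1)" using exp_gt_zero[of "2 * x"] by argo
    have "(exp x + exp (- x)) / 2 = exp (- x) * (1 + 1/2 * (exp (2 * x) - 1))"
      by (simp add: algebra_simps mult_exp_exp add_divide_distrib)
    also have "\<dots> = exp (- (2 * x) * (1/2)) * exp (ln (1 + 1/2 * (exp (2 * x) - 1)))"
      unfolding exp_ln[OF pos] by simp
    also have "\<dots> = exp (- (2 * x) * (1/2) + ln (1 + 1/2 * (exp (2 * x) - 1)))"
      by (rule exp_add[symmetric])
    also have "\<dots> \<le> exp ((2 * x)\<^sup>2 / 8)"
      using Hoeffdings_lemma_aux[of "2 * x" "1/2"] that by simp
    finally show ?thesis by (simp add: power_mult_distrib)
  qed
  show ?thesis using *[of x] *[of "- x"] by (cases "0 \<le> x") (auto simp: add.commute)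
qed

lemma signed_sum_exp_moment:
  assumes "finite I"
  shows "subset_avg I (\<lambda>_. 1/2) (\<lambda>S. exp (u * signed_sum I b S)) \<le> exp (u\<^sup>2 * (\<Sum>i\<in>I. (b i)\<^sup>2) / 2)"
proof -
  have "subset_avg I (\<lambda>_. 1/2) (\<lambda>S. exp (2 * u * centred_sum I (\<lambda>_. 1/2) b S)) \<le> exp (u\<^sup>2 * (\<Sum>i\<in>I. (b i)\<^sup>2) / 2)"
    using assms
  proof (induction I)
    case empty then show ?case by (simp add: centred_sum_def)
  next
    case (insert x I)
    let ?W = "centred_sum I (\<lambda>_. 1/2) b"
    define A where "A = subset_avg I (\<lambda>_. 1/2) (\<lambda>S. exp (2 * u * ?W S))"
    have A0: "0 \<le> A"
      using subset_avg_mono[of I "\<lambda>_. 1/2" "\<lambda>_. 0" "\<lambda>S. exp (2 * u * ?W S)"] insert by (simp add: A_def)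
    have shift: "subset_avg I (\<lambda>_. 1/2) (\<lambda>S. exp (2 * u * (?W S + d))) = exp (2 * u * d) * A" for d
      unfolding A_def subset_avg_cmult[symmetric] by (rule subset_avg_cong) (auto simp: exp_add[symmetric] algebra_simps)
    have "subset_avg (insert x I) (\<lambda>_. 1/2) (\<lambda>S. exp (2 * u * centred_sum (insert x I) (\<lambda>_. 1/2) b S))
        = 1/2 * subset_avg I (\<lambda>_. 1/2) (\<lambda>S. exp (2 * u * (?W S + (1 - 1/2) * b x)))
        + (1 - 1/2) * subset_avg I (\<lambda>_. 1/2) (\<lambda>S. exp (2 * u * (?W S - 1/2 * b x)))"
      by (rule subset_avg_centred_sum_insert[OF insert(1,2), of "\<lambda>_. 1/2" "\<lambda>z. exp (2 * u * z)" b])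
    also have "\<dots> = (exp (u * b x) + exp (- (u * b x))) / 2 * A"
      using shift[of "1/2 * b x"] shift[of "- (1/2 * b x)"] by (simp add: algebra_simps add_divide_distrib)
    also have "\<dots> \<le> exp ((u * b x)\<^sup>2 / 2) * exp (u\<^sup>2 * (\<Sum>i\<in>I. (b i)\<^sup>2) / 2)"
      using insert A0 by (intro mult_mono cosh_le_exp_square) (auto simp: A_def)
    also have "\<dots> = exp (u\<^sup>2 * (\<Sum>i\<in>insert x I. (b i)\<^sup>2) / 2)"
      unfolding exp_add[symmetric] using insert(1,2) by (simp add: algebra_simps power_mult_distrib add_divide_distrib)
    finally show ?case .
  qed
  moreover have "subset_avg I (\<lambda>_. 1/2) (\<lambda>S. exp (u * signed_sum I b S)) = subset_avg I (\<lambda>_. 1/2) (\<lambda>S. exp (2 * u * centred_sum I (\<lambda>_. 1/2) b S))"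
    by (rule subset_avg_cong) (auto simp: signed_sum_eq_centred_sum[OF assms])
  ultimately show ?thesis by simp
qed

text \<open>Exponential Markov inequality, applied to both signs of the sum.\<close>

lemma signed_sum_tail:
  assumes "finite I" "0 \<le> u"
  shows "subset_avg I (\<lambda>_. 1/2) (\<lambda>S. of_bool (s < \<bar>signed_sum I b S\<bar>)) \<le> 2 * exp (u\<^sup>2 * (\<Sum>i\<in>I. (b i)\<^sup>2) / 2 - u * s)"
proof -
  have "subset_avg I (\<lambda>_. 1/2) (\<lambda>S. of_bool (s < \<bar>signed_sum I b S\<bar>))
      \<le> subset_avg I (\<lambda>_. 1/2) (\<lambda>S. exp (- (u * s)) * exp (u * signed_sum I b S) + exp (- (u * s)) * exp ((- u) * signed_sum I b S))"
  proof (rule subset_avg_mono)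
    fix S
    let ?z = "signed_sum I b S"
    show "of_bool (s < \<bar>?z\<bar>) \<le> exp (- (u * s)) * exp (u * ?z) + exp (- (u * s)) * exp ((- u) * ?z)"
    proof (cases "s < \<bar>?z\<bar>")
      case True
      then have "u * s \<le> u * \<bar>?z\<bar>" using assms by (intro mult_left_mono) auto
      then have "1 \<le> exp (- (u * s)) * exp (u * \<bar>?z\<bar>)" by (simp add: mult_exp_exp)
      also have "\<dots> \<le> exp (- (u * s)) * exp (u * ?z) + exp (- (u * s)) * exp ((- u) * ?z)"
        by (cases "0 \<le> ?z") auto
      finally show ?thesis using True by simp
    qed simp
  qed auto
  also have "\<dots> \<le> exp (- (u * s)) * exp (u\<^sup>2 * (\<Sum>i\<in>I. (b i)\<^sup>2) / 2) + exp (- (u * s)) * exp ((- u)\<^sup>2 * (\<Sum>i\<in>I. (b i)\<^sup>2) / 2)"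
    unfolding subset_avg_add subset_avg_cmult by (intro add_mono mult_left_mono signed_sum_exp_moment assms) auto
  also have "\<dots> = 2 * exp (u\<^sup>2 * (\<Sum>i\<in>I. (b i)\<^sup>2) / 2 - u * s)"
    by (simp add: mult_exp_exp)
  finally show ?thesis .
qed

lemma sum_dyadic_blocks:
  fixes h :: "nat \<Rightarrow> real"
  shows "(\<Sum>l\<in>{1..<2^J}. h l) = (\<Sum>j<J. \<Sum>l\<in>{2^j..<2^(Suc j)}. h l)"
proof (induction J)
  case (Suc J)
  have "(\<Sum>l\<in>{1..<2^Suc J}. h l) = (\<Sum>l\<in>{1..<2^J}. h l) + (\<Sum>l\<in>{2^J..<2^(Suc J)}. h l)"
    by (rule sum.atLeastLessThan_concat[symmetric]) auto
  then show ?case using Suc by simp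
qed simp

text \<open>The exponent leaves room on both sides: the squares, of order \<open>l powr (-5/4)\<close>, are summable,
  so that random signs give a bounded function, and they exceed the square \<open>l powr (-2)\<close> of
  the factor \<open>1 / l\<close> in the coefficients of the series by the factor \<open>l powr (3/4)\<close>.\<close>

abbreviation block_weight :: "nat \<Rightarrow> real" where
  "block_weight l \<equiv> real l powr (- 5/8)"

lemma block_weight_le:
  assumes "2 ^ j \<le> l"
  shows "block_weight l \<le> 1 / (2 powr (1/8)) ^ (5 * j)"
proof -
  have "(2::real) ^ j \<le> real l" using assms by (metis of_nat_le_iff of_nat_numeral of_nat_power)
  then have "block_weight l \<le> ((2::real) ^ j) powr (- 5/8)" by (intro powr_mono2') auto
  also have "\<dots> = 1 / (2 powr (1/8)) ^ (5 * j)"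
    by (simp add: powr_realpow[symmetric] powr_powr powr_minus_divide mult.commute)
  finally show ?thesis .
qed

text \<open>The sum is cut into dyadic blocks. A block with index \<open>j\<close> has \<open>2 ^ j\<close> terms, hence a variance
  of order \<open>2 powr (- j / 4)\<close>, and a Lipschitz constant at most of order \<open>4 ^ j\<close>, so it suffices to control
  it on a grid of width \<open>1 / 8 ^ j\<close>. Sub-Gaussian tails pay for the number of grid points and
  leave bounds that decrease geometrically in \<open>j\<close>.\<close>

lemma salem_zygmund:
  fixes f :: "nat \<Rightarrow> real \<Rightarrow> real"
  assumes f: "\<And>l x. \<bar>f l x\<bar> \<le> 2" and lip: "\<And>l x y. \<bar>f l x - f l y\<bar> \<le> real l * \<bar>x - y\<bar>" and \<eta>: "0 < \<eta>"
  shows "\<exists>C\<ge>0. \<forall>J. subset_avg {1..<2^J} (\<lambda>_. 1/2)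
    (\<lambda>S. of_bool (\<exists>x\<in>{0..7}. C < \<bar>signed_sum {1..<2^J} (\<lambda>l. block_weight l * f l x) S\<bar>)) \<le> \<eta>"
proof -
  define R where "R = (2::real) powr (1/8)"
  have R1: "1 < R" by (simp add: R_def)
  have R8: "R ^ 8 = 2" by (simp add: R_def powr_realpow[symmetric] powr_powr)
  define K where "K = max 0 (- ln (\<eta> / (32 * exp 1)))"
  have K: "0 \<le> K" "exp (- K) \<le> \<eta> / (32 * exp 1)"
  proof -
    have "exp (- K) \<le> exp (ln (\<eta> / (32 * exp 1)))" by (simp add: K_def)
    then show "exp (- K) \<le> \<eta> / (32 * exp 1)" using \<eta> by simp
  qed (simp add: K_def)
  \<comment> \<open>with the parameter \<open>R ^ j / 2\<close> in the exponential moment the tail at \<open>s j\<close> is of order \<open>exp (- K) / 16 ^ j\<close>, against at most \<open>8 * 8 ^ j\<close> grid points\<close>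
  define s where "s j = 2 * (K + real j * ln 16) / R ^ j" for j
  \<comment> \<open>the second term accounts for the points between those of the grid\<close>
  define v where "v j = s j + 2 / 2 ^ j" for j
  have s0: "0 \<le> s j" and v0: "0 \<le> v j" for j using K R1 by (auto simp: s_def v_def)
  have sum_v: "summable v"
  proof -
    have r: "norm (1 / R) < 1" using R1 by simp
    have 1: "summable (\<lambda>j. 2 * K * (1 / R) ^ j)" using summable_geometric[OF r] by (rule summable_mult)
    have 2: "summable (\<lambda>j. 2 * ln 16 * (of_nat (Suc j) * (1 / R) ^ j))"
      using sums_summable[OF geometric_deriv_sums[OF r]] by (rule summable_mult)
    have 3: "summable (\<lambda>j. 2 * (1/2::real) ^ j)" by (intro summable_mult summable_geometric) auto
    have "summable (\<lambda>j. 2 * K * (1 / R) ^ j + 2 * ln 16 * (of_nat (Suc j) * (1 / R) ^ j) + 2 * (1/2::real) ^ j)"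
      by (intro summable_add 1 2 3)
    then show ?thesis
    proof (rule summable_comparison_test'[where N = 0])
      fix j :: nat
      have "real j * ln 16 * (1 / R) ^ j \<le> real (Suc j) * ln 16 * (1 / R) ^ j"
        using R1 by (intro mult_right_mono) auto
      moreover have "v j = 2 * K * (1 / R) ^ j + 2 * (real j * ln 16 * (1 / R) ^ j) + 2 * (1/2) ^ j"
        using R1 by (simp add: v_def s_def field_simps power_divide)
      ultimately show "norm (v j) \<le> 2 * K * (1 / R) ^ j + 2 * ln 16 * (of_nat (Suc j) * (1 / R) ^ j) + 2 * (1/2::real) ^ j"
        using v0[of j] by (simp add: algebra_simps)
    qed
  qed
  define C where "C = suminf v"
  have C0: "0 \<le> C" unfolding C_def using sum_v v0 by (intro suminf_nonneg)
  have "subset_avg {1..<2^J} (\<lambda>_. 1/2)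
    (\<lambda>S. of_bool (\<exists>x\<in>{0..7}. C < \<bar>signed_sum {1..<2^J} (\<lambda>l. block_weight l * f l x) S\<bar>)) \<le> \<eta>" (is "subset_avg ?I _ ?bad \<le> _") for J
  proof -
    let ?B = "\<lambda>j. {2^j..<2^Suc j} :: nat set"
    let ?N = "\<lambda>j. {..7 * 8^j} :: nat set"
    define F where "F j x S = (\<Sum>l\<in>?B j. (2 * of_bool (l \<in> S) - 1) * (block_weight l * f l x))" for j x S
    have total: "signed_sum ?I (\<lambda>l. block_weight l * f l x) S = (\<Sum>j<J. F j x S)" for x S
      unfolding signed_sum_def F_def by (rule sum_dyadic_blocks)
    have F_lip: "\<bar>F j x S - F j y S\<bar> \<le> 2 / 2 ^ j" if "\<bar>x - y\<bar> \<le> 1 / 8 ^ j" for j x y S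
    proof -
      have "\<bar>F j x S - F j y S\<bar> = \<bar>\<Sum>l\<in>?B j. (2 * of_bool (l \<in> S) - 1) * (block_weight l * (f l x - f l y))\<bar>"
        by (simp add: F_def sum_subtractf[symmetric] algebra_simps)
      also have "\<dots> \<le> (\<Sum>l\<in>?B j. \<bar>(2 * of_bool (l \<in> S) - 1) * (block_weight l * (f l x - f l y))\<bar>)" by (rule sum_abs)
      also have "\<dots> \<le> (\<Sum>l\<in>?B j. 1 * (1 * (2 * 2 ^ j * (1 / 8 ^ j))))"
      proof (rule sum_mono)
        fix l assume l: "l \<in> ?B j"
        have "block_weight l \<le> 1 / R ^ (5 * j)" unfolding R_def using l by (intro block_weight_le) auto
        also have "\<dots> \<le> 1" using R1 by (simp add: one_le_power)
        finally have a: "\<bar>block_weight l\<bar> \<le> 1" by simp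
        have "real l \<le> real (2 ^ Suc j)" using l by (intro of_nat_mono) auto
        then have "real l * \<bar>x - y\<bar> \<le> (2 * 2 ^ j) * (1 / 8 ^ j)" using that by (intro mult_mono) auto
        then have b: "\<bar>f l x - f l y\<bar> \<le> 2 * 2 ^ j * (1 / 8 ^ j)" using lip[of l x y] by linarith
        show "\<bar>(2 * of_bool (l \<in> S) - 1) * (block_weight l * (f l x - f l y))\<bar> \<le> 1 * (1 * (2 * 2 ^ j * (1 / 8 ^ j)))"
          unfolding abs_mult using a b by (intro mult_mono) auto
      qed
      also have "\<dots> = 2 / 2 ^ j"
      proof -
        have "(8::real) ^ j = 2 ^ j * 2 ^ j * 2 ^ j" by (simp add: power_mult_distrib[symmetric])
        then show ?thesis by (simp add: field_simps)
      qed
      finally show ?thesis .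
    qed
    have F_tail: "subset_avg ?I (\<lambda>_. 1/2) (\<lambda>S. of_bool (s j < \<bar>F j x S\<bar>)) \<le> 2 * exp 1 * exp (- K) / 16 ^ j" if j: "j < J" for j x
    proof -
      define b where "b l = of_bool (l \<in> ?B j) * (block_weight l * f l x)" for l
      have sub: "?B j \<subseteq> ?I"
      proof -
        have "(2::nat) ^ Suc j \<le> 2 ^ J" using j by (intro power_increasing) auto
        then show ?thesis by (auto intro: less_le_trans order_trans[OF one_le_power])
      qed
      have bF: "signed_sum ?I b S = F j x S" for S
        unfolding signed_sum_def F_def
        by (rule sum.mono_neutral_cong_right) (use sub in \<open>auto simp: b_def\<close>)
      have "(\<Sum>l\<in>?I. (b l)\<^sup>2) = (\<Sum>l\<in>?B j. (block_weight l * f l x)\<^sup>2)"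
        by (rule sum.mono_neutral_cong_right) (use sub in \<open>auto simp: b_def\<close>)
      also have "\<dots> \<le> (\<Sum>l\<in>?B j. (1 / R ^ (5 * j) * 2)\<^sup>2)"
      proof (rule sum_mono)
        fix l assume l: "l \<in> ?B j"
        have "block_weight l \<le> 1 / R ^ (5 * j)" unfolding R_def using l by (intro block_weight_le) auto
        then have "\<bar>block_weight l * f l x\<bar> \<le> 1 / R ^ (5 * j) * 2"
          unfolding abs_mult using f[of l x] R1 by (intro mult_mono) auto
        then have "\<bar>block_weight l * f l x\<bar>\<^sup>2 \<le> (1 / R ^ (5 * j) * 2)\<^sup>2" by (intro power_mono) auto
        then show "(block_weight l * f l x)\<^sup>2 \<le> (1 / R ^ (5 * j) * 2)\<^sup>2" by simp
      qed
      also have "\<dots> = 4 / R ^ (2 * j)"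
      proof -
        have "(2::real) ^ j = R ^ (8 * j)" by (simp add: R8[symmetric] power_mult)
        also have "\<dots> = R ^ (10 * j) / R ^ (2 * j)" using R1 by (simp add: power_diff[symmetric])
        finally have "(2::real) ^ j = R ^ (10 * j) / R ^ (2 * j)" .
        moreover have "(R ^ (5 * j))\<^sup>2 = R ^ (10 * j)" by (simp add: power_mult[symmetric] mult.commute)
        ultimately show ?thesis using R1 by (simp add: power_mult_distrib power_divide)
      qed
      finally have sq: "(\<Sum>l\<in>?I. (b l)\<^sup>2) \<le> 4 / R ^ (2 * j)" .
      let ?u = "R ^ j / 2"
      have us: "?u * s j = K + real j * ln 16" using R1 by (simp add: s_def)
      have "?u\<^sup>2 * (\<Sum>l\<in>?I. (b l)\<^sup>2) \<le> ?u\<^sup>2 * (4 / R ^ (2 * j))" using sq by (intro mult_left_mono) auto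
      also have "\<dots> = 1" using R1 by (simp add: power_divide power_mult[symmetric] mult.commute)
      finally have u2: "?u\<^sup>2 * (\<Sum>l\<in>?I. (b l)\<^sup>2) / 2 \<le> 1" by simp
      have "subset_avg ?I (\<lambda>_. 1/2) (\<lambda>S. of_bool (s j < \<bar>F j x S\<bar>)) \<le> 2 * exp (?u\<^sup>2 * (\<Sum>l\<in>?I. (b l)\<^sup>2) / 2 - ?u * s j)"
        unfolding bF[symmetric] by (rule signed_sum_tail) (use R1 in auto)
      also have "\<dots> \<le> 2 * exp (1 - (K + real j * ln 16))" using u2 unfolding us by simp
      also have "\<dots> = 2 * exp 1 * exp (- K) / 16 ^ j"
      proof -
        have "exp (real j * ln 16) = (16::real) ^ j" by (simp add: exp_of_nat_mult)
        then show ?thesis by (simp add: exp_diff exp_add exp_minus field_simps)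
      qed
      finally show ?thesis .
    qed
    have "subset_avg ?I (\<lambda>_. 1/2) ?bad \<le> subset_avg ?I (\<lambda>_. 1/2) (\<lambda>S. \<Sum>j<J. \<Sum>i\<in>?N j. of_bool (s j < \<bar>F j (real i / 8^j) S\<bar>))"
    proof (rule subset_avg_mono)
      fix S
      let ?T = "\<Sum>j<J. \<Sum>i\<in>?N j. of_bool (s j < \<bar>F j (real i / 8^j) S\<bar>) :: real"
      have T0: "0 \<le> ?T" by (intro sum_nonneg) auto
      show "?bad S \<le> ?T"
      proof (cases "\<exists>j<J. \<exists>i\<in>?N j. s j < \<bar>F j (real i / 8^j) S\<bar>")
        case True
        then obtain j i where ji: "j < J" "i \<in> ?N j" "s j < \<bar>F j (real i / 8^j) S\<bar>" by blast
        have "1 = (of_bool (s j < \<bar>F j (real i / 8^j) S\<bar>) :: real)" using ji by simp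
        also have "\<dots> \<le> (\<Sum>i\<in>?N j. of_bool (s j < \<bar>F j (real i / 8^j) S\<bar>))"
          using ji(2) by (intro member_le_sum) auto
        also have "\<dots> \<le> ?T"
          using ji(1) by (intro member_le_sum[of j "{..<J}" "\<lambda>j. \<Sum>i\<in>?N j. of_bool (s j < \<bar>F j (real i / 8^j) S\<bar>)"]) (auto intro!: sum_nonneg)
        finally have "1 \<le> ?T" .
        then show ?thesis by (auto simp: of_bool_def)
      next
        case False
        have "\<bar>signed_sum ?I (\<lambda>l. block_weight l * f l x) S\<bar> \<le> C" if x: "x \<in> {0..7}" for x
        proof -
          have Fv: "\<bar>F j x S\<bar> \<le> v j" if j: "j < J" for j
          proof -
            define i where "i = nat \<lfloor>x * 8^j\<rfloor>"
            have i: "real i \<le> x * 8^j" "x * 8^j < real i + 1" using x by (auto simp: i_def)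
            have "real i \<le> 7 * 8^j"
            proof -
              have "x * 8^j \<le> 7 * 8^j" using x by (intro mult_right_mono) auto
              then show ?thesis using i by linarith
            qed
            then have "real i \<le> real (7 * 8^j)" by simp
            then have iN: "i \<in> ?N j" by (simp only: of_nat_le_iff atMost_iff)
            have "x - real i / 8^j = (x * 8^j - real i) / 8^j" by (simp add: diff_divide_distrib)
            moreover have "0 \<le> (x * 8^j - real i) / 8^j" "(x * 8^j - real i) / 8^j \<le> 1 / 8^j"
              using i by (auto intro!: divide_right_mono divide_nonneg_nonneg)
            ultimately have "\<bar>x - real i / 8^j\<bar> \<le> 1 / 8^j" by simp
            then have "\<bar>F j x S - F j (real i / 8^j) S\<bar> \<le> 2 / 2^j" by (rule F_lip)
            moreover have "\<not> s j < \<bar>F j (real i / 8^j) S\<bar>" using False j iN by blast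
            ultimately show ?thesis unfolding v_def by linarith
          qed
          have "\<bar>\<Sum>j<J. F j x S\<bar> \<le> (\<Sum>j<J. \<bar>F j x S\<bar>)" by (rule sum_abs)
          also have "\<dots> \<le> (\<Sum>j<J. v j)" using Fv by (intro sum_mono) auto
          also have "\<dots> \<le> C" unfolding C_def using sum_v v0 by (intro sum_le_suminf) auto
          finally show ?thesis unfolding total .
        qed
        then have "?bad S = 0" by (auto simp: not_less)
        then show ?thesis using T0 by simp
      qed
    qed auto
    also have "\<dots> = (\<Sum>j<J. \<Sum>i\<in>?N j. subset_avg ?I (\<lambda>_. 1/2) (\<lambda>S. of_bool (s j < \<bar>F j (real i / 8^j) S\<bar>)))"
      by (simp only: subset_avg_sum)
    also have "\<dots> \<le> (\<Sum>j<J. \<Sum>i\<in>?N j. 2 * exp 1 * exp (- K) / 16 ^ j)"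
      by (intro sum_mono F_tail) auto
    also have "\<dots> \<le> (\<Sum>j<J. 16 * exp 1 * exp (- K) * (1/2) ^ j)"
    proof (rule sum_mono)
      fix j
      have "(\<Sum>i\<in>?N j. 2 * exp 1 * exp (- K) / 16 ^ j) = (7 * 8 ^ j + 1) * (2 * exp 1 * exp (- K) / 16 ^ j)" by simp
      also have "\<dots> \<le> (8 * 8 ^ j) * (2 * exp 1 * exp (- K) / 16 ^ j)" by (intro mult_right_mono) auto
      also have "\<dots> = 16 * exp 1 * exp (- K) * (1/2) ^ j"
      proof -
        have "(16::real) ^ j = 8 ^ j * 2 ^ j" by (simp add: power_mult_distrib[symmetric])
        then show ?thesis by (simp add: field_simps power_divide)
      qed
      finally show "(\<Sum>i\<in>?N j. 2 * exp 1 * exp (- K) / 16 ^ j) \<le> 16 * exp 1 * exp (- K) * (1/2) ^ j" .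
    qed
    also have "\<dots> = 16 * exp 1 * exp (- K) * (\<Sum>j<J. (1/2) ^ j)" by (simp add: sum_distrib_left)
    also have "\<dots> \<le> 16 * exp 1 * exp (- K) * 2"
    proof (rule mult_left_mono)
      have "(\<Sum>j<J. (1/2::real) ^ j) \<le> (\<Sum>j\<le>J. (1/2) ^ j)" by (intro sum_mono2) auto
      then show "(\<Sum>j<J. (1/2::real) ^ j) \<le> 2" using sum_geometric_half_le[of J] by linarith
    qed auto
    also have "\<dots> \<le> \<eta>" using K(2) by (simp add: field_simps)
    finally show ?thesis .
  qed
  then show ?thesis using C0 by blast
qed


text \<open>The signed sums of \<open>block_weight l * x l\<close> are limits of integrals of simple functions that
  approximate the signed sums of \<open>block_weight l * f l\<close>, and for most signs the latter are
  bounded independently of the number of terms.\<close>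

lemma square_summable_coefficients:
  fixes M :: "'a measure" and X :: "real measure" and f :: "nat \<Rightarrow> real \<Rightarrow> real"
  assumes SM: "stochastic_meas M X \<mu>" and space: "space X \<subseteq> {0..7}" and A: "A \<in> sets X"
    and f: "\<And>l x. \<bar>f l x\<bar> \<le> 2" and lip: "\<And>l x y. \<bar>f l x - f l y\<bar> \<le> real l * \<bar>x - y\<bar>"
    and approx: "\<And>l. sm_approximation M X \<mu> (f l) (gs l)"
    and x: "\<And>l. x l \<in> borel_measurable M" "\<And>l. conv_in_prob M (\<lambda>n. sm_simple_integral X \<mu> A (gs l n)) (x l)"
  shows "AE \<omega> in M. summable (\<lambda>l. (block_weight l * x l \<omega>)\<^sup>2)"
proof -
  interpret stochastic_meas M X \<mu> by (rule SM)
  have gs: "simple_function X (gs l n)" "\<And>s. s \<in> space X \<Longrightarrow> (\<lambda>n. gs l n s) \<longlonglongrightarrow> f l s" for l n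
    using approx[of l] by (auto simp: sm_approximation_def)
  have "\<forall>l. \<forall>B\<in>sets X. \<exists>\<zeta>. \<zeta> \<in> borel_measurable M \<and> conv_in_prob M (\<lambda>n. sint B (gs l n)) \<zeta>"
    using approx unfolding sm_approximation_def by blast
  then obtain \<zeta> where \<zeta>: "\<And>l B. B \<in> sets X \<Longrightarrow> \<zeta> l B \<in> borel_measurable M"
    "\<And>l B. B \<in> sets X \<Longrightarrow> conv_in_prob M (\<lambda>n. sint B (gs l n)) (\<zeta> l B)" by metis
  \<comment> \<open>the limits on the other sets may be any versions; on \<open>A\<close> the given one is used\<close>
  define \<nu> where "\<nu> l B = (if B = A then x l else \<zeta> l B)" for l B
  have \<nu>: "\<nu> l B \<in> borel_measurable M" "conv_in_prob M (\<lambda>n. sint B (gs l n)) (\<nu> l B)" if "B \<in> sets X" for l B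
    using \<zeta>[OF that] x by (auto simp: \<nu>_def)
  define Y where "Y l \<omega> = block_weight l * x l \<omega>" for l \<omega>
  have Y: "Y l \<in> borel_measurable M" for l unfolding Y_def using x by (intro borel_measurable_times) auto
  have key: "\<exists>N\<in>events. prob N \<le> 80 * \<eta> \<and> (\<forall>\<omega>\<in>space M - N. summable (\<lambda>l. (Y l \<omega>)\<^sup>2))" if \<eta>: "0 < \<eta>" for \<eta>
  proof -
    obtain t where t: "0 < t" and bound: "\<And>f A C. simple_function X f \<Longrightarrow> A \<in> sets X \<Longrightarrow> 0 < C \<Longrightarrow> (\<forall>x\<in>A. \<bar>f x\<bar> \<le> C)
      \<Longrightarrow> tail_prob M (sint A f) (C * t) \<le> \<eta>"
      using sint_bounded_in_prob[OF \<eta>] by blast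
    obtain C where C: "0 \<le> C" and SZ: "\<And>J. subset_avg {1..<2^J} (\<lambda>_. 1/2)
      (\<lambda>S. of_bool (\<exists>s\<in>{0..7}. C < \<bar>signed_sum {1..<2^J} (\<lambda>l. block_weight l * f l s) S\<bar>)) \<le> \<eta>"
      using salem_zygmund[OF f lip \<eta>] by blast
    define t1 where "t1 = (C + 1) * t + 2"
    have t1: "0 \<le> t1" using C t by (simp add: t1_def)
    define G where "G J = {\<omega> \<in> space M. 4 * t1\<^sup>2 < (\<Sum>l\<in>{1..<2^J}. (Y l \<omega>)\<^sup>2)}" for J
    have Gev: "G J \<in> events" for J
    proof -
      have [measurable]: "(\<lambda>\<omega>. \<Sum>l\<in>{1..<2^J}. (Y l \<omega>)\<^sup>2) \<in> borel_measurable M"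
        using Y by (intro borel_measurable_sum borel_measurable_power) auto
      show ?thesis unfolding G_def by measurable
    qed
    have Gprob: "prob (G J) \<le> 80 * \<eta>" for J
    proof -
      let ?I = "{1..<2^J} :: nat set"
      let ?bad = "\<lambda>S. of_bool (\<exists>s\<in>{0..7}. C < \<bar>signed_sum ?I (\<lambda>l. block_weight l * f l s) S\<bar>) :: real"
      have "1/20 * prob (G J) \<le> subset_avg ?I (\<lambda>_. 1/2) (\<lambda>S. tail_prob M (\<lambda>\<omega>. \<Sum>l\<in>?I. (2 * of_bool (l \<in> S) - 1) * Y l \<omega>) t1)"
        unfolding G_def by (rule tail_square_sum_le[unfolded signed_sum_def]) (use Y t1 in auto)
      also have "\<dots> \<le> subset_avg ?I (\<lambda>_. 1/2) (\<lambda>S. 3 * \<eta> + ?bad S)"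
      proof (rule subset_avg_mono)
        fix S
        let ?e = "\<lambda>l. (2 * of_bool (l \<in> S) - 1) * block_weight l"
        show "tail_prob M (\<lambda>\<omega>. \<Sum>l\<in>?I. (2 * of_bool (l \<in> S) - 1) * Y l \<omega>) t1 \<le> 3 * \<eta> + ?bad S"
        proof (cases "\<exists>s\<in>{0..7}. C < \<bar>signed_sum ?I (\<lambda>l. block_weight l * f l s) S\<bar>")
          case True
          have "tail_prob M (\<lambda>\<omega>. \<Sum>l\<in>?I. (2 * of_bool (l \<in> S) - 1) * Y l \<omega>) t1 \<le> 1" by (rule prob_le_1)
          moreover have "?bad S = 1" using True by simp
          ultimately show ?thesis using \<eta> by linarith
        next
          case False
          have eq: "(\<Sum>l\<in>?I. (2 * of_bool (l \<in> S) - 1) * Y l \<omega>) = (\<Sum>l\<in>?I. ?e l * \<nu> l A \<omega>)" for \<omega>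
            by (simp add: Y_def \<nu>_def mult.assoc)
          have "tail_prob M (\<lambda>\<omega>. \<Sum>l\<in>?I. ?e l * \<nu> l A \<omega>) ((C + 1) * t + 2) \<le> 3 * \<eta>"
          proof (rule integral_limit_bounded[OF bound \<eta>, where gs = "\<lambda>n s. \<Sum>l\<in>?I. ?e l * gs l n s" and g = "\<lambda>s. \<Sum>l\<in>?I. ?e l * f l s"
                and \<nu> = "\<lambda>B \<omega>. \<Sum>l\<in>?I. ?e l * \<nu> l B \<omega>"])
            show "simple_function X (\<lambda>s. \<Sum>l\<in>?I. ?e l * gs l n s)" for n
              by (intro simple_function_sum simple_function_mult simple_function_const gs)
            show "(\<lambda>n. \<Sum>l\<in>?I. ?e l * gs l n s) \<longlonglongrightarrow> (\<Sum>l\<in>?I. ?e l * f l s)" if "s \<in> space X" for s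
              by (intro tendsto_sum tendsto_mult tendsto_const gs that)
            show "\<bar>\<Sum>l\<in>?I. ?e l * f l s\<bar> \<le> C" if "s \<in> space X" for s
              using False space that by (auto simp: signed_sum_def mult.assoc not_less)
            show m: "(\<lambda>\<omega>. \<Sum>l\<in>?I. ?e l * \<nu> l B \<omega>) \<in> borel_measurable M" if "B \<in> sets X" for B
              using \<nu>(1)[OF that] by (intro borel_measurable_sum borel_measurable_times) auto
            show "conv_in_prob M (\<lambda>n. sint B (\<lambda>s. \<Sum>l\<in>?I. ?e l * gs l n s)) (\<lambda>\<omega>. \<Sum>l\<in>?I. ?e l * \<nu> l B \<omega>)"
              if B: "B \<in> sets X" for B
            proof (rule conv_in_prob_cong_AE)
              show "conv_in_prob M (\<lambda>n \<omega>. \<Sum>l\<in>?I. ?e l * sint B (gs l n) \<omega>) (\<lambda>\<omega>. \<Sum>l\<in>?I. ?e l * \<nu> l B \<omega>)"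
                using \<nu>[OF B] sint_measurable[OF B gs(1)]
                by (intro conv_in_prob_sum conv_in_prob_cmult borel_measurable_times) auto
              show "(\<lambda>\<omega>. \<Sum>l\<in>?I. ?e l * sint B (gs l n) \<omega>) \<in> borel_measurable M" for n
                using sint_measurable[OF B gs(1)] by (intro borel_measurable_sum borel_measurable_times) auto
              show "sint B (\<lambda>s. \<Sum>l\<in>?I. ?e l * gs l n s) \<in> borel_measurable M" for n
                by (intro sint_measurable B simple_function_sum simple_function_mult simple_function_const gs)
              show "AE \<omega> in M. (\<Sum>l\<in>?I. ?e l * sint B (gs l n) \<omega>) = sint B (\<lambda>s. \<Sum>l\<in>?I. ?e l * gs l n s) \<omega>" for n
                using sint_sum[OF B, of ?I "\<lambda>l. gs l n" ?e] gs(1) by (simp add: eq_commute)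
            qed (rule m[OF B])
          qed (use A C in auto)
          moreover have "?bad S = 0" using False by simp
          ultimately show ?thesis unfolding eq t1_def by linarith
        qed
      qed auto
      also have "\<dots> = 3 * \<eta> + subset_avg ?I (\<lambda>_. 1/2) ?bad" by (simp add: subset_avg_add)
      also have "\<dots> \<le> 4 * \<eta>" using SZ[of J] by simp
      finally show ?thesis by simp
    qed
    have "incseq G"
    proof (rule incseq_SucI, rule subsetI)
      fix J \<omega> assume "\<omega> \<in> G J"
      moreover have "(\<Sum>l\<in>{1..<2^J}. (Y l \<omega>)\<^sup>2) \<le> (\<Sum>l\<in>{1..<2^Suc J}. (Y l \<omega>)\<^sup>2)" by (intro sum_mono2) auto
      ultimately show "\<omega> \<in> G (Suc J)" by (auto simp: G_def)
    qed
    then have "(\<lambda>J. prob (G J)) \<longlonglongrightarrow> prob (\<Union>J. G J)" using Gev by (intro finite_Lim_measure_incseq) auto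
    then have "prob (\<Union>J. G J) \<le> 80 * \<eta>" by (rule LIMSEQ_le_const2) (use Gprob in auto)
    moreover have "summable (\<lambda>l. (Y l \<omega>)\<^sup>2)" if \<omega>: "\<omega> \<in> space M - (\<Union>J. G J)" for \<omega>
    proof (rule summableI_nonneg_bounded)
      fix n :: nat
      \<comment> \<open>the term with index 0 vanishes because \<open>0 powr a = 0\<close>\<close>
      have "(\<Sum>l<n. (Y l \<omega>)\<^sup>2) \<le> (\<Sum>l\<in>insert 0 {1..<2^n}. (Y l \<omega>)\<^sup>2)"
      proof (rule sum_mono2)
        show "{..<n} \<subseteq> insert 0 {1..<2^n}" using less_trans[OF _ less_exp[of n]] by auto
      qed auto
      also have "\<dots> = (\<Sum>l\<in>{1..<2^n}. (Y l \<omega>)\<^sup>2)" by (simp add: Y_def)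
      also have "\<dots> \<le> 4 * t1\<^sup>2" using \<omega> by (auto simp: G_def not_less)
      finally show "(\<Sum>l<n. (Y l \<omega>)\<^sup>2) \<le> 4 * t1\<^sup>2" .
    qed simp
    ultimately show ?thesis using Gev by (intro bexI[of _ "\<Union>J. G J"]) auto
  qed
  have "\<forall>m. \<exists>N. N \<in> events \<and> prob N \<le> 80 * (1 / real (Suc m)) \<and> (\<forall>\<omega>\<in>space M - N. summable (\<lambda>l. (Y l \<omega>)\<^sup>2))"
  proof
    fix m :: nat
    have "0 < 1 / real (Suc m)" by simp
    from key[OF this] show "\<exists>N. N \<in> events \<and> prob N \<le> 80 * (1 / real (Suc m)) \<and> (\<forall>\<omega>\<in>space M - N. summable (\<lambda>l. (Y l \<omega>)\<^sup>2))"
      by (simp only: Bex_def)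
  qed
  then obtain N where N: "\<And>m. N m \<in> events" "\<And>m. prob (N m) \<le> 80 * (1 / real (Suc m))"
    "\<And>m \<omega>. \<omega> \<in> space M - N m \<Longrightarrow> summable (\<lambda>l. (Y l \<omega>)\<^sup>2)" by metis
  have Nev: "(\<Inter>m. N m) \<in> events" using N(1) by auto
  have "prob (\<Inter>m. N m) \<le> 80 * (1 / real (Suc m))" for m
    using finite_measure_mono[of "\<Inter>m. N m" "N m"] N(1,2)[of m] by (meson INT_lower UNIV_I order_trans)
  moreover have "(\<lambda>m. 80 * (1 / real (Suc m))) \<longlonglongrightarrow> 80 * 0"
    by (intro tendsto_mult tendsto_const LIMSEQ_Suc[OF lim_1_over_n])
  ultimately have "prob (\<Inter>m. N m) \<le> 80 * 0" by (intro LIMSEQ_le_const) auto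
  then have "prob (\<Inter>m. N m) = 0" by (simp add: measure_le_0_iff)
  then have "(\<Inter>m. N m) \<in> null_sets M" using Nev by (simp add: null_sets_def emeasure_eq_measure)
  then show ?thesis
  proof (rule AE_I')
    show "{\<omega> \<in> space M. \<not> summable (\<lambda>l. (block_weight l * x l \<omega>)\<^sup>2)} \<subseteq> (\<Inter>m. N m)"
      using N(3) by (auto simp: Y_def)
  qed
qed

section \<open>The Fourier series of a stochastic measure\<close>

lemma sin_lipschitz: "\<bar>sin a - sin b\<bar> \<le> \<bar>a - b\<bar>" for a b :: real
proof -
  have "\<bar>sin a - sin b\<bar> = 2 * \<bar>sin ((a - b) / 2)\<bar> * \<bar>cos ((a + b) / 2)\<bar>"
    by (simp add: sin_diff_sin abs_mult)
  also have "\<dots> \<le> 2 * \<bar>(a - b) / 2\<bar> * 1" by (intro mult_mono abs_sin_x_le_abs_x) auto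
  finally show ?thesis by simp
qed

lemma cos_lipschitz: "\<bar>cos a - cos b\<bar> \<le> \<bar>a - b\<bar>" for a b :: real
  using sin_lipschitz[of "pi / 2 - a" "pi / 2 - b"] by (simp add: cos_sin_eq abs_minus_commute)

lemma (in stochastic_meas) sm_integral_spec:
  assumes g: "sm_integrable M X \<mu> g" and A: "A \<in> sets X"
  shows "\<exists>gs. sm_approximation M X \<mu> g gs \<and> sm_integral M X \<mu> A g \<in> borel_measurable M
    \<and> conv_in_prob M (\<lambda>n. sint A (gs n)) (sm_integral M X \<mu> A g)"
proof -
  obtain gs where gs: "sm_approximation M X \<mu> g gs" using g by (auto simp: sm_integrable_def)
  then obtain \<zeta> where "\<zeta> \<in> borel_measurable M" "conv_in_prob M (\<lambda>n. sint A (gs n)) \<zeta>"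
    using A unfolding sm_approximation_def by blast
  then have "\<exists>\<zeta>. \<zeta> \<in> borel_measurable M \<and> (\<exists>gs. sm_approximation M X \<mu> g gs \<and> conv_in_prob M (\<lambda>n. sint A (gs n)) \<zeta>)"
    using gs by blast
  from someI_ex[OF this] show ?thesis unfolding sm_integral_def by blast
qed

text \<open>The exponents match because \<open>3/4 - 2 = 2 * (-5/8)\<close>.\<close>

lemma weighted_square_summable:
  fixes x c :: "nat \<Rightarrow> real"
  assumes "summable (\<lambda>k. (block_weight k * x k)\<^sup>2)" and c: "\<And>k. 1 \<le> k \<Longrightarrow> \<bar>c k\<bar> = \<bar>x k\<bar> / (real k * pi)"
  shows "summable (\<lambda>k. real k powr (3/4) * (c k)\<^sup>2)"
proof -
  have "real k powr (3/4) * (c k)\<^sup>2 = 1 / pi\<^sup>2 * (block_weight k * x k)\<^sup>2" for k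
  proof (cases "k = 0")
    case False
    then have k: "0 < real k" by simp
    have cx: "(c k)\<^sup>2 = (x k)\<^sup>2 / (real k * pi)\<^sup>2"
      using c[of k] False by (metis One_nat_def Suc_leI neq0_conv power2_abs power_divide)
    have bw: "(block_weight k)\<^sup>2 = real k powr (3/4) / (real k)\<^sup>2"
    proof -
      have "(block_weight k)\<^sup>2 = (block_weight k) powr 2" using k by (intro powr_numeral[symmetric]) simp
      also have "\<dots> = real k powr (3/4 - 2)" by (simp add: powr_powr)
      also have "\<dots> = real k powr (3/4) / real k powr 2" by (rule powr_diff)
      also have "real k powr 2 = (real k)\<^sup>2" using k by (intro powr_numeral) simp
      finally show ?thesis .
    qed
    show ?thesis unfolding power_mult_distrib[of "block_weight k"] cx bw
      by (simp add: power_mult_distrib mult.commute)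
  qed simp
  then show ?thesis using summable_mult[OF assms(1), of "1 / pi\<^sup>2"] by simp
qed

theorem theorem2:
  fixes M :: "'a measure"
    and X m :: "real measure"
    and \<mu> :: "real set \<Rightarrow> 'a \<Rightarrow> real"
    and \<xi> \<eta> :: "nat \<Rightarrow> 'a \<Rightarrow> real"
    and S :: "nat \<Rightarrow> real \<Rightarrow> 'a \<Rightarrow> real"
  assumes "prob_space M" and "complete_measure M"
    and X_def: "X = restrict_space borel {0..2*pi}"
    and "stochastic_measure M X \<mu>"
    and "finite_measure m" and "sets m = sets X"
    and exp_integrable: "\<And>g :: real \<Rightarrow> real. g \<in> borel_measurable X \<Longrightarrow>
          (\<And>l :: real. l > 0 \<Longrightarrow> (\<integral>\<^sup>+ t. ennreal (2 powr (l * \<bar>g t\<bar>)) \<partial>m) < \<infinity>) \<Longrightarrow>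
          sm_integrable M X \<mu> g"
    and \<xi>_measurable: "\<And>k. \<xi> k \<in> borel_measurable M"
    and \<eta>_measurable: "\<And>k. k \<ge> 1 \<Longrightarrow> \<eta> k \<in> borel_measurable M"
    and \<xi>_0: "AE \<omega> in M. \<xi> 0 \<omega> =
          2 * \<mu> {0<..2*pi} \<omega> - 1 / pi * sm_integral M X \<mu> {0<..2*pi} (\<lambda>s. s) \<omega>"
    and \<xi>_k: "\<And>k. k \<ge> 1 \<Longrightarrow> AE \<omega> in M. \<xi> k \<omega> =
          - (1 / (real k * pi)) * sm_integral M X \<mu> {0<..2*pi} (\<lambda>s. sin (real k * s)) \<omega>"
    and \<eta>_k: "\<And>k. k \<ge> 1 \<Longrightarrow> AE \<omega> in M. \<eta> k \<omega> =
          1 / (real k * pi) * sm_integral M X \<mu> {0<..2*pi} (\<lambda>s. cos (real k * s) - 1) \<omega>"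
    and S_def: "\<And>n t \<omega>. S n t \<omega> =
          \<xi> 0 \<omega> / 2 + (\<Sum>k=1..n. \<xi> k \<omega> * cos (real k * t) + \<eta> k \<omega> * sin (real k * t))"
  shows "measure M {\<omega> \<in> space M.
           AE t in lborel. t \<in> {0..2*pi} \<longrightarrow> convergent (\<lambda>n. S n t \<omega>)} = 1"
proof -
  interpret prob_space M by fact
  interpret complete_measure M by fact
  interpret stochastic_meas M X \<mu> by unfold_locales fact
  interpret m: finite_measure m by fact
  define A where "A = {0<..2*pi}"
  have A: "A \<in> sets X" unfolding X_def A_def by (auto simp: sets_restrict_space image_iff intro!: bexI[of _ "{0<..2*pi}"])
  have spaceX: "space X \<subseteq> {0..7}" using pi_less_4 pi_approx by (auto simp: X_def space_restrict_space)
  have bounded_integrable: "sm_integrable M X \<mu> g" if g: "g \<in> borel_measurable borel" and b: "\<And>t. \<bar>g t\<bar> \<le> 2" for g :: "real \<Rightarrow> real"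
  proof (rule exp_integrable)
    show "g \<in> borel_measurable X" unfolding X_def using g by (rule measurable_restrict_space1)
    fix l :: real assume l: "0 < l"
    have "(\<integral>\<^sup>+ t. ennreal (2 powr (l * \<bar>g t\<bar>)) \<partial>m) \<le> (\<integral>\<^sup>+ t. ennreal (2 powr (l * 2)) \<partial>m)"
      using b l by (intro nn_integral_mono ennreal_leI powr_mono mult_left_mono) auto
    also have "\<dots> < \<infinity>" using m.emeasure_finite[of "space m"] by (auto simp: less_top[symmetric] ennreal_mult_eq_top_iff)
    finally show "(\<integral>\<^sup>+ t. ennreal (2 powr (l * \<bar>g t\<bar>)) \<partial>m) < \<infinity>" .
  qed
  have coefficients: "AE \<omega> in M. summable (\<lambda>l. (block_weight l * sm_integral M X \<mu> A (f l) \<omega>)\<^sup>2)"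
    if f: "\<And>l. f l \<in> borel_measurable borel" "\<And>l x. \<bar>f l x\<bar> \<le> 2" "\<And>l x y. \<bar>f l x - f l y\<bar> \<le> real l * \<bar>x - y\<bar>"
    for f :: "nat \<Rightarrow> real \<Rightarrow> real"
  proof -
    have "\<forall>l. \<exists>gs. sm_approximation M X \<mu> (f l) gs \<and> sm_integral M X \<mu> A (f l) \<in> borel_measurable M
      \<and> conv_in_prob M (\<lambda>n. sint A (gs n)) (sm_integral M X \<mu> A (f l))"
      by (intro allI sm_integral_spec bounded_integrable f A)
    then obtain gs where gs: "\<And>l. sm_approximation M X \<mu> (f l) (gs l)" "\<And>l. sm_integral M X \<mu> A (f l) \<in> borel_measurable M"
      "\<And>l. conv_in_prob M (\<lambda>n. sint A (gs l n)) (sm_integral M X \<mu> A (f l))" by metis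
    show ?thesis
      by (rule square_summable_coefficients[OF stochastic_meas_axioms spaceX A f(2,3) gs])
  qed
  have "AE \<omega> in M. summable (\<lambda>l. (block_weight l * sm_integral M X \<mu> A (\<lambda>s. sin (real l * s)) \<omega>)\<^sup>2)"
  proof (rule coefficients)
    fix l :: nat and x y :: real
    show "\<bar>sin (real l * x)\<bar> \<le> 2" using abs_sin_le_one[of "real l * x"] by linarith
    show "\<bar>sin (real l * x) - sin (real l * y)\<bar> \<le> real l * \<bar>x - y\<bar>"
      using sin_lipschitz[of "real l * x" "real l * y"] by (simp add: right_diff_distrib[symmetric] abs_mult)
  qed measurable
  moreover have "AE \<omega> in M. summable (\<lambda>l. (block_weight l * sm_integral M X \<mu> A (\<lambda>s. cos (real l * s) - 1) \<omega>)\<^sup>2)"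
  proof (rule coefficients)
    fix l :: nat and x y :: real
    show "\<bar>cos (real l * x) - 1\<bar> \<le> 2" using abs_cos_le_one[of "real l * x"] by linarith
    show "\<bar>cos (real l * x) - 1 - (cos (real l * y) - 1)\<bar> \<le> real l * \<bar>x - y\<bar>"
      using cos_lipschitz[of "real l * x" "real l * y"] by (simp add: right_diff_distrib[symmetric] abs_mult)
  qed measurable
  moreover have "AE \<omega> in M. \<forall>k\<in>{1..}. \<xi> k \<omega> = - (1 / (real k * pi)) * sm_integral M X \<mu> A (\<lambda>s. sin (real k * s)) \<omega>"
    unfolding A_def by (intro AE_ball_countable[THEN iffD2] ballI \<xi>_k) auto
  moreover have "AE \<omega> in M. \<forall>k\<in>{1..}. \<eta> k \<omega> = 1 / (real k * pi) * sm_integral M X \<mu> A (\<lambda>s. cos (real k * s) - 1) \<omega>"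
    unfolding A_def by (intro AE_ball_countable[THEN iffD2] ballI \<eta>_k) auto
  ultimately have main: "AE \<omega> in M. AE t in lborel. t \<in> {0..2*pi} \<longrightarrow> convergent (\<lambda>n. S n t \<omega>)"
  proof eventually_elim
    case (elim \<omega>)
    have "summable (\<lambda>k. real k powr (3/4) * (\<xi> k \<omega>)\<^sup>2)"
      by (rule weighted_square_summable[OF elim(1)]) (use elim(3) in \<open>simp add: abs_mult\<close>)
    then have "AE t in lborel. t \<in> {0..2*pi} \<longrightarrow> convergent (\<lambda>n. \<Sum>k=1..n. \<xi> k \<omega> * cos (real k * t))"
      by (intro orthogonal_series_converges_AE[where \<kappa> = pi] cos_orthogonal) auto
    moreover have "summable (\<lambda>k. real k powr (3/4) * (\<eta> k \<omega>)\<^sup>2)"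
      by (rule weighted_square_summable[OF elim(2)]) (use elim(4) in \<open>simp add: abs_mult\<close>)
    then have "AE t in lborel. t \<in> {0..2*pi} \<longrightarrow> convergent (\<lambda>n. \<Sum>k=1..n. \<eta> k \<omega> * sin (real k * t))"
      by (intro orthogonal_series_converges_AE[where \<kappa> = pi] cos_orthogonal) auto
    ultimately show ?case
    proof eventually_elim
      case (elim t)
      show ?case
      proof
        assume "t \<in> {0..2*pi}"
        then have "convergent (\<lambda>n. \<xi> 0 \<omega> / 2 + ((\<Sum>k=1..n. \<xi> k \<omega> * cos (real k * t)) + (\<Sum>k=1..n. \<eta> k \<omega> * sin (real k * t))))"
          using elim by (intro convergent_add convergent_const) auto
        then show "convergent (\<lambda>n. S n t \<omega>)" by (simp add: S_def sum.distrib)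
      qed
    qed
  qed
  let ?P = "\<lambda>\<omega>. AE t in lborel. t \<in> {0..2*pi} \<longrightarrow> convergent (\<lambda>n. S n t \<omega>)"
  have "{\<omega> \<in> space M. ?P \<omega>} \<in> events"
  proof (rule in_sets_AE)
    show "AE \<omega> in M. (\<omega> \<in> space M) = (\<omega> \<in> {\<omega> \<in> space M. ?P \<omega>})" using main by eventually_elim auto
  qed auto
  then show ?thesis using main by (simp only: prob_Collect_eq_1)
qed

end
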